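(* Let $\mu,\sigma>0$, $1\le\gamma<2$, and $\nu=\frac{2\mu}{(\gamma-2)\sigma^2}<0$. Then the CEV Fokker--Planck operator $$\mathcal L_\gamma[p]=-\mu\,(xp)'+\Big(\frac{\sigma^2}{2}x^\gamma p\Big)'',\qquad x\in(0,\infty),$$ is in the limit point case at both endpoints $0$ and $\infty$ with respect to the weight $w_\gamma(x)=x^\gamma e^{\nu x^{2-\gamma}}$, and, on its maximal domain, it is self-adjoint on $L^2((0,\infty),w_\gamma)$. Its spectrum is purely discrete and equals $$\sigma(\mathcal L_\gamma)=\{-\mu(2-\gamma)(n+1):n\in\mathbb N\},$$ with corresponding eigenfunctions in $L^2((0,\infty),w_\gamma)$ $$p_n(x)=x^{1-\gamma}L_n^{\frac1{2-\gamma}}(-\nu x^{2-\gamma}),\qquad n\in\mathbb N.$$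
   Context: $\mathbb N$ includes $0$. $L_n^a(y)=\frac{y^{-a}e^y}{n!}\frac{d^n}{dy^n}(e^{-y}y^{n+a})$ is the generalized Laguerre polynomial. In Sturm--Liouville form, $\mathcal L_\gamma[p]=\frac1{w_\gamma}\big[(Q_2p')'+Q_0p\big]$ with $Q_2=\frac{\sigma^2}{2}x^\gamma w_\gamma$ and $Q_0=w_\gamma\big[\frac{\sigma^2}{2}\gamma(\gamma-1)x^{\gamma-2}-\mu\big]$. The maximal domain is the set $\mathcal D_{\max}$ of $p\in L^2((0,\infty),w_\gamma)$ such that $p,\,Q_2p'$ are locally absolutely continuous on $(0,\infty)$ and $\mathcal L_\gamma[p]\in L^2((0,\infty),w_\gamma)$. For $f,g\in\mathcal D_{\max}$ let $W_x(f,g)=Q_2(x)[f(x)g'(x)-f'(x)g(x)]$; an endpoint $e\in\{0,\infty\}$ is limit point if $\lim_{x\to e}W_x(f,g)=0$ for all $f,g\in\mathcal D_{\max}$, and limit circle otherwise. *)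

theory Defs
  imports "HOL-Analysis.Analysis"
begin

section \<open>Square-integrable functions\<close>

text \<open>
  Elements of \<open>L\<^sup>2(M)\<close> are represented by functions; two functions represent the same
  element iff they agree almost everywhere.
\<close>

definition L2 :: "'a measure \<Rightarrow> ('a \<Rightarrow> complex) set" where
  "L2 M = {f \<in> borel_measurable M. integrable M (\<lambda>x. (cmod (f x))\<^sup>2)}"

definition L2_inner :: "'a measure \<Rightarrow> ('a \<Rightarrow> complex) \<Rightarrow> ('a \<Rightarrow> complex) \<Rightarrow> complex" where
  "L2_inner M f g = (LINT x|M. f x * cnj (g x))"

definition L2_norm :: "'a measure \<Rightarrow> ('a \<Rightarrow> complex) \<Rightarrow> real" where
  "L2_norm M f = sqrt (LINT x|M. (cmod (f x))\<^sup>2)"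


section \<open>Unbounded operators on \<open>L\<^sup>2\<close>\<close>

text \<open>
  An operator is given by its graph, a subset of \<open>L2 M \<times> L2 M\<close> that is closed under almost
  everywhere equality in both components, so that it is the preimage of a genuine graph in the
  Hilbert space of equivalence classes.
\<close>

type_synonym 'a op_graph = "(('a \<Rightarrow> complex) \<times> ('a \<Rightarrow> complex)) set"

definition densely_defined :: "'a measure \<Rightarrow> 'a op_graph \<Rightarrow> bool" where
  "densely_defined M T \<longleftrightarrow>
     (\<forall>f\<in>L2 M. \<forall>e>0. \<exists>u\<in>Domain T. L2_norm M (\<lambda>x. f x - u x) < e)"

definition adjoint_op :: "'a measure \<Rightarrow> 'a op_graph \<Rightarrow> 'a op_graph" where
  "adjoint_op M T =
     {(g, k). g \<in> L2 M \<and> k \<in> L2 M \<and> (\<forall>(f, h)\<in>T. L2_inner M h g = L2_inner M f k)}"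

definition self_adjoint_op :: "'a measure \<Rightarrow> 'a op_graph \<Rightarrow> bool" where
  "self_adjoint_op M T \<longleftrightarrow> densely_defined M T \<and> adjoint_op M T = T"

text \<open>
  \<open>z\<close> is in the resolvent set iff \<open>T - z\<close> is a bijection from the domain of \<open>T\<close> onto \<open>L\<^sup>2\<close> with
  bounded inverse; the lower bound expresses both injectivity and boundedness of the inverse.
\<close>

definition resolvent_set_op :: "'a measure \<Rightarrow> 'a op_graph \<Rightarrow> complex set" where
  "resolvent_set_op M T =
     {z. (\<forall>k\<in>L2 M. \<exists>(f, h)\<in>T. AE x in M. h x - z * f x = k x) \<and>
         (\<exists>C. \<forall>(f, h)\<in>T. L2_norm M f \<le> C * L2_norm M (\<lambda>x. h x - z * f x))}"

definition spectrum_op :: "'a measure \<Rightarrow> 'a op_graph \<Rightarrow> complex set" where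
  "spectrum_op M T = - resolvent_set_op M T"

definition eigenfunction_op :: "'a measure \<Rightarrow> 'a op_graph \<Rightarrow> complex \<Rightarrow> ('a \<Rightarrow> complex) \<Rightarrow> bool" where
  "eigenfunction_op M T z f \<longleftrightarrow> (f, \<lambda>x. z * f x) \<in> T \<and> \<not> (AE x in M. f x = 0)"

definition finite_multiplicity_op :: "'a measure \<Rightarrow> 'a op_graph \<Rightarrow> complex \<Rightarrow> bool" where
  "finite_multiplicity_op M T z \<longleftrightarrow>
     (\<exists>B. finite B \<and> (\<forall>f. eigenfunction_op M T z f \<longrightarrow>
        (\<exists>c. AE x in M. f x = (\<Sum>b\<in>B. c b * b x))))"

definition purely_discrete_spectrum :: "'a measure \<Rightarrow> 'a op_graph \<Rightarrow> bool" where
  "purely_discrete_spectrum M T \<longleftrightarrow>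
     (\<forall>z\<in>spectrum_op M T.
        z isolated_in spectrum_op M T \<and>
        (\<exists>f. eigenfunction_op M T z f) \<and>
        finite_multiplicity_op M T z)"


section \<open>Local absolute continuity\<close>

definition abs_continuous_on_Icc :: "real \<Rightarrow> real \<Rightarrow> (real \<Rightarrow> complex) \<Rightarrow> bool" where
  "abs_continuous_on_Icc a b f \<longleftrightarrow>
     (\<forall>e>0. \<exists>d>0. \<forall>D :: (real \<times> real) set.
        finite D \<and> (\<forall>(u, v)\<in>D. a \<le> u \<and> u \<le> v \<and> v \<le> b) \<and>
        pairwise (\<lambda>I J. {fst I<..<snd I} \<inter> {fst J<..<snd J} = {}) D \<and>
        (\<Sum>(u, v)\<in>D. v - u) < d
        \<longrightarrow> (\<Sum>(u, v)\<in>D. cmod (f v - f u)) < e)"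

definition locally_abs_continuous :: "(real \<Rightarrow> complex) \<Rightarrow> bool" where
  "locally_abs_continuous f \<longleftrightarrow> (\<forall>a b. 0 < a \<and> a < b \<longrightarrow> abs_continuous_on_Icc a b f)"


section \<open>The CEV Fokker--Planck operator\<close>

abbreviation vderiv :: "(real \<Rightarrow> complex) \<Rightarrow> real \<Rightarrow> complex" where
  "vderiv f x \<equiv> vector_derivative f (at x)"

definition cev_nu :: "real \<Rightarrow> real \<Rightarrow> real \<Rightarrow> real" where
  "cev_nu \<mu> \<sigma> \<gamma> = 2 * \<mu> / ((\<gamma> - 2) * \<sigma>\<^sup>2)"

definition cev_weight :: "real \<Rightarrow> real \<Rightarrow> real \<Rightarrow> real \<Rightarrow> real" where
  "cev_weight \<mu> \<sigma> \<gamma> x = x powr \<gamma> * exp (cev_nu \<mu> \<sigma> \<gamma> * x powr (2 - \<gamma>))"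

definition cev_measure :: "real \<Rightarrow> real \<Rightarrow> real \<Rightarrow> real measure" where
  "cev_measure \<mu> \<sigma> \<gamma> =
     density (lebesgue_on {0<..}) (\<lambda>x. ennreal (cev_weight \<mu> \<sigma> \<gamma> x))"

definition cev_expr :: "real \<Rightarrow> real \<Rightarrow> real \<Rightarrow> (real \<Rightarrow> complex) \<Rightarrow> real \<Rightarrow> complex" where
  "cev_expr \<mu> \<sigma> \<gamma> p x =
     - of_real \<mu> * vderiv (\<lambda>y. of_real y * p y) x
     + vderiv (vderiv (\<lambda>y. of_real (\<sigma>\<^sup>2 / 2 * y powr \<gamma>) * p y)) x"

definition cev_Q2 :: "real \<Rightarrow> real \<Rightarrow> real \<Rightarrow> real \<Rightarrow> real" where
  "cev_Q2 \<mu> \<sigma> \<gamma> x = \<sigma>\<^sup>2 / 2 * x powr \<gamma> * cev_weight \<mu> \<sigma> \<gamma> x"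

definition cev_Q0 :: "real \<Rightarrow> real \<Rightarrow> real \<Rightarrow> real \<Rightarrow> real" where
  "cev_Q0 \<mu> \<sigma> \<gamma> x =
     cev_weight \<mu> \<sigma> \<gamma> x * (\<sigma>\<^sup>2 / 2 * \<gamma> * (\<gamma> - 1) * x powr (\<gamma> - 2) - \<mu>)"

definition cev_SL_expr :: "real \<Rightarrow> real \<Rightarrow> real \<Rightarrow> (real \<Rightarrow> complex) \<Rightarrow> real \<Rightarrow> complex" where
  "cev_SL_expr \<mu> \<sigma> \<gamma> p x =
     (vderiv (\<lambda>y. of_real (cev_Q2 \<mu> \<sigma> \<gamma> y) * vderiv p y) x + of_real (cev_Q0 \<mu> \<sigma> \<gamma> x) * p x)
     / of_real (cev_weight \<mu> \<sigma> \<gamma> x)"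

text \<open>
  If \<open>p\<close> and \<open>Q\<^sub>2 p'\<close> are locally absolutely continuous, then \<open>p\<close> is continuously differentiable
  because \<open>Q\<^sub>2\<close> is continuous and positive; so \<open>p'\<close> is required to exist on all of \<open>(0,\<infinity>)\<close>.
  The expression \<open>cev_expr\<close> is then meaningful almost everywhere.
\<close>

definition cev_Dmax :: "real \<Rightarrow> real \<Rightarrow> real \<Rightarrow> (real \<Rightarrow> complex) set" where
  "cev_Dmax \<mu> \<sigma> \<gamma> =
     {p \<in> L2 (cev_measure \<mu> \<sigma> \<gamma>).
        locally_abs_continuous p \<and>
        p differentiable_on {0<..} \<and>
        locally_abs_continuous (\<lambda>x. of_real (cev_Q2 \<mu> \<sigma> \<gamma> x) * vderiv p x) \<and>
        cev_expr \<mu> \<sigma> \<gamma> p \<in> L2 (cev_measure \<mu> \<sigma> \<gamma>)}"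

definition cev_op :: "real \<Rightarrow> real \<Rightarrow> real \<Rightarrow> real op_graph" where
  "cev_op \<mu> \<sigma> \<gamma> =
     {(f, h). f \<in> L2 (cev_measure \<mu> \<sigma> \<gamma>) \<and> h \<in> L2 (cev_measure \<mu> \<sigma> \<gamma>) \<and>
        (\<exists>p\<in>cev_Dmax \<mu> \<sigma> \<gamma>.
           (AE x in cev_measure \<mu> \<sigma> \<gamma>. f x = p x) \<and>
           (AE x in cev_measure \<mu> \<sigma> \<gamma>. h x = cev_expr \<mu> \<sigma> \<gamma> p x))}"

definition cev_wronskian ::
  "real \<Rightarrow> real \<Rightarrow> real \<Rightarrow> (real \<Rightarrow> complex) \<Rightarrow> (real \<Rightarrow> complex) \<Rightarrow> real \<Rightarrow> complex" where
  "cev_wronskian \<mu> \<sigma> \<gamma> f g x =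
     of_real (cev_Q2 \<mu> \<sigma> \<gamma> x) * (f x * vderiv g x - vderiv f x * g x)"

text \<open>The endpoint is given by its filter: \<open>at_right 0\<close> for \<open>0\<close> and \<open>at_top\<close> for \<open>\<infinity>\<close>.\<close>

definition cev_limit_point :: "real \<Rightarrow> real \<Rightarrow> real \<Rightarrow> real filter \<Rightarrow> bool" where
  "cev_limit_point \<mu> \<sigma> \<gamma> E \<longleftrightarrow>
     (\<forall>f\<in>cev_Dmax \<mu> \<sigma> \<gamma>. \<forall>g\<in>cev_Dmax \<mu> \<sigma> \<gamma>. (cev_wronskian \<mu> \<sigma> \<gamma> f g \<longlongrightarrow> 0) E)"

definition gen_Laguerre :: "nat \<Rightarrow> real \<Rightarrow> real \<Rightarrow> real" where
  "gen_Laguerre n a y =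
     y powr (- a) * exp y / fact n * (deriv ^^ n) (\<lambda>t. exp (- t) * t powr (real n + a)) y"

definition cev_eigenfun :: "real \<Rightarrow> real \<Rightarrow> real \<Rightarrow> nat \<Rightarrow> real \<Rightarrow> complex" where
  "cev_eigenfun \<mu> \<sigma> \<gamma> n x =
     of_real (x powr (1 - \<gamma>) *
       gen_Laguerre n (1 / (2 - \<gamma>)) (- cev_nu \<mu> \<sigma> \<gamma> * x powr (2 - \<gamma>)))"


section \<open>Consistency of the conventions\<close>

lemma cev_nu_neg:
  assumes "\<mu> > 0" "\<sigma> > 0" "\<gamma> < 2"
  shows "cev_nu \<mu> \<sigma> \<gamma> < 0"
  unfolding cev_nu_def using assms by (intro divide_pos_neg mult_neg_pos) auto

lemma cev_weight_pos: "x > 0 \<Longrightarrow> cev_weight \<mu> \<sigma> \<gamma> x > 0"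
  by (simp add: cev_weight_def)

lemma cev_weight_deriv:
  assumes "\<sigma> \<noteq> 0" "\<gamma> < 2" "x > 0"
  shows "(cev_weight \<mu> \<sigma> \<gamma> has_real_derivative
            cev_weight \<mu> \<sigma> \<gamma> x * (\<gamma> / x - 2 * \<mu> / \<sigma>\<^sup>2 * x powr (1 - \<gamma>))) (at x)"
proof -
  have nu: "cev_nu \<mu> \<sigma> \<gamma> * (2 - \<gamma>) = - 2 * \<mu> / \<sigma>\<^sup>2"
    using assms by (simp add: cev_nu_def divide_simps) (simp add: algebra_simps)
  have "((\<lambda>x. x powr \<gamma> * exp (cev_nu \<mu> \<sigma> \<gamma> * x powr (2 - \<gamma>))) has_real_derivative
          (\<gamma> * x powr (\<gamma> - 1)) * exp (cev_nu \<mu> \<sigma> \<gamma> * x powr (2 - \<gamma>)) +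
          x powr \<gamma> * (exp (cev_nu \<mu> \<sigma> \<gamma> * x powr (2 - \<gamma>)) *
             (cev_nu \<mu> \<sigma> \<gamma> * ((2 - \<gamma>) * x powr (2 - \<gamma> - 1))))) (at x)"
    using assms by (auto intro!: derivative_eq_intros)
  also have "(\<gamma> * x powr (\<gamma> - 1)) * exp (cev_nu \<mu> \<sigma> \<gamma> * x powr (2 - \<gamma>)) +
          x powr \<gamma> * (exp (cev_nu \<mu> \<sigma> \<gamma> * x powr (2 - \<gamma>)) *
             (cev_nu \<mu> \<sigma> \<gamma> * ((2 - \<gamma>) * x powr (2 - \<gamma> - 1)))) =
          cev_weight \<mu> \<sigma> \<gamma> x * (\<gamma> / x + (cev_nu \<mu> \<sigma> \<gamma> * (2 - \<gamma>)) * x powr (1 - \<gamma>))"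
    using assms by (simp add: cev_weight_def powr_diff field_simps)
  finally show ?thesis
    unfolding nu by (simp add: cev_weight_def[abs_def])
qed

text \<open>The Fokker--Planck expression agrees with its Sturm--Liouville form.\<close>

lemma cev_expr_eq_SL:
  assumes "\<sigma> \<noteq> 0" "\<gamma> < 2" "x > 0"
    and p: "p differentiable_on {0<..}"
    and q: "(\<lambda>y. of_real (cev_Q2 \<mu> \<sigma> \<gamma> y) * vderiv p y) differentiable at x"
  shows "cev_expr \<mu> \<sigma> \<gamma> p x = cev_SL_expr \<mu> \<sigma> \<gamma> p x"
proof -
  define w where "w = cev_weight \<mu> \<sigma> \<gamma>"
  have w0: "w y > 0" if "y > 0" for y
    using cev_weight_pos[OF that] by (simp add: w_def)
  have Q0: "cev_Q2 \<mu> \<sigma> \<gamma> y > 0" if "y > 0" for y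
    using w0[OF that] that assms(1) by (simp add: cev_Q2_def w_def)
  have dp: "(p has_vector_derivative vderiv p y) (at y)" if "y > 0" for y
    using p that by (metis at_within_open differentiable_on_def greaterThan_iff open_greaterThan
        vector_derivative_works)
  have dpow: "((\<lambda>y. y powr a) has_real_derivative a * y powr (a - 1)) (at y)"
    if "y > 0" for y a :: real
    using that by (auto intro!: derivative_eq_intros)
  have ofr: "((\<lambda>y. complex_of_real (f y)) has_vector_derivative of_real d) (at y)"
    if "(f has_real_derivative d) (at y)" for f d y
    using has_vector_derivative_of_real[OF that] by simp
  have prod: "((\<lambda>y. complex_of_real (f y) * g y) has_vector_derivative
        of_real (f y) * g' + of_real d * g y) (at y)"
    if "(f has_real_derivative d) (at y)" "(g has_vector_derivative g') (at y)" for f d g g' y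
    using has_vector_derivative_mult[OF ofr[OF that(1)] that(2)] by simp
  define Qd where "Qd = \<sigma>\<^sup>2 / 2 * (\<gamma> * x powr (\<gamma> - 1)) * w x +
      \<sigma>\<^sup>2 / 2 * x powr \<gamma> * (w x * (\<gamma> / x - 2 * \<mu> / \<sigma>\<^sup>2 * x powr (1 - \<gamma>)))"
  have dQ: "(cev_Q2 \<mu> \<sigma> \<gamma> has_real_derivative Qd) (at x)"
    unfolding cev_Q2_def[abs_def] Qd_def w_def
    using assms(3)
    by (auto intro!: derivative_eq_intros cev_weight_deriv[OF assms(1-3)] simp: field_simps)
  have "((\<lambda>y. inverse (cev_Q2 \<mu> \<sigma> \<gamma> y)) has_real_derivative
      - (inverse (cev_Q2 \<mu> \<sigma> \<gamma> x) * Qd * inverse (cev_Q2 \<mu> \<sigma> \<gamma> x))) (at x)"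
    using DERIV_inverse'[OF dQ] Q0[OF assms(3)] by simp
  from prod[OF this q[unfolded vector_derivative_works]] obtain d0 where
    "((\<lambda>y. complex_of_real (inverse (cev_Q2 \<mu> \<sigma> \<gamma> y)) * (of_real (cev_Q2 \<mu> \<sigma> \<gamma> y) * vderiv p y))
      has_vector_derivative d0) (at x)"
    by blast
  then have dq: "(vderiv p has_vector_derivative d0) (at x)"
    by (rule has_vector_derivative_transform_within_open[where S = "{0<..}"])
       (use assms(3) Q0 in \<open>auto simp: less_imp_neq[THEN not_sym]\<close>)
  have A: "vderiv (\<lambda>y. of_real y * p y) x = of_real x * vderiv p x + p x"
    using prod[OF DERIV_ident dp[OF assms(3)]] by (intro vector_derivative_at) simp
  have B: "vderiv (\<lambda>y. of_real (\<sigma>\<^sup>2 / 2 * y powr \<gamma>) * p y) y =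
      of_real (\<sigma>\<^sup>2 / 2 * y powr \<gamma>) * vderiv p y +
      of_real (\<sigma>\<^sup>2 / 2 * (\<gamma> * y powr (\<gamma> - 1))) * p y" if "y > 0" for y
    by (rule vector_derivative_at[OF prod[OF DERIV_cmult[OF dpow[OF that]] dp[OF that]]])
  have "((\<lambda>y. of_real (\<sigma>\<^sup>2 / 2 * y powr \<gamma>) * vderiv p y +
      of_real (\<sigma>\<^sup>2 / 2 * (\<gamma> * y powr (\<gamma> - 1))) * p y) has_vector_derivative
      (of_real (\<sigma>\<^sup>2 / 2 * x powr \<gamma>) * d0 + of_real (\<sigma>\<^sup>2 / 2 * (\<gamma> * x powr (\<gamma> - 1))) * vderiv p x) +
      (of_real (\<sigma>\<^sup>2 / 2 * (\<gamma> * x powr (\<gamma> - 1))) * vderiv p x +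
       of_real (\<sigma>\<^sup>2 / 2 * (\<gamma> * ((\<gamma> - 1) * x powr (\<gamma> - 1 - 1)))) * p x)) (at x)"
    by (intro has_vector_derivative_add prod DERIV_cmult dpow dp dq assms)
  then have "(vderiv (\<lambda>y. of_real (\<sigma>\<^sup>2 / 2 * y powr \<gamma>) * p y) has_vector_derivative
      (of_real (\<sigma>\<^sup>2 / 2 * x powr \<gamma>) * d0 + of_real (\<sigma>\<^sup>2 / 2 * (\<gamma> * x powr (\<gamma> - 1))) * vderiv p x) +
      (of_real (\<sigma>\<^sup>2 / 2 * (\<gamma> * x powr (\<gamma> - 1))) * vderiv p x +
       of_real (\<sigma>\<^sup>2 / 2 * (\<gamma> * ((\<gamma> - 1) * x powr (\<gamma> - 1 - 1)))) * p x)) (at x)"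
    by (rule has_vector_derivative_transform_within_open[where S = "{0<..}"])
       (use assms(3) B in auto)
  note C = vector_derivative_at[OF this]
  have D: "vderiv (\<lambda>y. of_real (cev_Q2 \<mu> \<sigma> \<gamma> y) * vderiv p y) x =
      of_real (cev_Q2 \<mu> \<sigma> \<gamma> x) * d0 + of_real Qd * vderiv p x"
    by (rule vector_derivative_at[OF prod[OF dQ dq]])
  have Qd: "Qd = w x * (\<sigma>\<^sup>2 * \<gamma> * x powr (\<gamma> - 1) - \<mu> * x)"
  proof -
    have "x powr \<gamma> * (\<gamma> / x) = \<gamma> * x powr (\<gamma> - 1)"
      using assms(3) by (simp add: powr_diff)
    moreover have "x powr \<gamma> * x powr (1 - \<gamma>) = x"
      using assms(3) by (simp flip: powr_add)
    moreover have "Qd = w x * (\<sigma>\<^sup>2 / 2 * (\<gamma> * x powr (\<gamma> - 1)) +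
        \<sigma>\<^sup>2 / 2 * (x powr \<gamma> * (\<gamma> / x)) - \<mu> * (x powr \<gamma> * x powr (1 - \<gamma>)))"
      unfolding Qd_def using assms(1,3) by (simp add: field_simps)
    ultimately show ?thesis by (simp add: algebra_simps)
  qed
  have wn: "complex_of_real (w x) \<noteq> 0" using w0[OF assms(3)] by simp
  have "cev_SL_expr \<mu> \<sigma> \<gamma> p x = of_real (\<sigma>\<^sup>2 / 2 * x powr \<gamma>) * d0 +
      of_real (\<sigma>\<^sup>2 * \<gamma> * x powr (\<gamma> - 1) - \<mu> * x) * vderiv p x +
      of_real (\<sigma>\<^sup>2 / 2 * \<gamma> * (\<gamma> - 1) * x powr (\<gamma> - 2) - \<mu>) * p x"
  proof -
    have "cev_SL_expr \<mu> \<sigma> \<gamma> p x = (of_real (w x) * (of_real (\<sigma>\<^sup>2 / 2 * x powr \<gamma>) * d0 +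
      of_real (\<sigma>\<^sup>2 * \<gamma> * x powr (\<gamma> - 1) - \<mu> * x) * vderiv p x +
      of_real (\<sigma>\<^sup>2 / 2 * \<gamma> * (\<gamma> - 1) * x powr (\<gamma> - 2) - \<mu>) * p x)) / of_real (w x)"
      unfolding cev_SL_expr_def D
      unfolding Qd cev_Q2_def cev_Q0_def w_def[symmetric]
      by (simp add: algebra_simps)
    then show ?thesis using wn by simp
  qed
  also have "\<dots> = cev_expr \<mu> \<sigma> \<gamma> p x"
    unfolding cev_expr_def A C by (simp add: field_simps)
  finally show ?thesis ..
qed

end

theory Submission
  imports Defs "HOL-Real_Asymp.Real_Asymp"
begin

text \<open>
  Write \<open>w\<close> for the weight, \<open>m = 1 / w\<close>, \<open>y = \<alpha> x\<^sup>2\<^sup>-\<^sup>\<gamma>\<close> with \<open>\<alpha> = - \<nu> > 0\<close>, and \<open>s = (2 / \<sigma>\<^sup>2) e\<^sup>-\<^sup>y\<close>.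
  For \<open>u = w p\<close> and the probability flux \<open>J = (\<sigma>\<^sup>2/2 x\<^sup>\<gamma> p)' - \<mu> x p\<close> the equation \<open>L p = k\<close> becomes the
  first-order system \<open>u' = s J\<close>, \<open>J' = k\<close> (\<open>Dmax_primitives\<close>, \<open>Dmax_of_primitives\<close>).  It is the
  backward (Kolmogorov) form of the operator, with scale density \<open>s\<close> and speed density \<open>m\<close>, and the
  Wronskian of \<open>f\<close> and \<open>g\<close> is \<open>u\<^sub>f J\<^sub>g - J\<^sub>f u\<^sub>g\<close>.  Going back and forth between the operator and the
  system requires that absolutely continuous functions are exactly the indefinite integrals; the
  first two sections prove this.

  At either endpoint the function \<open>1\<close> solves the homogeneous equation for \<open>u\<close> and is not
  square integrable with respect to \<open>m\<close>, while a second solution \<open>S\<close>, tending to zero there, is.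
  The combination \<open>B = u + S J\<close> satisfies \<open>B' = S k\<close>, so \<open>B\<close> has a limit, and this limit must be \<open>0\<close>
  because \<open>u\<close> is square integrable and \<open>1\<close> is not; hence \<open>\<bar>B(x)\<bar>\<^sup>2 \<le> K \<sigma>(x)\<close>, where \<open>\<sigma>(x)\<close> is the integral
  of \<open>S\<^sup>2 m\<close> between \<open>x\<close> and the endpoint.  Since \<open>S W = u\<^sub>f B\<^sub>g - B\<^sub>f u\<^sub>g\<close>, a nonzero limit of the
  Wronskian \<open>W\<close> would force the tails of \<open>(\<bar>u\<^sub>f\<bar>\<^sup>2 + \<bar>u\<^sub>g\<bar>\<^sup>2) m\<close> to stay away from zero.  This is
  \<open>wronskian_tendsto\<close>; it gives the limit point property at both endpoints and, by Green's identity,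
  the symmetry of the maximal operator.

  The rest is diagonalisation.  The Rodrigues functions \<open>v = d\<^sup>n/dy\<^sup>n (e\<^sup>-\<^sup>y y\<^sup>n\<^sup>+\<^sup>a)\<close> with \<open>a = 1 / (2 - \<gamma>)\<close>
  satisfy a second-order recurrence which says precisely that the functions \<open>p\<^sub>n\<close> are eigenfunctions.
  They are total: a function orthogonal to all of them has vanishing moments
  in \<open>y\<close>, hence vanishing exponential moments, and is zero by the Weierstrass theorem
  (\<open>eigenfun_total\<close>).  The maximal operator is closed (\<open>cev_op_closed\<close>), because the system can be
  integrated explicitly from \<open>x = 1\<close>.  A closed symmetric operator with a total orthogonal system of
  eigenvectors is diagonal in that system, so it is self-adjoint and its spectrum is the discrete set of
  eigenvalues (locale \<open>diagonal_operator\<close>).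
\<close>

section \<open>Lebesgue differentiation and total variation\<close>

text \<open>
  The one-sided statement \<open>integrable_ccontinuous_explicit\<close> gives the right derivative; applied to
  \<open>f (- x)\<close> it gives the left derivative.
\<close>

lemma lebesgue_differentiation:
  fixes f :: "real \<Rightarrow> 'b::euclidean_space"
  assumes f: "f integrable_on {a..b}"
  obtains N where "negligible N"
    "\<And>x. x \<in> {a<..<b} - N \<Longrightarrow> ((\<lambda>x. integral {a..x} f) has_vector_derivative f x) (at x)"
proof -
  define g where "g = (\<lambda>x. if x \<in> {a..b} then f x else 0)"
  have gU: "g integrable_on UNIV"
    unfolding g_def using f unfolding integrable_restrict_UNIV .
  have gi: "g integrable_on {u..v}" for u v
    using integrable_on_subinterval[OF gU] by simp
  have gr: "(\<lambda>x. g (- x)) integrable_on {u..v}" for u v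
    using Henstock_Kurzweil_Integration.integrable_reflect_real[where f=g and a="-v" and b="-u"] gi by simp
  obtain N1 where N1: "negligible N1" and r1: "\<And>x e. \<lbrakk>x \<notin> N1; 0 < e\<rbrakk> \<Longrightarrow>
      \<exists>d>0. \<forall>h. 0 < h \<and> h < d \<longrightarrow> norm (integral (cbox x (x + h *\<^sub>R One)) g /\<^sub>R h ^ DIM(real) - g x) < e"
    using integrable_ccontinuous_explicit[of g] gi by (metis cbox_interval)
  obtain N2 where N2: "negligible N2" and r2: "\<And>x e. \<lbrakk>x \<notin> N2; 0 < e\<rbrakk> \<Longrightarrow>
      \<exists>d>0. \<forall>h. 0 < h \<and> h < d \<longrightarrow> norm (integral (cbox x (x + h *\<^sub>R One)) (\<lambda>x. g (- x)) /\<^sub>R h ^ DIM(real) - g (- x)) < e"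
    using integrable_ccontinuous_explicit[of "\<lambda>x. g (- x)"] gr by (metis cbox_interval)
  have N2': "negligible (uminus ` N2)"
    by (auto intro!: negligible_differentiable_image_negligible N2 derivative_intros)
  show ?thesis
  proof (rule that)
    show "negligible (N1 \<union> uminus ` N2)" using N1 N2' by simp
    fix x assume x: "x \<in> {a<..<b} - (N1 \<union> uminus ` N2)"
    then have xn: "x \<notin> N1" "- x \<notin> N2" and xab: "a < x" "x < b"
      by (auto simp: image_iff)
    have gx: "g x = f x" using xab by (simp add: g_def)
    have gint: "integral {u..v} g = integral {u..v} f" if "a \<le> u" "v \<le> b" for u v
      using that by (intro integral_cong) (auto simp: g_def)
    show "((\<lambda>x. integral {a..x} f) has_vector_derivative f x) (at x)"
      unfolding has_vector_derivative_def has_derivative_at_alt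
    proof (intro conjI allI impI)
      show "bounded_linear (\<lambda>h. h *\<^sub>R f x)" by (rule bounded_linear_scaleR_left)
      fix e :: real assume e: "e > 0"
      obtain d1 where d1: "d1 > 0" and D1: "\<And>h. 0 < h \<Longrightarrow> h < d1 \<Longrightarrow>
          norm (integral {x..x + h} g /\<^sub>R h - f x) < e"
        using r1[OF xn(1) e] gx by auto
      obtain d2 where d2: "d2 > 0" and D2: "\<And>h. 0 < h \<Longrightarrow> h < d2 \<Longrightarrow>
          norm (integral {-x..-x + h} (\<lambda>x. g (- x)) /\<^sub>R h - f x) < e"
        using r2[OF xn(2) e] gx by auto
      define d where "d = Min {d1, d2, x - a, b - x}"
      have d: "d > 0" "d \<le> d1" "d \<le> d2" "d \<le> x - a" "d \<le> b - x"
        using d1 d2 xab by (auto simp: d_def)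
      show "\<exists>d>0. \<forall>y. norm (y - x) < d \<longrightarrow>
        norm (integral {a..y} f - integral {a..x} f - (y - x) *\<^sub>R f x) \<le> e * norm (y - x)"
      proof (intro exI[of _ d] conjI allI impI d(1))
        fix y assume y: "norm (y - x) < d"
        then have yab: "a \<le> y" "y \<le> b" using d by auto
        have fi: "f integrable_on {u..v}" if "a \<le> u" "v \<le> b" for u v
          using integrable_on_subinterval[OF f] that by simp
        consider "y = x" | "y > x" | "y < x" by linarith
        then show "norm (integral {a..y} f - integral {a..x} f - (y - x) *\<^sub>R f x) \<le> e * norm (y - x)"
        proof cases
          case 2
          define h where "h = y - x"
          have h: "0 < h" "h < d1" using 2 y d by (auto simp: h_def)
          have "integral {a..x} f + integral {x..y} f = integral {a..y} f"
            using 2 xab yab by (intro Henstock_Kurzweil_Integration.integral_combine fi) auto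
          then have "integral {a..y} f - integral {a..x} f - (y - x) *\<^sub>R f x = integral {x..x+h} g - h *\<^sub>R f x"
            using gint[of x y] xab yab by (simp add: h_def algebra_simps)
          also have "\<dots> = h *\<^sub>R (integral {x..x + h} g /\<^sub>R h - f x)"
            using h by (simp add: scaleR_diff_right)
          finally show ?thesis using D1[OF h] h by (simp add: h_def)
        next
          case 3
          define h where "h = x - y"
          have h: "0 < h" "h < d2" using 3 y d by (auto simp: h_def)
          have "integral {a..y} f + integral {y..x} f = integral {a..x} f"
            using 3 xab yab by (intro Henstock_Kurzweil_Integration.integral_combine fi) auto
          moreover have "integral {-x..-x+h} (\<lambda>x. g (- x)) = integral {y..x} f"
            using gint[of y x] xab yab Henstock_Kurzweil_Integration.integral_reflect_real[of x y g] by (simp add: h_def)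
          ultimately have "integral {a..y} f - integral {a..x} f - (y - x) *\<^sub>R f x = - (integral {-x..-x+h} (\<lambda>x. g (- x)) - h *\<^sub>R f x)"
            by (simp add: h_def algebra_simps)
          also have "\<dots> = - (h *\<^sub>R (integral {-x..-x+h} (\<lambda>x. g (- x)) /\<^sub>R h - f x))"
            using h by (simp add: scaleR_diff_right)
          finally show ?thesis using D2[OF h] h by (simp add: h_def)
        qed simp
      qed
    qed
  qed
qed

text \<open>
  The families of the definition of absolute continuity, without degenerate intervals: then a
  family is determined by its left endpoints, and families on adjacent intervals are disjoint sets.
\<close>

definition subintervals :: "real \<Rightarrow> real \<Rightarrow> (real \<times> real) set set" where
  "subintervals a b = {D. finite D \<and> (\<forall>(u, v)\<in>D. a \<le> u \<and> u < v \<and> v \<le> b) \<and>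
     pairwise (\<lambda>I J. {fst I<..<snd I} \<inter> {fst J<..<snd J} = {}) D}"

definition variation_on :: "(real \<Rightarrow> complex) \<Rightarrow> (real \<times> real) set \<Rightarrow> real" where
  "variation_on F D = (\<Sum>(u, v)\<in>D. cmod (F v - F u))"

lemma subintervalsD:
  assumes "D \<in> subintervals a b"
  shows "finite D" "\<And>u v. (u, v) \<in> D \<Longrightarrow> a \<le> u \<and> u < v \<and> v \<le> b"
    "pairwise (\<lambda>I J. {fst I<..<snd I} \<inter> {fst J<..<snd J} = {}) D"
  using assms unfolding subintervals_def by auto

lemma disjoint_open_intervals_iff:
  fixes u v u' v' :: real
  assumes "u < v" "u' < v'"
  shows "{u<..<v} \<inter> {u'<..<v'} = {} \<longleftrightarrow> v \<le> u' \<or> v' \<le> u"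
proof
  assume *: "{u<..<v} \<inter> {u'<..<v'} = {}"
  show "v \<le> u' \<or> v' \<le> u"
  proof (rule ccontr)
    assume "\<not> ?thesis"
    then have "(max u u' + min v v') / 2 \<in> {u<..<v} \<inter> {u'<..<v'}"
      using assms by (auto simp: max_def min_def field_simps)
    with * show False by blast
  qed
qed auto

lemma subintervals_iff:
  "D \<in> subintervals a b \<longleftrightarrow> finite D \<and> (\<forall>(u, v)\<in>D. a \<le> u \<and> u < v \<and> v \<le> b) \<and>
     (\<forall>(u, v)\<in>D. \<forall>(u', v')\<in>D. (u, v) \<noteq> (u', v') \<longrightarrow> v \<le> u' \<or> v' \<le> u)"
  unfolding subintervals_def pairwise_def
  using disjoint_open_intervals_iff by (auto 0 4 simp: split_beta)

lemma sum_length_le: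
  assumes D: "D \<in> subintervals a b" and "a \<le> b"
  shows "(\<Sum>(u, v)\<in>D. v - u) \<le> b - a"
proof -
  have "(\<Sum>(u, v)\<in>D. v - u) = (\<Sum>I\<in>D. measure lebesgue {fst I<..<snd I})"
    using subintervalsD(2)[OF D] by (intro sum.cong) (auto simp: less_imp_le)
  also have "\<dots> = measure lebesgue (\<Union>I\<in>D. {fst I<..<snd I})"
    using subintervalsD[OF D] by (intro measure_UNION'[symmetric]) (auto simp: pairwise_def disjnt_def)
  also have "\<dots> \<le> measure lebesgue {a..b}"
  proof (rule measure_mono_fmeasurable)
    show "(\<Union>I\<in>D. {fst I<..<snd I}) \<subseteq> {a..b}"
      using subintervalsD(2)[OF D] by fastforce
    show "(\<Union>I\<in>D. {fst I<..<snd I}) \<in> sets lebesgue"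
      using subintervalsD(1)[OF D] by auto
  qed auto
  finally show ?thesis using \<open>a \<le> b\<close> by simp
qed

lemma subintervals_sep:
  "D \<in> subintervals a b \<Longrightarrow> (u, v) \<in> D \<Longrightarrow> (u', v') \<in> D \<Longrightarrow> (u, v) \<noteq> (u', v') \<Longrightarrow> v \<le> u' \<or> v' \<le> u"
  unfolding subintervals_iff by blast

lemma subintervalsI:
  assumes "finite D" "\<And>u v. (u, v) \<in> D \<Longrightarrow> a \<le> u \<and> u < v \<and> v \<le> b"
    "\<And>u v u' v'. (u, v) \<in> D \<Longrightarrow> (u', v') \<in> D \<Longrightarrow> (u, v) \<noteq> (u', v') \<Longrightarrow> v \<le> u' \<or> v' \<le> u"
  shows "D \<in> subintervals a b"
  unfolding subintervals_iff using assms by blast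

lemma subintervals_Un:
  assumes D1: "D1 \<in> subintervals a b" and D2: "D2 \<in> subintervals b c" and abc: "a \<le> b" "b \<le> c"
  shows "D1 \<union> D2 \<in> subintervals a c" "D1 \<inter> D2 = {}"
proof -
  show "D1 \<union> D2 \<in> subintervals a c"
  proof (rule subintervalsI)
    show "finite (D1 \<union> D2)" using subintervalsD(1)[OF D1] subintervalsD(1)[OF D2] by simp
    fix u v assume *: "(u, v) \<in> D1 \<union> D2"
    then show "a \<le> u \<and> u < v \<and> v \<le> c"
      using subintervalsD(2)[OF D1, of u v] subintervalsD(2)[OF D2, of u v] abc by auto
    fix u' v' assume "(u', v') \<in> D1 \<union> D2" "(u, v) \<noteq> (u', v')"
    then show "v \<le> u' \<or> v' \<le> u"
      using * subintervalsD(2)[OF D1, of u v] subintervalsD(2)[OF D2, of u v]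
        subintervalsD(2)[OF D1, of u' v'] subintervalsD(2)[OF D2, of u' v']
        subintervals_sep[OF D1, of u v u' v'] subintervals_sep[OF D2, of u v u' v'] by auto
  qed
  show "D1 \<inter> D2 = {}"
    using subintervalsD(2)[OF D1] subintervalsD(2)[OF D2] by force
qed

text \<open>
  Cutting every interval of the family at \<open>b\<close>; an interval that contains \<open>b\<close> is the only
  source of the inequality.
\<close>

lemma subintervals_split:
  assumes D: "D \<in> subintervals a c" and b: "a \<le> b" "b \<le> c"
  obtains D1 D2 where "D1 \<in> subintervals a b" "D2 \<in> subintervals b c"
    "variation_on F D \<le> variation_on F D1 + variation_on F D2"
proof -
  define f where "f = (\<lambda>(u::real, v). (u, min v b))"
  define g where "g = (\<lambda>(u, v::real). (max u b, v))"
  define A where "A = {I\<in>D. fst I < b}"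
  define B where "B = {I\<in>D. b < snd I}"
  note d = subintervalsD(2)[OF D] and sep = subintervals_sep[OF D]
  have fin: "finite A" "finite B" using subintervalsD(1)[OF D] by (auto simp: A_def B_def)
  have injf: "inj_on f A"
  proof (rule inj_onI, clarify)
    fix u v u' v' assume "(u, v) \<in> A" "(u', v') \<in> A" "f (u, v) = f (u', v')"
    then show "u = u' \<and> v = v'"
      using d[of u v] d[of u' v'] sep[of u v u' v'] by (auto simp: f_def A_def)
  qed
  have injg: "inj_on g B"
  proof (rule inj_onI, clarify)
    fix u v u' v' assume "(u, v) \<in> B" "(u', v') \<in> B" "g (u, v) = g (u', v')"
    then show "u = u' \<and> v = v'"
      using d[of u v] d[of u' v'] sep[of u v u' v'] by (auto simp: g_def B_def)
  qed
  have 1: "f ` A \<in> subintervals a b"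
  proof (rule subintervalsI)
    show "finite (f ` A)" using fin by simp
    fix x y assume "(x, y) \<in> f ` A"
    then obtain v where v: "(x, v) \<in> D" "x < b" "y = min v b" by (auto simp: f_def A_def)
    then show "a \<le> x \<and> x < y \<and> y \<le> b" using d[of x v] by auto
    fix x' y' assume "(x', y') \<in> f ` A" and ne: "(x, y) \<noteq> (x', y')"
    then obtain v' where v': "(x', v') \<in> D" "x' < b" "y' = min v' b" by (auto simp: f_def A_def)
    have "(x, v) \<noteq> (x', v')" using ne v v' by auto
    then show "y \<le> x' \<or> y' \<le> x" using v v' sep[of x v x' v'] by linarith
  qed
  have 2: "g ` B \<in> subintervals b c"
  proof (rule subintervalsI)
    show "finite (g ` B)" using fin by simp
    fix x y assume "(x, y) \<in> g ` B"
    then obtain v where v: "(v, y) \<in> D" "b < y" "x = max v b" by (auto simp: g_def B_def)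
    then show "b \<le> x \<and> x < y \<and> y \<le> c" using d[of v y] by auto
    fix x' y' assume "(x', y') \<in> g ` B" and ne: "(x, y) \<noteq> (x', y')"
    then obtain v' where v': "(v', y') \<in> D" "b < y'" "x' = max v' b" by (auto simp: g_def B_def)
    have "(v, y) \<noteq> (v', y')" using ne v v' by auto
    then show "y \<le> x' \<or> y' \<le> x" using v v' sep[of v y v' y'] by linarith
  qed
  have "variation_on F D \<le> (\<Sum>I\<in>D. (if I \<in> A then cmod (F (snd (f I)) - F (fst (f I))) else 0)
        + (if I \<in> B then cmod (F (snd (g I)) - F (fst (g I))) else 0))"
    unfolding variation_on_def
  proof (rule sum_mono)
    fix I assume "I \<in> D"
    obtain u v where I: "I = (u, v)" by force
    have uv: "u < v" using \<open>I \<in> D\<close> d[of u v] I by auto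
    have tri: "cmod (F v - F u) \<le> cmod (F b - F u) + cmod (F v - F b)"
      using norm_triangle_ineq[of "F b - F u" "F v - F b"] by simp
    consider "v \<le> b" | "b \<le> u" | "u < b" "b < v" by linarith
    then show "(case I of (u, v) \<Rightarrow> cmod (F v - F u)) \<le> (if I \<in> A then cmod (F (snd (f I)) - F (fst (f I))) else 0)
        + (if I \<in> B then cmod (F (snd (g I)) - F (fst (g I))) else 0)"
      using uv tri \<open>I \<in> D\<close> by cases (simp_all add: I A_def B_def f_def g_def)
  qed
  also have "\<dots> = (\<Sum>I\<in>A. cmod (F (snd (f I)) - F (fst (f I)))) + (\<Sum>I\<in>B. cmod (F (snd (g I)) - F (fst (g I))))"
  proof -
    have "D \<inter> A = A" "D \<inter> B = B" by (auto simp: A_def B_def)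
    then show ?thesis using subintervalsD(1)[OF D] by (simp add: sum.distrib flip: sum.inter_restrict)
  qed
  also have "\<dots> = variation_on F (f ` A) + variation_on F (g ` B)"
    unfolding variation_on_def by (simp add: sum.reindex injf injg split_beta)
  finally show ?thesis by (rule that[OF 1 2])
qed

lemma ac_subintervals:
  assumes "abs_continuous_on_Icc a b F" "e > 0"
  obtains d where "d > 0" "\<And>D. D \<in> subintervals a b \<Longrightarrow> (\<Sum>(u, v)\<in>D. v - u) < d \<Longrightarrow> variation_on F D < e"
proof -
  obtain d where d: "d > 0" "\<And>D :: (real \<times> real) set.
        finite D \<Longrightarrow> (\<forall>(u, v)\<in>D. a \<le> u \<and> u \<le> v \<and> v \<le> b) \<Longrightarrow>
        pairwise (\<lambda>I J. {fst I<..<snd I} \<inter> {fst J<..<snd J} = {}) D \<Longrightarrow>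
        (\<Sum>(u, v)\<in>D. v - u) < d
        \<Longrightarrow> (\<Sum>(u, v)\<in>D. cmod (F v - F u)) < e"
    using assms unfolding abs_continuous_on_Icc_def by meson
  show ?thesis
    by (rule that[OF d(1)], unfold variation_on_def, rule d(2))
       (auto simp: subintervals_def less_imp_le)
qed

lemma ac_subintervalsI:
  assumes "\<And>e. e > 0 \<Longrightarrow> \<exists>d>0. \<forall>D\<in>subintervals a b. (\<Sum>(u, v)\<in>D. v - u) < d \<longrightarrow> variation_on F D < e"
  shows "abs_continuous_on_Icc a b F"
  unfolding abs_continuous_on_Icc_def
proof (intro allI impI)
  fix e :: real assume "e > 0"
  then obtain d where d: "d > 0" "\<And>D. D \<in> subintervals a b \<Longrightarrow> (\<Sum>(u, v)\<in>D. v - u) < d \<Longrightarrow> variation_on F D < e"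
    using assms by meson
  show "\<exists>d>0. \<forall>D :: (real \<times> real) set.
        finite D \<and> (\<forall>(u, v)\<in>D. a \<le> u \<and> u \<le> v \<and> v \<le> b) \<and>
        pairwise (\<lambda>I J. {fst I<..<snd I} \<inter> {fst J<..<snd J} = {}) D \<and>
        (\<Sum>(u, v)\<in>D. v - u) < d
        \<longrightarrow> (\<Sum>(u, v)\<in>D. cmod (F v - F u)) < e"
  proof (intro exI[of _ d] conjI d(1) allI impI, elim conjE)
    fix D :: "(real \<times> real) set"
    assume D: "finite D" "\<forall>(u, v)\<in>D. a \<le> u \<and> u \<le> v \<and> v \<le> b"
      "pairwise (\<lambda>I J. {fst I<..<snd I} \<inter> {fst J<..<snd J} = {}) D" "(\<Sum>(u, v)\<in>D. v - u) < d"
    define D' where "D' = {I\<in>D. fst I < snd I}"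
    have sub: "D' \<subseteq> D" by (auto simp: D'_def)
    have eq: "fst I = snd I" if "I \<in> D - D'" for I
      using that D(2) by (force simp: D'_def)
    have "D' \<in> subintervals a b"
      using D finite_subset[OF sub] pairwise_subset[OF D(3) sub]
      unfolding subintervals_def D'_def by auto
    moreover have "(\<Sum>(u, v)\<in>D'. v - u) = (\<Sum>(u, v)\<in>D. v - u)"
      using D(1) sub eq by (intro sum.mono_neutral_left) (auto simp: split_beta)
    moreover have "variation_on F D' = (\<Sum>(u, v)\<in>D. cmod (F v - F u))"
      unfolding variation_on_def using D(1) sub eq
      by (intro sum.mono_neutral_left) (auto simp: split_beta)
    ultimately show "(\<Sum>(u, v)\<in>D. cmod (F v - F u)) < e"
      using d(2) D(4) by metis
  qed
qed

text \<open>
  Absolute continuity for \<open>e = 1\<close> bounds the variation by \<open>1\<close> on every interval of length less than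
  some \<open>d\<close>, and finitely many such intervals make up \<open>[a, b]\<close>.
\<close>

lemma ac_bounded_variation:
  assumes F: "abs_continuous_on_Icc a b F" and ab: "a \<le> b"
  obtains K where "\<And>D. D \<in> subintervals a b \<Longrightarrow> variation_on F D \<le> K"
proof -
  obtain d where d: "d > 0" "\<And>D. D \<in> subintervals a b \<Longrightarrow> (\<Sum>(u, v)\<in>D. v - u) < d \<Longrightarrow> variation_on F D < 1"
    using ac_subintervals[OF F, of 1] by auto
  have *: "\<exists>K. \<forall>D\<in>subintervals a y. variation_on F D \<le> K"
    if "a \<le> y" "y \<le> b" "y \<le> a + real n * (d / 2)" for n y
    using that
  proof (induction n arbitrary: y)
    case 0
    have "variation_on F D \<le> 0" if "D \<in> subintervals a y" for D
    proof -
      have "D = {}" using subintervalsD(2)[OF that] 0 by force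
      then show ?thesis by (simp add: variation_on_def)
    qed
    then show ?case by blast
  next
    case (Suc n)
    define y' where "y' = max a (y - d / 2)"
    have "real (Suc n) * (d / 2) = real n * (d / 2) + d / 2" by (simp add: field_simps)
    with Suc.prems(3) have "y - d / 2 \<le> a + real n * (d / 2)" by linarith
    then have y': "a \<le> y'" "y' \<le> y" "y' \<le> b" "y - y' \<le> d / 2" "y' \<le> a + real n * (d / 2)"
      using Suc.prems d by (auto simp: y'_def max_def)
    obtain K where K: "\<And>D. D \<in> subintervals a y' \<Longrightarrow> variation_on F D \<le> K"
      using Suc.IH[OF y'(1,3,5)] by blast
    have "variation_on F D \<le> K + 1" if D: "D \<in> subintervals a y" for D
    proof -
      obtain D1 D2 where 1: "D1 \<in> subintervals a y'" "D2 \<in> subintervals y' y"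
        "variation_on F D \<le> variation_on F D1 + variation_on F D2"
        using subintervals_split[OF D y'(1,2)] by metis
      have "D2 \<in> subintervals a b"
        using 1(2) y' Suc.prems unfolding subintervals_def by fastforce
      moreover have "(\<Sum>(u, v)\<in>D2. v - u) < d"
        using sum_length_le[OF 1(2) y'(2)] y' d by linarith
      ultimately have "variation_on F D2 < 1" using d(2) by blast
      with 1 K show ?thesis by fastforce
    qed
    then show ?case by blast
  qed
  obtain n :: nat where "(b - a) / (d / 2) < real n" using reals_Archimedean2 by blast
  then have "b \<le> a + real n * (d / 2)" using d by (simp add: field_simps)
  from *[OF ab order_refl this] that show ?thesis by blast
qed

text \<open>
  The dominating function \<open>G\<close> is the total variation of \<open>F\<close> on \<open>[a, x]\<close>.  It reduces statements
  about complex functions to monotone ones, because \<open>G\<close>, \<open>G - Re F\<close> and \<open>G - Im F\<close> all increase.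
\<close>

lemma ac_variation:
  assumes F: "abs_continuous_on_Icc a b F" and ab: "a \<le> b"
  obtains G :: "real \<Rightarrow> real" where
    "abs_continuous_on_Icc a b (\<lambda>x. of_real (G x))"
    "\<And>u v. a \<le> u \<Longrightarrow> u \<le> v \<Longrightarrow> v \<le> b \<Longrightarrow> cmod (F v - F u) \<le> G v - G u"
proof -
  obtain K where K: "\<And>D. D \<in> subintervals a b \<Longrightarrow> variation_on F D \<le> K"
    using ac_bounded_variation[OF F ab] by blast
  define V where "V u v = (SUP D\<in>subintervals u v. variation_on F D)" for u v
  have mono: "subintervals u v \<subseteq> subintervals a b" if "a \<le> u" "v \<le> b" for u v
    using that unfolding subintervals_def by fastforce
  have bdd: "bdd_above (variation_on F ` subintervals u v)" if "a \<le> u" "v \<le> b" for u v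
    using mono[OF that] K by (intro bdd_aboveI[of _ K]) auto
  have emp: "{} \<in> subintervals u v" for u v by (simp add: subintervals_def)
  have Vup: "variation_on F D \<le> V u v" if "D \<in> subintervals u v" "a \<le> u" "v \<le> b" for D u v
    unfolding V_def using that bdd by (intro cSUP_upper) auto
  have Vleast: "V u v \<le> B" if "\<And>D. D \<in> subintervals u v \<Longrightarrow> variation_on F D \<le> B" for u v B
    unfolding V_def using that emp by (intro cSUP_least) auto
  define G where "G x = V a x" for x
  have incr: "cmod (F v - F u) \<le> G v - G u" if uv: "a \<le> u" "u \<le> v" "v \<le> b" for u v
  proof (cases "u = v")
    case False
    have D2: "{(u, v)} \<in> subintervals u v" using False uv by (simp add: subintervals_def)
    have "G u \<le> G v - cmod (F v - F u)"
      unfolding G_def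
    proof (rule Vleast)
      fix D assume D: "D \<in> subintervals a u"
      have "variation_on F D + cmod (F v - F u) = variation_on F (D \<union> {(u, v)})"
        using subintervals_Un(2)[OF D D2 uv(1,2)] subintervalsD(1)[OF D]
        by (simp add: variation_on_def)
      also have "\<dots> \<le> V a v"
        by (rule Vup[OF subintervals_Un(1)[OF D D2 uv(1,2)] order_refl uv(3)])
      finally show "variation_on F D \<le> V a v - cmod (F v - F u)" by simp
    qed
    then show ?thesis by simp
  qed simp
  have G_le: "G v - G u \<le> V u v" if uv: "a \<le> u" "u \<le> v" "v \<le> b" for u v
  proof -
    have "G v \<le> G u + V u v"
      unfolding G_def
    proof (rule Vleast)
      fix D assume D: "D \<in> subintervals a v"
      obtain D1 D2 where 1: "D1 \<in> subintervals a u" "D2 \<in> subintervals u v"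
        "variation_on F D \<le> variation_on F D1 + variation_on F D2"
        using subintervals_split[OF D uv(1,2)] by metis
      show "variation_on F D \<le> V a u + V u v"
        using 1(3) Vup[OF 1(1)] Vup[OF 1(2)] uv by fastforce
    qed
    then show ?thesis by simp
  qed
  have "abs_continuous_on_Icc a b (\<lambda>x. of_real (G x))"
  proof (rule ac_subintervalsI)
    fix e :: real assume e: "e > 0"
    obtain d where d: "d > 0" "\<And>D. D \<in> subintervals a b \<Longrightarrow> (\<Sum>(u, v)\<in>D. v - u) < d \<Longrightarrow> variation_on F D < e / 2"
      using ac_subintervals[OF F, of "e / 2"] e by auto
    have "variation_on (\<lambda>x. of_real (G x)) D < e"
      if D: "D \<in> subintervals a b" and len: "(\<Sum>(u, v)\<in>D. v - u) < d" for D
    proof -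
      \<comment> \<open>The error allowed in each of the suprema, so that together they cost less than \<open>e / 2\<close>.\<close>
      define \<eta> where "\<eta> = e / (2 * (real (card D) + 1))"
      have \<eta>: "\<eta> > 0" "card D * \<eta> < e / 2" using e by (auto simp: \<eta>_def field_simps)
      note DD = subintervalsD[OF D]
      have "\<exists>E. E \<in> subintervals (fst I) (snd I) \<and> V (fst I) (snd I) < variation_on F E + \<eta>" for I
      proof (rule ccontr)
        assume "\<not> ?thesis"
        then have "V (fst I) (snd I) \<le> V (fst I) (snd I) - \<eta>"
          by (intro Vleast) (simp add: not_less algebra_simps)
        with \<eta> show False by simp
      qed
      then obtain E where E: "\<And>I. E I \<in> subintervals (fst I) (snd I)"
        "\<And>I. V (fst I) (snd I) < variation_on F (E I) + \<eta>" by metis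
      have Edisj: "\<And>I J. I \<in> D \<Longrightarrow> J \<in> D \<Longrightarrow> I \<noteq> J \<Longrightarrow> E I \<inter> E J = {}"
      proof -
        fix I J assume IJ: "I \<in> D" "J \<in> D" "I \<noteq> J"
        have "snd I \<le> fst J \<or> snd J \<le> fst I"
          using subintervals_sep[OF D, of "fst I" "snd I" "fst J" "snd J"] IJ by auto
        then show "E I \<inter> E J = {}"
          using subintervalsD(2)[OF E(1)[of I]] subintervalsD(2)[OF E(1)[of J]] by force
      qed
      have U: "(\<Union>I\<in>D. E I) \<in> subintervals a b"
      proof (rule subintervalsI)
        show "finite (\<Union>I\<in>D. E I)" using DD(1) subintervalsD(1)[OF E(1)] by auto
        fix u v assume "(u, v) \<in> (\<Union>I\<in>D. E I)"
        then obtain I where I: "I \<in> D" "(u, v) \<in> E I" by blast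
        show "a \<le> u \<and> u < v \<and> v \<le> b"
          using subintervalsD(2)[OF E(1) I(2)] DD(2)[of "fst I" "snd I"] I by auto
        fix u' v' assume "(u', v') \<in> (\<Union>I\<in>D. E I)" and ne: "(u, v) \<noteq> (u', v')"
        then obtain J where J: "J \<in> D" "(u', v') \<in> E J" by blast
        show "v \<le> u' \<or> v' \<le> u"
        proof (cases "I = J")
          case True
          then show ?thesis using subintervals_sep[OF E(1) I(2), of u' v'] J ne by auto
        next
          case False
          then have "snd I \<le> fst J \<or> snd J \<le> fst I"
            using subintervals_sep[OF D, of "fst I" "snd I" "fst J" "snd J"] I J by auto
          then show ?thesis
            using subintervalsD(2)[OF E(1) I(2)] subintervalsD(2)[OF E(1) J(2)] by linarith
        qed
      qed
      have sumU: "(\<Sum>x\<in>(\<Union>I\<in>D. E I). f x) = (\<Sum>I\<in>D. \<Sum>x\<in>E I. f x)" for f :: "real \<times> real \<Rightarrow> real"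
        using DD(1) subintervalsD(1)[OF E(1)] Edisj by (intro sum.UNION_disjoint) auto
      have "(\<Sum>(u, v)\<in>(\<Union>I\<in>D. E I). v - u) = (\<Sum>I\<in>D. \<Sum>(u, v)\<in>E I. v - u)" by (rule sumU)
      also have "\<dots> \<le> (\<Sum>I\<in>D. snd I - fst I)"
        using DD(2) by (intro sum_mono sum_length_le[OF E(1)]) (auto simp: less_imp_le)
      also have "\<dots> < d" using len by (simp add: split_beta)
      finally have "variation_on F (\<Union>I\<in>D. E I) < e / 2" by (rule d(2)[OF U])
      also have "variation_on F (\<Union>I\<in>D. E I) = (\<Sum>I\<in>D. variation_on F (E I))"
        unfolding variation_on_def by (rule sumU)
      finally have *: "(\<Sum>I\<in>D. variation_on F (E I)) < e / 2" .
      have "variation_on (\<lambda>x. of_real (G x)) D = (\<Sum>(u, v)\<in>D. \<bar>G v - G u\<bar>)"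
        unfolding variation_on_def by (simp flip: of_real_diff)
      also have "\<dots> \<le> (\<Sum>I\<in>D. variation_on F (E I) + \<eta>)"
      proof (rule sum_mono)
        fix I assume I: "I \<in> D"
        obtain u v where uv: "I = (u, v)" by force
        have "a \<le> u" "u \<le> v" "v \<le> b" using DD(2)[of u v] I uv by auto
        then have "\<bar>G v - G u\<bar> \<le> V u v"
          using G_le[of u v] incr[of u v] norm_ge_zero[of "F v - F u"] by linarith
        then show "(case I of (u, v) \<Rightarrow> \<bar>G v - G u\<bar>) \<le> variation_on F (E I) + \<eta>"
          using E(2)[of I] uv by simp
      qed
      also have "\<dots> = (\<Sum>I\<in>D. variation_on F (E I)) + card D * \<eta>" by (simp add: sum.distrib)
      also have "\<dots> < e" using * \<eta>(2) by linarith
      finally show ?thesis .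
    qed
    with d(1) show "\<exists>d>0. \<forall>D\<in>subintervals a b. (\<Sum>(u, v)\<in>D. v - u) < d \<longrightarrow> variation_on (\<lambda>x. of_real (G x)) D < e"
      by blast
  qed
  then show ?thesis using incr that by blast
qed

lemma ac_continuous_on:
  assumes F: "abs_continuous_on_Icc a b F"
  shows "continuous_on {a..b} F"
  unfolding continuous_on_iff
proof (intro ballI allI impI)
  fix x e :: real assume x: "x \<in> {a..b}" and e: "e > 0"
  obtain d where d: "d > 0" "\<And>D. D \<in> subintervals a b \<Longrightarrow> (\<Sum>(u, v)\<in>D. v - u) < d \<Longrightarrow> variation_on F D < e"
    using ac_subintervals[OF F e] by metis
  have "dist (F y) (F x) < e" if y: "y \<in> {a..b}" "dist y x < d" for y
  proof (cases "y = x")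
    case False
    define D where "D = {(min x y, max x y)}"
    have "variation_on F D < e"
      using x y False by (intro d(2)) (auto simp: D_def subintervals_def dist_real_def min_def max_def)
    then show ?thesis
      by (auto simp: D_def variation_on_def dist_norm min_def max_def norm_minus_commute split: if_splits)
  qed (use e in auto)
  then show "\<exists>d>0. \<forall>y\<in>{a..b}. dist y x < d \<longrightarrow> dist (F y) (F x) < e"
    using d(1) by blast
qed

section \<open>Absolutely continuous functions as indefinite integrals\<close>

text \<open>
  The Stieltjes measure of \<open>H\<close> is absolutely continuous.  A compact null set is covered by
  the cells of a fine grid that meet it; these lie in an open set of small measure and form a family of
  intervals with disjoint interiors, on which \<open>H\<close> has small total increment.
\<close>

lemma mono_ac_null_compact:
  fixes H :: "real \<Rightarrow> real"
  assumes mono: "\<And>x y. a \<le> x \<Longrightarrow> x \<le> y \<Longrightarrow> y \<le> b \<Longrightarrow> H x \<le> H y"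
    and ac: "abs_continuous_on_Icc a b (\<lambda>x. of_real (H x))" and ab: "a \<le> b"
    and N: "sets N = sets borel"
      "\<And>x y. x \<le> y \<Longrightarrow> emeasure N {x<..y} = ennreal (H (max a (min b y)) - H (max a (min b x)))"
    and K: "compact K" "K \<in> null_sets lebesgue"
  shows "emeasure N K = 0"
proof -
  define c where "c x = max a (min b x)" for x
  have c: "a \<le> c x" "c x \<le> b" "x \<le> y \<Longrightarrow> c x \<le> c y" "x \<le> y \<Longrightarrow> c y - c x \<le> y - x" for x y
    using ab by (auto simp: c_def)
  have bound: "emeasure N K \<le> 0 + ennreal e" if e: "e > 0" for e
  proof -
    obtain d where d: "d > 0" "\<And>D. D \<in> subintervals a b \<Longrightarrow> (\<Sum>(u, v)\<in>D. v - u) < d \<Longrightarrow>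
        variation_on (\<lambda>x. of_real (H x)) D < e"
      using ac_subintervals[OF ac e] by metis
    have Ks: "K \<in> sets lebesgue" using K(2) by auto
    obtain U where U: "open U" "K \<subseteq> U" "U - K \<in> lmeasurable" "emeasure lebesgue (U - K) < ennreal d"
      using sets_lebesgue_outer_open[OF Ks d(1)] by metis
    have U_eq: "emeasure lebesgue U = emeasure lebesgue (U - K)"
      using emeasure_Diff_null_set[OF K(2), of U] U(1) by simp
    have Um: "U \<in> lmeasurable"
      using U(1,3) U_eq by (auto simp: fmeasurable_def)
    have mU: "measure lebesgue U < d"
      using U(4) U_eq Um by (metis emeasure_eq_measure2 ennreal_less_iff measure_nonneg)
    obtain r where r: "r > 0" "(\<Union>x\<in>K. ball x r) \<subseteq> U"
      using compact_subset_open_imp_ball_epsilon_subset[OF K(1) U(1,2)] by metis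
    obtain n :: nat where n: "n > 0" "1 / real n < r"
      using r(1) by (metis nat_approx_posE zero_less_Suc)
    define g where "g j = real_of_int j / real n" for j
    have gS: "g (j + 1) = g j + 1 / real n" for j by (simp add: g_def add_divide_distrib)
    have gmono: "j \<le> k \<Longrightarrow> g j \<le> g k" for j k by (simp add: g_def divide_right_mono)
    define js where "js = {j. {g j<..g (j + 1)} \<inter> K \<noteq> {}}"
    obtain B where B: "\<And>x. x \<in> K \<Longrightarrow> \<bar>x\<bar> \<le> B"
      using compact_imp_bounded[OF K(1)] by (auto simp: bounded_iff)
    have fin: "finite js"
    proof (rule finite_subset)
      show "js \<subseteq> {- \<lceil>(B + 1) * n\<rceil>.. \<lceil>(B + 1) * n\<rceil>}"
      proof
        fix j assume "j \<in> js"
        then obtain x where x: "x \<in> K" "g j < x" "x \<le> g (j + 1)" by (auto simp: js_def)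
        have 1: "real_of_int j < x * n" "x * n \<le> real_of_int j + 1"
          using x n(1) by (auto simp: g_def field_simps)
        have "\<bar>x * n\<bar> \<le> B * n" using B[OF x(1)] by (simp add: abs_mult mult_right_mono)
        then have "real_of_int j \<le> (B + 1) * n" "- real_of_int j \<le> (B + 1) * n"
          using 1 n(1) by (auto simp: algebra_simps)
        then show "j \<in> {- \<lceil>(B + 1) * n\<rceil>.. \<lceil>(B + 1) * n\<rceil>}"
          by (simp add: le_ceiling_iff minus_le_iff)
      qed
    qed simp
    have cellU: "{g j<..g (j + 1)} \<subseteq> U" if j: "j \<in> js" for j
    proof
      fix y assume y: "y \<in> {g j<..g (j + 1)}"
      obtain x where x: "x \<in> K" "g j < x" "x \<le> g (j + 1)" using j by (auto simp: js_def)
      have "dist x y < r" using x y n(2) gS[of j] by (auto simp: dist_real_def)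
      then have "y \<in> (\<Union>x\<in>K. ball x r)" using x(1) by auto
      then show "y \<in> U" using r(2) by blast
    qed
    have cover: "K \<subseteq> (\<Union>j\<in>js. {g j<..g (j + 1)})"
    proof
      fix x assume x: "x \<in> K"
      define j where "j = \<lceil>x * n\<rceil> - 1"
      have "real_of_int j < x * n" "x * n \<le> real_of_int j + 1"
        unfolding j_def by linarith+
      then have "x \<in> {g j<..g (j + 1)}" using n(1) by (auto simp: g_def field_simps)
      then show "x \<in> (\<Union>j\<in>js. {g j<..g (j + 1)})" unfolding js_def using x by blast
    qed
    \<comment> \<open>The grid cells, clipped to \<open>[a, b]\<close>; cells that degenerate are discarded.\<close>
    define D where "D = (\<lambda>j. (c (g j), c (g (j + 1)))) ` {j\<in>js. c (g j) < c (g (j + 1))}"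
    have sep: "j < k \<Longrightarrow> c (g (j + 1)) \<le> c (g k)" for j k
      by (intro c(3) gmono) simp
    have inj: "inj_on (\<lambda>j. (c (g j), c (g (j + 1)))) {j\<in>js. c (g j) < c (g (j + 1))}"
    proof (rule inj_onI)
      fix j k assume "j \<in> {j\<in>js. c (g j) < c (g (j + 1))}" "k \<in> {j\<in>js. c (g j) < c (g (j + 1))}"
        "(c (g j), c (g (j + 1))) = (c (g k), c (g (k + 1)))"
      then show "j = k" using sep[of j k] sep[of k j] by (cases j k rule: linorder_cases) auto
    qed
    have D: "D \<in> subintervals a b"
    proof (rule subintervalsI)
      show "finite D" using fin by (simp add: D_def)
      fix u v assume "(u, v) \<in> D"
      then obtain j where j: "u = c (g j)" "v = c (g (j + 1))" "u < v" by (auto simp: D_def)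
      then show "a \<le> u \<and> u < v \<and> v \<le> b" using c by auto
      fix u' v' assume "(u', v') \<in> D" and ne: "(u, v) \<noteq> (u', v')"
      then obtain k where k: "u' = c (g k)" "v' = c (g (k + 1))" by (auto simp: D_def)
      show "v \<le> u' \<or> v' \<le> u"
        using sep[of j k] sep[of k j] ne j k by (cases j k rule: linorder_cases) auto
    qed
    have sumD: "(\<Sum>x\<in>D. f x) = (\<Sum>j\<in>js. f (c (g j), c (g (j + 1))))"
      if "\<And>u. f (u, u) = 0" for f :: "real \<times> real \<Rightarrow> real"
    proof -
      have "(\<Sum>x\<in>D. f x) = (\<Sum>j\<in>{j\<in>js. c (g j) < c (g (j + 1))}. f (c (g j), c (g (j + 1))))"
        unfolding D_def by (subst sum.reindex[OF inj]) simp
      also have "\<dots> = (\<Sum>j\<in>js. f (c (g j), c (g (j + 1))))"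
      proof (rule sum.mono_neutral_left)
        show "\<forall>j\<in>js - {j\<in>js. c (g j) < c (g (j + 1))}. f (c (g j), c (g (j + 1))) = 0"
        proof
          fix j assume "j \<in> js - {j\<in>js. c (g j) < c (g (j + 1))}"
          then have "c (g j) = c (g (j + 1))"
            using c(3)[OF gmono, of j "j + 1"] by force
          then show "f (c (g j), c (g (j + 1))) = 0" using that by simp
        qed
      qed (use fin in auto)
      finally show ?thesis .
    qed
    have "(\<Sum>(u, v)\<in>D. v - u) = (\<Sum>j\<in>js. c (g (j + 1)) - c (g j))"
      by (subst sumD) auto
    also have "\<dots> \<le> (\<Sum>j\<in>js. measure lebesgue {g j<..g (j + 1)})"
      by (intro sum_mono) (simp add: c(4) gmono)
    also have "\<dots> = measure lebesgue (\<Union>j\<in>js. {g j<..g (j + 1)})"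
    proof (rule measure_UNION'[symmetric])
      show "{g j<..g (j + 1)} \<in> lmeasurable" for j
        by (rule bounded_set_imp_lmeasurable) auto
      show "pairwise (\<lambda>i j. disjnt {g i<..g (i + 1)} {g j<..g (j + 1)}) js"
      proof (rule pairwiseI)
        fix i j :: int assume "i \<noteq> j"
        then have "g (i + 1) \<le> g j \<or> g (j + 1) \<le> g i"
          using gmono[of "i + 1" j] gmono[of "j + 1" i] by linarith
        then show "disjnt {g i<..g (i + 1)} {g j<..g (j + 1)}" by (auto simp: disjnt_def)
      qed
    qed (use fin in auto)
    also have "\<dots> \<le> measure lebesgue U"
      using cellU fin Um by (intro measure_mono_fmeasurable) auto
    also have "\<dots> < d" by (rule mU)
    finally have "variation_on (\<lambda>x. of_real (H x)) D < e" by (rule d(2)[OF D])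
    moreover have Hc: "H (c (g j)) \<le> H (c (g (j + 1)))" for j by (intro mono c gmono) simp
    then have "variation_on (\<lambda>x. of_real (H x)) D = (\<Sum>j\<in>js. H (c (g (j + 1))) - H (c (g j)))"
      unfolding variation_on_def
      by (subst sumD) (auto simp flip: of_real_diff intro!: sum.cong)
    ultimately have *: "(\<Sum>j\<in>js. H (c (g (j + 1))) - H (c (g j))) < e" by simp
    have 1: "emeasure N K \<le> emeasure N (\<Union>j\<in>js. {g j<..g (j + 1)})"
      by (intro emeasure_mono cover) (use fin N(1) in auto)
    have 2: "emeasure N (\<Union>j\<in>js. {g j<..g (j + 1)}) \<le> (\<Sum>j\<in>js. emeasure N {g j<..g (j + 1)})"
      by (rule emeasure_subadditive_finite[OF fin]) (auto simp: N(1))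
    have 3: "(\<Sum>j\<in>js. emeasure N {g j<..g (j + 1)}) = (\<Sum>j\<in>js. ennreal (H (c (g (j + 1))) - H (c (g j))))"
      by (rule sum.cong[OF refl], unfold c_def, rule N(2), rule gmono) simp
    have 4: "(\<Sum>j\<in>js. ennreal (H (c (g (j + 1))) - H (c (g j)))) = ennreal (\<Sum>j\<in>js. H (c (g (j + 1))) - H (c (g j)))"
      by (rule sum_ennreal, rule iffD2[OF diff_ge_0_iff_ge], rule Hc)
    have 5: "ennreal (\<Sum>j\<in>js. H (c (g (j + 1))) - H (c (g j))) \<le> ennreal e"
      by (rule ennreal_leI, rule less_imp_le, rule *)
    show ?thesis
      using order_trans[OF order_trans[OF 1 2[unfolded 3 4]] 5] by (simp only: add_0)
  qed
  have "emeasure N K \<le> 0" by (rule ennreal_le_epsilon) (rule bound)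
  then show ?thesis by simp
qed

text \<open>
  By inner regularity it suffices to know that the Stieltjes measure of \<open>H\<close> vanishes on
  compact null sets; the integrand is then its Radon--Nikodym density.
\<close>

lemma mono_ac_integral:
  fixes H :: "real \<Rightarrow> real"
  assumes mono: "\<And>x y. a \<le> x \<Longrightarrow> x \<le> y \<Longrightarrow> y \<le> b \<Longrightarrow> H x \<le> H y"
    and ac: "abs_continuous_on_Icc a b (\<lambda>x. of_real (H x))" and ab: "a \<le> b"
  obtains h :: "real \<Rightarrow> real" where "h absolutely_integrable_on {a..b}"
    "\<And>x. x \<in> {a..b} \<Longrightarrow> integral {a..x} h = H x - H a"
proof -
  define c where "c x = max a (min b x)" for x
  have c: "a \<le> c x" "c x \<le> b" "x \<le> y \<Longrightarrow> c x \<le> c y" for x y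
    using ab by (auto simp: c_def)
  have cont: "continuous_on {a..b} (\<lambda>x. complex_of_real (H x))" by (rule ac_continuous_on[OF ac])
  have contH: "continuous_on {a..b} H"
    using continuous_on_Re[OF cont] by simp
  have contc: "continuous_on UNIV c" unfolding c_def by (intro continuous_intros)
  have "continuous_on UNIV (\<lambda>x. H (c x))"
    by (rule continuous_on_compose2[OF contH contc]) (use c in auto)
  then have cr: "continuous (at_right x) (\<lambda>x. H (c x))" for x
    using continuous_on_eq_continuous_at continuous_at_imp_continuous_within open_UNIV by blast
  have Hm: "H (c x) \<le> H (c y)" if "x \<le> y" for x y using that by (intro mono c)
  define N where "N = interval_measure (\<lambda>x. H (c x))"
  have Nioc: "emeasure N {x<..y} = ennreal (H (c y) - H (c x))" if "x \<le> y" for x y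
    unfolding N_def using emeasure_interval_measure_Ioc[OF that, of "\<lambda>x. H (c x)"] Hm cr by auto
  have Ns: "sets N = sets borel" by (simp add: N_def)
  have Nfin: "emeasure N (space N) \<noteq> \<infinity>"
  proof -
    have "emeasure N (\<Union>n::nat. {- real n<..real n}) = (SUP n::nat. emeasure N {- real n<..real n})"
      by (intro SUP_emeasure_incseq[symmetric]) (auto simp: Ns incseq_def)
    also have "\<dots> \<le> ennreal (H b - H a)"
      by (intro SUP_least) (auto simp: Nioc intro!: ennreal_leI diff_mono mono c order_refl ab)
    also have "(\<Union>n::nat. {- real n<..real n}) = UNIV"
    proof -
      have "x \<in> (\<Union>n::nat. {- real n<..real n})" for x
      proof -
        obtain n :: nat where "\<bar>x\<bar> < real n" using reals_Archimedean2 by blast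
        then have "x \<in> {- real n<..real n}" by auto
        then show ?thesis by blast
      qed
      then show ?thesis by blast
    qed
    finally show ?thesis by (auto simp: N_def top_unique)
  qed
  have "absolutely_continuous lborel N"
    unfolding absolutely_continuous_def
  proof
    fix A :: "real set" assume A: "A \<in> null_sets lborel"
    then have Ab: "A \<in> sets borel" by auto
    have "emeasure N A = (SUP K\<in>{K. K \<subseteq> A \<and> compact K}. emeasure N K)"
      by (rule inner_regular[OF Ns Nfin Ab])
    also have "\<dots> \<le> 0"
    proof (rule SUP_least)
      fix K assume K: "K \<in> {K. K \<subseteq> A \<and> compact K}"
      then have "K \<in> null_sets lborel"
        using A by (auto intro: null_sets_subset simp: borel_compact)
      then have "K \<in> null_sets lebesgue" by (rule null_sets_completionI)
      then show "emeasure N K \<le> 0"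
        using mono_ac_null_compact[OF mono ac ab Ns, of K] Nioc K by (simp add: c_def)
    qed
    finally show "A \<in> null_sets N" using Ab Ns by (auto simp: null_sets_def)
  qed
  then obtain f where f: "f \<in> borel_measurable lborel" "density lborel f = N"
    using sigma_finite_measure.Radon_Nikodym[OF sigma_finite_lborel, of N] Ns by auto
  have "AE x in lborel. f x \<noteq> \<infinity>"
  proof (rule nn_integral_PInf_AE)
    have "(\<integral>\<^sup>+ x. f x \<partial>lborel) = emeasure (density lborel f) UNIV"
      using f(1) by (simp add: emeasure_density)
    then show "(\<integral>\<^sup>+ x. f x \<partial>lborel) \<noteq> \<infinity>" using Nfin f(2) by (simp add: N_def)
  qed (use f in simp)
  define h where "h x = enn2real (f x)" for x
  have hm: "h \<in> borel_measurable borel" using f(1) by (simp add: h_def[abs_def])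
  have h0: "h t \<ge> 0" for t by (simp add: h_def)
  have hint: "(h has_integral (H x - H a)) {a..x}" if x: "x \<in> {a..b}" for x
  proof -
    have "(\<integral>\<^sup>+ t. ennreal (indicator {a<..x} t * h t) \<partial>lborel) = (\<integral>\<^sup>+ t. f t * indicator {a<..x} t \<partial>lborel)"
      using \<open>AE x in lborel. f x \<noteq> \<infinity>\<close>
      by (intro nn_integral_cong_AE) (auto simp: h_def indicator_def ennreal_enn2real_if top_unique infinity_ennreal_def)
    also have "\<dots> = emeasure N {a<..x}"
      using f by (simp flip: f(2) add: emeasure_density)
    also have "\<dots> = ennreal (H x - H a)"
      using Nioc[of a x] x by (simp add: c_def)
    finally have "((\<lambda>t. indicator {a<..x} t * h t) has_integral (H x - H a)) UNIV"
      using hm h0 x by (intro nn_integral_has_integral) (auto intro: mono)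
    then have "((\<lambda>t. if t \<in> {a..x} then h t else 0) has_integral (H x - H a)) UNIV"
      by (rule has_integral_spike[rotated -1, of _ _ _ "{a}"]) (auto simp: indicator_def)
    then show ?thesis by (subst (asm) has_integral_restrict_UNIV)
  qed
  show ?thesis
  proof (rule that)
    show "h absolutely_integrable_on {a..b}"
      using hint[of b] ab by (intro nonnegative_absolutely_integrable_1) (auto simp: h_def has_integral_integrable)
    show "integral {a..x} h = H x - H a" if "x \<in> {a..b}" for x
      using hint[OF that] by (rule integral_unique)
  qed
qed

text \<open>
  One estimate that covers the closure properties of absolutely continuous functions: products, real
  and imaginary parts, sums.
\<close>

lemma ac_dominated:
  assumes G: "abs_continuous_on_Icc a b G" and G': "abs_continuous_on_Icc a b G'"
    and F: "\<And>u v. a \<le> u \<Longrightarrow> u \<le> v \<Longrightarrow> v \<le> b \<Longrightarrow>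
      cmod (F v - F u) \<le> A * cmod (G v - G u) + B * cmod (G' v - G' u) + C * (v - u)"
  shows "abs_continuous_on_Icc a b F"
proof (rule ac_subintervalsI)
  fix e :: real assume e: "e > 0"
  define A' where "A' = \<bar>A\<bar> + 1"
  define B' where "B' = \<bar>B\<bar> + 1"
  define C' where "C' = \<bar>C\<bar> + 1"
  have pos: "A' > 0" "B' > 0" "C' > 0" "A \<le> A'" "B \<le> B'" "C \<le> C'" by (auto simp: A'_def B'_def C'_def)
  obtain d1 where d1: "d1 > 0" "\<And>D. D \<in> subintervals a b \<Longrightarrow> (\<Sum>(u, v)\<in>D. v - u) < d1 \<Longrightarrow> variation_on G D < e / (3 * A')"
    using ac_subintervals[OF G, of "e / (3 * A')"] e pos by auto
  obtain d2 where d2: "d2 > 0" "\<And>D. D \<in> subintervals a b \<Longrightarrow> (\<Sum>(u, v)\<in>D. v - u) < d2 \<Longrightarrow> variation_on G' D < e / (3 * B')"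
    using ac_subintervals[OF G', of "e / (3 * B')"] e pos by auto
  define d where "d = Min {d1, d2, e / (3 * C')}"
  have d: "d > 0" "d \<le> d1" "d \<le> d2" "d \<le> e / (3 * C')" using d1 d2 e pos by (auto simp: d_def)
  have "variation_on F D < e" if D: "D \<in> subintervals a b" and len: "(\<Sum>(u, v)\<in>D. v - u) < d" for D
  proof -
    have "variation_on F D \<le> (\<Sum>(u, v)\<in>D. A' * cmod (G v - G u) + B' * cmod (G' v - G' u) + C' * (v - u))"
      unfolding variation_on_def
    proof (rule sum_mono)
      fix I assume I: "I \<in> D"
      obtain u v where uv: "I = (u, v)" by force
      have "a \<le> u" "u \<le> v" "v \<le> b" using subintervalsD(2)[OF D, of u v] I uv by auto
      then have "cmod (F v - F u) \<le> A * cmod (G v - G u) + B * cmod (G' v - G' u) + C * (v - u)" by (rule F)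
      also have "\<dots> \<le> A' * cmod (G v - G u) + B' * cmod (G' v - G' u) + C' * (v - u)"
        using pos \<open>u \<le> v\<close> by (intro add_mono mult_right_mono) auto
      finally show "(case I of (u, v) \<Rightarrow> cmod (F v - F u)) \<le>
        (case I of (u, v) \<Rightarrow> A' * cmod (G v - G u) + B' * cmod (G' v - G' u) + C' * (v - u))" using uv by simp
    qed
    also have "\<dots> = A' * variation_on G D + B' * variation_on G' D + C' * (\<Sum>(u, v)\<in>D. v - u)"
      unfolding variation_on_def by (simp add: split_beta sum.distrib sum_distrib_left)
    also have "\<dots> < A' * (e / (3 * A')) + B' * (e / (3 * B')) + C' * (e / (3 * C'))"
      using d1(2)[OF D] d2(2)[OF D] len d pos
      by (intro add_strict_mono mult_strict_left_mono) auto
    also have "\<dots> = e" using pos by (simp add: field_simps)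
    finally show ?thesis .
  qed
  with d(1) show "\<exists>d>0. \<forall>D\<in>subintervals a b. (\<Sum>(u, v)\<in>D. v - u) < d \<longrightarrow> variation_on F D < e" by blast
qed

lemma ac_mult:
  assumes F: "abs_continuous_on_Icc a b F" and G: "abs_continuous_on_Icc a b G"
  shows "abs_continuous_on_Icc a b (\<lambda>x. F x * G x)"
proof -
  have "bounded (F ` {a..b})" "bounded (G ` {a..b})"
    using ac_continuous_on[OF F] ac_continuous_on[OF G]
    by (auto intro!: compact_imp_bounded compact_continuous_image)
  then obtain A B where A: "\<And>x. x \<in> {a..b} \<Longrightarrow> cmod (F x) \<le> A" and B: "\<And>x. x \<in> {a..b} \<Longrightarrow> cmod (G x) \<le> B"
    unfolding bounded_iff by blast
  show ?thesis
  proof (rule ac_dominated[OF F G])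
    fix u v assume uv: "a \<le> u" "u \<le> v" "v \<le> b"
    have "F v * G v - F u * G u = (F v - F u) * G v + F u * (G v - G u)" by (simp add: algebra_simps)
    then have "cmod (F v * G v - F u * G u) \<le> cmod (F v - F u) * cmod (G v) + cmod (F u) * cmod (G v - G u)"
      by (metis norm_mult norm_triangle_ineq)
    also have "\<dots> \<le> B * cmod (F v - F u) + A * cmod (G v - G u) + 0 * (v - u)"
      using A[of u] B[of v] uv mult_left_mono[of "cmod (G v)" B "cmod (F v - F u)"]
        mult_right_mono[of "cmod (F u)" A "cmod (G v - G u)"] by (simp add: mult.commute)
    finally show "cmod (F v * G v - F u * G u) \<le> B * cmod (F v - F u) + A * cmod (G v - G u) + 0 * (v - u)" .
  qed
qed

theorem ac_integral_representation:
  assumes F: "abs_continuous_on_Icc a b F" and ab: "a \<le> b"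
  obtains f where "f absolutely_integrable_on {a..b}"
    "\<And>x. x \<in> {a..b} \<Longrightarrow> integral {a..x} f = F x - F a"
proof -
  obtain G where G: "abs_continuous_on_Icc a b (\<lambda>x. of_real (G x))"
    "\<And>u v. a \<le> u \<Longrightarrow> u \<le> v \<Longrightarrow> v \<le> b \<Longrightarrow> cmod (F v - F u) \<le> G v - G u"
    using ac_variation[OF F ab] by blast
  have re: "\<bar>Re (F v) - Re (F u)\<bar> \<le> G v - G u" "\<bar>Im (F v) - Im (F u)\<bar> \<le> G v - G u" "G u \<le> G v"
    if "a \<le> u" "u \<le> v" "v \<le> b" for u v
  proof -
    have "cmod (F v - F u) \<le> G v - G u" using that by (rule G)
    then show "\<bar>Re (F v) - Re (F u)\<bar> \<le> G v - G u" "\<bar>Im (F v) - Im (F u)\<bar> \<le> G v - G u" "G u \<le> G v"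
      using abs_Re_le_cmod[of "F v - F u"] abs_Im_le_cmod[of "F v - F u"] norm_ge_zero[of "F v - F u"]
      by simp_all
  qed
  have acR: "abs_continuous_on_Icc a b (\<lambda>x. of_real (G x - Re (F x)))"
    using re(1) by (intro ac_dominated[OF G(1) G(1), of _ 1 1 0]) (force simp flip: of_real_diff)
  have acI: "abs_continuous_on_Icc a b (\<lambda>x. of_real (G x - Im (F x)))"
    using re(2) by (intro ac_dominated[OF G(1) G(1), of _ 1 1 0]) (force simp flip: of_real_diff)
  obtain h where h: "h absolutely_integrable_on {a..b}" "\<And>x. x \<in> {a..b} \<Longrightarrow> integral {a..x} h = G x - G a"
    by (rule mono_ac_integral[OF re(3) G(1) ab]) auto
  have m1: "G u - Re (F u) \<le> G v - Re (F v)" if "a \<le> u" "u \<le> v" "v \<le> b" for u v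
    using re(1)[OF that] by linarith
  have m2: "G u - Im (F u) \<le> G v - Im (F v)" if "a \<le> u" "u \<le> v" "v \<le> b" for u v
    using re(2)[OF that] by linarith
  obtain h1 where h1: "h1 absolutely_integrable_on {a..b}"
    "\<And>x. x \<in> {a..b} \<Longrightarrow> integral {a..x} h1 = (G x - Re (F x)) - (G a - Re (F a))"
    by (rule mono_ac_integral[OF m1 acR ab]) auto
  obtain h2 where h2: "h2 absolutely_integrable_on {a..b}"
    "\<And>x. x \<in> {a..b} \<Longrightarrow> integral {a..x} h2 = (G x - Im (F x)) - (G a - Im (F a))"
    by (rule mono_ac_integral[OF m2 acI ab]) auto
  \<comment> \<open>\<open>h\<close>, \<open>h1\<close> and \<open>h2\<close> are densities of \<open>G\<close>, \<open>G - Re F\<close> and \<open>G - Im F\<close>.\<close>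
  define f where "f x = complex_of_real (h x - h1 x) + \<i> * complex_of_real (h x - h2 x)" for x
  have ofr: "(\<lambda>x. complex_of_real (q x)) absolutely_integrable_on S" if "q absolutely_integrable_on S" for q S
    using absolutely_integrable_linear[OF that bounded_linear_of_real] by (simp add: o_def)
  show ?thesis
  proof (rule that)
    show "f absolutely_integrable_on {a..b}"
      unfolding f_def using h h1 h2
      by (intro set_integral_add set_integrable_mult_right ofr set_integral_diff) auto
    fix x assume x: "x \<in> {a..b}"
    have ion: "q integrable_on {a..x}" if "q absolutely_integrable_on {a..b}" for q :: "real \<Rightarrow> real"
      using integrable_on_subinterval[OF set_lebesgue_integral_eq_integral(1)[OF that], of a x] x by auto
    have 1: "((\<lambda>t. h t - h1 t) has_integral Re (F x - F a)) {a..x}"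
      using has_integral_diff[OF integrable_integral[OF ion[OF h(1)]] integrable_integral[OF ion[OF h1(1)]]]
        h(2)[OF x] h1(2)[OF x] by simp
    have 2: "((\<lambda>t. h t - h2 t) has_integral Im (F x - F a)) {a..x}"
      using has_integral_diff[OF integrable_integral[OF ion[OF h(1)]] integrable_integral[OF ion[OF h2(1)]]]
        h(2)[OF x] h2(2)[OF x] by simp
    have "(f has_integral (of_real (Re (F x - F a)) + \<i> * of_real (Im (F x - F a)))) {a..x}"
      unfolding f_def by (intro has_integral_add has_integral_mult_right has_integral_of_real 1 2)
    then show "integral {a..x} f = F x - F a"
      by (metis complex_eq integral_unique)
  qed
qed

lemma ac_differentiable_ae:
  assumes F: "abs_continuous_on_Icc a b F" and ab: "a \<le> b"
  obtains N f where "negligible N" "f absolutely_integrable_on {a..b}" "(f has_integral (F b - F a)) {a..b}"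
    "\<And>x. x \<in> {a<..<b} - N \<Longrightarrow> (F has_vector_derivative f x) (at x)"
proof -
  obtain f where f: "f absolutely_integrable_on {a..b}" "\<And>x. x \<in> {a..b} \<Longrightarrow> integral {a..x} f = F x - F a"
    using ac_integral_representation[OF F ab] by blast
  have fi: "f integrable_on {a..b}" using f(1) by (rule set_lebesgue_integral_eq_integral(1))
  obtain N where N: "negligible N"
    "\<And>x. x \<in> {a<..<b} - N \<Longrightarrow> ((\<lambda>x. integral {a..x} f) has_vector_derivative f x) (at x)"
    using lebesgue_differentiation[OF fi] by blast
  have "(F has_vector_derivative f x) (at x)" if x: "x \<in> {a<..<b} - N" for x
  proof -
    have "((\<lambda>x. integral {a..x} f + F a) has_vector_derivative f x) (at x)"
      using N(2)[OF x] by (auto intro!: derivative_eq_intros)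
    then show ?thesis
      by (rule has_vector_derivative_transform_within_open[where S = "{a<..<b}"]) (use x f(2) in auto)
  qed
  moreover have "(f has_integral (F b - F a)) {a..b}"
    using f(2)[of b] ab integrable_integral[OF fi] by simp
  ultimately show ?thesis using that N(1) f(1) by blast
qed

text \<open>
  Any almost everywhere derivative may be used as the integrand, which is what applications need:
  there the derivative is given by an expression and not by the abstract density.
\<close>

lemma ac_FTC:
  assumes F: "abs_continuous_on_Icc a b F" and ab: "a \<le> b" and N: "negligible N"
    and f: "\<And>x. x \<in> {a<..<b} - N \<Longrightarrow> (F has_vector_derivative f x) (at x)"
  shows "f absolutely_integrable_on {a..b}" "(f has_integral (F b - F a)) {a..b}"
proof -
  obtain N' g where g: "negligible N'" "g absolutely_integrable_on {a..b}" "(g has_integral (F b - F a)) {a..b}"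
    "\<And>x. x \<in> {a<..<b} - N' \<Longrightarrow> (F has_vector_derivative g x) (at x)"
    using ac_differentiable_ae[OF F ab] by blast
  have neg: "negligible (N \<union> N' \<union> {a, b})" using N g(1) by simp
  have eq: "f x = g x" if "x \<in> {a..b} - (N \<union> N' \<union> {a, b})" for x
    by (rule vector_derivative_unique_at[OF f g(4)]) (use that in auto)
  show "(f has_integral (F b - F a)) {a..b}"
    by (rule has_integral_spike[OF neg eq g(3)])
  show "f absolutely_integrable_on {a..b}"
    by (rule absolutely_integrable_spike[OF g(2) neg eq])
qed

lemma sum_integral_subintervals_le:
  assumes D: "D \<in> subintervals a b" and q: "q integrable_on {a..b}" and q0: "\<And>x. x \<in> {a..b} \<Longrightarrow> q x \<ge> (0::real)"
  shows "(\<Sum>(u, v)\<in>D. integral {u..v} q) \<le> integral {a..b} q"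
proof -
  define d where "d = (\<lambda>(u, v). {u..v}) ` D"
  have inj: "inj_on (\<lambda>(u, v). {u..v}) D"
    using subintervalsD(2)[OF D] by (fastforce simp: inj_on_def Icc_eq_Icc)
  have div: "d division_of \<Union>d"
    unfolding division_of_def
  proof (intro conjI ballI impI)
    show "finite d" using subintervalsD(1)[OF D] by (simp add: d_def)
    fix K assume K: "K \<in> d"
    then obtain u v where uv: "(u, v) \<in> D" "K = {u..v}" by (auto simp: d_def)
    show "K \<subseteq> \<Union>d" using K by blast
    show "K \<noteq> {}" using uv subintervalsD(2)[OF D uv(1)] by auto
    show "\<exists>a b. K = cbox a b" using uv by auto
    fix K' assume K': "K' \<in> d" "K \<noteq> K'"
    then obtain u' v' where uv': "(u', v') \<in> D" "K' = {u'..v'}" by (auto simp: d_def)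
    have "v \<le> u' \<or> v' \<le> u" using subintervals_sep[OF D uv(1) uv'(1)] uv uv' K' by auto
    then show "interior K \<inter> interior K' = {}" using uv uv' by (auto simp: interior_atLeastAtMost_real)
  qed simp
  have sub: "\<Union>d \<subseteq> {a..b}" using subintervalsD(2)[OF D] by (force simp: d_def)
  have qd: "q integrable_on \<Union>d" by (rule integrable_on_subdivision[OF div q sub])
  have "(\<Sum>(u, v)\<in>D. integral {u..v} q) = (\<Sum>K\<in>d. integral K q)"
    unfolding d_def by (subst sum.reindex[OF inj]) (simp add: split_beta o_def)
  also have "\<dots> = integral (\<Union>d) q"
    by (rule integral_combine_division_topdown[OF qd div, symmetric])
  also have "\<dots> \<le> integral {a..b} q"
    by (rule integral_subset_le[OF sub qd q]) (use q0 in auto)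
  finally show ?thesis .
qed

text \<open>
  Truncate \<open>\<bar>f\<bar>\<close> at a height \<open>n\<close> that leaves less than \<open>e / 2\<close> of its integral; the truncated part
  contributes at most \<open>n\<close> times the total length of the intervals.
\<close>

lemma integral_ac:
  assumes f: "f absolutely_integrable_on {a..b}"
    and F: "\<And>u v. a \<le> u \<Longrightarrow> u \<le> v \<Longrightarrow> v \<le> b \<Longrightarrow> F v - F u = integral {u..v} f"
  shows "abs_continuous_on_Icc a b F"
proof (rule ac_subintervalsI)
  fix e :: real assume e: "e > 0"
  define g where "g x = cmod (f x)" for x
  have g: "g absolutely_integrable_on {a..b}" unfolding g_def by (rule absolutely_integrable_norm[OF f, unfolded o_def])
  define q where "q n x = min (g x) (real n)" for n x
  have qabs: "q n absolutely_integrable_on {a..b}" for n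
    unfolding q_def by (intro absolutely_integrable_min_1 g absolutely_integrable_on_const) auto
  have gi: "g integrable_on {a..b}" and qi: "q n integrable_on {a..b}" for n
    using g qabs set_lebesgue_integral_eq_integral(1) by blast+
  have "(\<lambda>n. integral {a..b} (q n)) \<longlonglongrightarrow> integral {a..b} g"
  proof (rule dominated_convergence(2)[OF qi gi])
    show "norm (q n x) \<le> g x" if "x \<in> {a..b}" for n x by (simp add: q_def g_def)
    fix x
    obtain N :: nat where "g x \<le> real N" using real_arch_simple by blast
    then have "eventually (\<lambda>n. q n x = g x) sequentially"
      unfolding eventually_sequentially by (intro exI[of _ N]) (auto simp: q_def)
    then show "(\<lambda>n. q n x) \<longlonglongrightarrow> g x" by (rule tendsto_eventually)
  qed
  then obtain n where n: "\<bar>integral {a..b} (q n) - integral {a..b} g\<bar> < e / 2"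
    using LIMSEQ_D[of _ _ "e / 2"] e by (metis half_gt_zero order_refl real_norm_def)
  define d where "d = e / (2 * (real n + 1))"
  have d: "d > 0" using e by (simp add: d_def)
  have "variation_on F D < e" if D: "D \<in> subintervals a b" and len: "(\<Sum>(u, v)\<in>D. v - u) < d" for D
  proof -
    have "variation_on F D \<le> (\<Sum>(u, v)\<in>D. integral {u..v} (\<lambda>x. g x - q n x) + real n * (v - u))"
      unfolding variation_on_def
    proof (rule sum_mono)
      fix I assume I: "I \<in> D"
      obtain u v where uv: "I = (u, v)" by force
      have ab: "a \<le> u" "u \<le> v" "v \<le> b" using subintervalsD(2)[OF D, of u v] I uv by auto
      have fi: "f integrable_on {u..v}" and gi': "g integrable_on {u..v}" and qi': "q n integrable_on {u..v}"
        using integrable_on_subinterval[OF set_lebesgue_integral_eq_integral(1)[OF f], of u v]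
          integrable_on_subinterval[OF gi, of u v] integrable_on_subinterval[OF qi, of u v] ab by auto
      have "cmod (F v - F u) \<le> integral {u..v} g"
        unfolding F[OF ab] by (rule integral_norm_bound_integral[OF fi gi']) (simp add: g_def)
      also have "\<dots> = integral {u..v} (\<lambda>x. g x - q n x) + integral {u..v} (q n)"
        using gi' qi' by (subst integral_diff) auto
      also have "integral {u..v} (q n) \<le> integral {u..v} (\<lambda>x. real n)"
        by (intro integral_le qi') (auto simp: q_def)
      finally show "(case I of (u, v) \<Rightarrow> cmod (F v - F u)) \<le>
          (case I of (u, v) \<Rightarrow> integral {u..v} (\<lambda>x. g x - q n x) + real n * (v - u))"
        using uv ab by (simp add: mult.commute)
    qed
    also have "\<dots> = (\<Sum>(u, v)\<in>D. integral {u..v} (\<lambda>x. g x - q n x)) + real n * (\<Sum>(u, v)\<in>D. v - u)"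
      by (simp add: split_beta sum.distrib sum_distrib_left)
    also have "(\<Sum>(u, v)\<in>D. integral {u..v} (\<lambda>x. g x - q n x)) \<le> integral {a..b} (\<lambda>x. g x - q n x)"
      by (intro sum_integral_subintervals_le[OF D] integrable_diff gi qi) (auto simp: q_def)
    also have "integral {a..b} (\<lambda>x. g x - q n x) = integral {a..b} g - integral {a..b} (q n)"
      by (rule integral_diff[OF gi qi])
    also have "\<dots> < e / 2" using n by linarith
    also have "real n * (\<Sum>(u, v)\<in>D. v - u) \<le> real n * d" using len by (intro mult_left_mono) auto
    also have "real n * d \<le> e / 2" using e by (simp add: d_def field_simps)
    finally show ?thesis by simp
  qed
  with d show "\<exists>d>0. \<forall>D\<in>subintervals a b. (\<Sum>(u, v)\<in>D. v - u) < d \<longrightarrow> variation_on F D < e" by blast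
qed

text \<open>
  The working notion for the rest of the proof: \<open>F\<close> is locally absolutely continuous on \<open>(0,\<infinity>)\<close>
  with almost everywhere derivative \<open>f\<close>, expressed by integrals only.
\<close>

definition primitive_of :: "(real \<Rightarrow> complex) \<Rightarrow> (real \<Rightarrow> complex) \<Rightarrow> bool" where
  "primitive_of f F \<longleftrightarrow> (\<forall>x y. 0 < x \<and> x \<le> y \<longrightarrow>
     f absolutely_integrable_on {x..y} \<and> integral {x..y} f = F y - F x)"

lemma primitive_ofD:
  assumes "primitive_of f F" "0 < x" "x \<le> y"
  shows "f absolutely_integrable_on {x..y}" "integral {x..y} f = F y - F x"
    "f integrable_on {x..y}" "(f has_integral (F y - F x)) {x..y}"
proof -
  show 1: "f absolutely_integrable_on {x..y}" "integral {x..y} f = F y - F x"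
    using assms unfolding primitive_of_def by auto
  show 2: "f integrable_on {x..y}" using 1(1) by (rule set_lebesgue_integral_eq_integral(1))
  show "(f has_integral (F y - F x)) {x..y}" using integrable_integral[OF 2] 1(2) by simp
qed

lemma primitive_ofI:
  assumes "\<And>x y. 0 < x \<Longrightarrow> x \<le> y \<Longrightarrow> f absolutely_integrable_on {x..y}"
    "\<And>x y. 0 < x \<Longrightarrow> x \<le> y \<Longrightarrow> (f has_integral (F y - F x)) {x..y}"
  shows "primitive_of f F"
  unfolding primitive_of_def using assms integral_unique by blast

lemma primitive_of_ac:
  assumes "primitive_of f F" "0 < a" "a \<le> b"
  shows "abs_continuous_on_Icc a b F"
  by (rule integral_ac[OF primitive_ofD(1)[OF assms]])
     (use assms primitive_ofD(2)[OF assms(1)] in auto)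

lemma primitive_of_lac: "primitive_of f F \<Longrightarrow> locally_abs_continuous F"
  unfolding locally_abs_continuous_def by (auto intro: primitive_of_ac)

lemma negligible_UN_nat: "(\<And>n::nat. negligible (N n)) \<Longrightarrow> negligible (\<Union>n. N n)"
  by (rule negligible_countable_Union) auto

lemma exhaust_halfline:
  assumes "0 < (x::real)"
  obtains n :: nat where "x \<in> {inverse (real (Suc n))<..<real (Suc n)}"
proof -
  obtain n :: nat where n: "x + inverse x < real n" using reals_Archimedean2 by blast
  have i0: "inverse x > 0" using assms by simp
  have "inverse x < real (Suc n)" "x < real (Suc n)" unfolding of_nat_Suc using n assms i0 by linarith+
  then have "inverse (real (Suc n)) < x"
    using assms by (metis inverse_inverse_eq inverse_less_imp_less inverse_positive_iff_positive less_trans inverse_less_iff_less)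
  with \<open>x < real (Suc n)\<close> show ?thesis using that by auto
qed

lemma primitive_of_deriv:
  assumes F: "primitive_of f F"
  obtains N where "negligible N" "\<And>x. x > 0 \<Longrightarrow> x \<notin> N \<Longrightarrow> (F has_vector_derivative f x) (at x)"
proof -
  have "\<exists>N. negligible N \<and> (\<forall>x\<in>{inverse (real (Suc n))<..<real (Suc n)} - N. (F has_vector_derivative f x) (at x))" for n
  proof -
    let ?a = "inverse (real (Suc n))" and ?b = "real (Suc n)"
    have ab: "0 < ?a" "?a \<le> ?b" using inverse_le_1_iff[of "real (Suc n)"] by (auto intro: order_trans[of _ 1])
    obtain N where N: "negligible N"
      "\<And>x. x \<in> {?a<..<?b} - N \<Longrightarrow> ((\<lambda>x. integral {?a..x} f) has_vector_derivative f x) (at x)"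
      using lebesgue_differentiation[OF primitive_ofD(3)[OF F ab]] by blast
    have "(F has_vector_derivative f x) (at x)" if x: "x \<in> {?a<..<?b} - N" for x
    proof -
      have "((\<lambda>x. integral {?a..x} f + F ?a) has_vector_derivative f x) (at x)"
        using N(2)[OF x] by (auto intro!: derivative_eq_intros)
      then show ?thesis
        by (rule has_vector_derivative_transform_within_open[where S = "{?a<..<?b}"])
           (use x primitive_ofD(2)[OF F ab(1)] in auto)
    qed
    with N(1) show ?thesis by blast
  qed
  then obtain N where N: "\<And>n. negligible (N n)"
    "\<And>n x. x \<in> {inverse (real (Suc n))<..<real (Suc n)} - N n \<Longrightarrow> (F has_vector_derivative f x) (at x)"
    by metis
  show ?thesis
  proof (rule that[of "\<Union>n. N n"])
    show "negligible (\<Union>n. N n)" by (rule negligible_UN_nat) (rule N)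
    show "(F has_vector_derivative f x) (at x)" if "x > 0" "x \<notin> (\<Union>n. N n)" for x
      using exhaust_halfline[OF that(1)] N(2) that(2) by (metis Diff_iff UN_I UNIV_I)
  qed
qed

lemma lac_differentiable_ae:
  assumes F: "locally_abs_continuous F"
  obtains N where "negligible N" "\<And>x. x > 0 \<Longrightarrow> x \<notin> N \<Longrightarrow> (F has_vector_derivative vderiv F x) (at x)"
proof -
  have "\<exists>N. negligible N \<and> (\<forall>x\<in>{inverse (real (Suc n))<..<real (Suc n)} - N. (F has_vector_derivative vderiv F x) (at x))" for n
  proof (cases "n = 0")
    case False
    let ?a = "inverse (real (Suc n))" and ?b = "real (Suc n)"
    have ab: "0 < ?a" "?a < ?b" using False inverse_less_1_iff[of "real (Suc n)"] by (auto intro: less_trans[of _ 1])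
    obtain N f where N: "negligible N"
      "\<And>x. x \<in> {?a<..<?b} - N \<Longrightarrow> (F has_vector_derivative f x) (at x)"
      using ac_differentiable_ae[of ?a ?b F] F ab unfolding locally_abs_continuous_def by (metis less_imp_le)
    then show ?thesis using vector_derivative_at by metis
  qed (auto intro: exI[of _ "{}"])
  then obtain N where N: "\<And>n. negligible (N n)"
    "\<And>n x. x \<in> {inverse (real (Suc n))<..<real (Suc n)} - N n \<Longrightarrow> (F has_vector_derivative vderiv F x) (at x)"
    by metis
  show ?thesis
  proof (rule that[of "\<Union>n. N n"])
    show "negligible (\<Union>n. N n)" by (rule negligible_UN_nat) (rule N)
    show "(F has_vector_derivative vderiv F x) (at x)" if "x > 0" "x \<notin> (\<Union>n. N n)" for x
      using exhaust_halfline[OF that(1)] N(2) that(2) by (metis Diff_iff UN_I UNIV_I)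
  qed
qed

lemma lac_primitive_of:
  assumes F: "\<And>a b. 0 < a \<Longrightarrow> a < b \<Longrightarrow> abs_continuous_on_Icc a b F" and N: "negligible N"
    and f: "\<And>x. x > 0 \<Longrightarrow> x \<notin> N \<Longrightarrow> (F has_vector_derivative f x) (at x)"
  shows "primitive_of f F"
  unfolding primitive_of_def
proof (intro allI impI, elim conjE)
  fix x y :: real assume xy: "0 < x" "x \<le> y"
  show "f absolutely_integrable_on {x..y} \<and> integral {x..y} f = F y - F x"
  proof (cases "x = y")
    case True
    then show ?thesis using absolutely_integrable_on_null[of x x f] by simp
  next
    case False
    then have "x < y" using xy by simp
    with ac_FTC[OF F[OF xy(1)] xy(2) N, of f] f xy show ?thesis
      by (auto intro: integral_unique)
  qed
qed

lemma primitive_of_mult: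
  assumes F: "primitive_of f F" and G: "primitive_of g G"
  shows "primitive_of (\<lambda>x. F x * g x + f x * G x) (\<lambda>x. F x * G x)"
proof -
  obtain N where N: "negligible N" "\<And>x. x > 0 \<Longrightarrow> x \<notin> N \<Longrightarrow> (F has_vector_derivative f x) (at x)"
    by (rule primitive_of_deriv[OF F]) (erule that, blast)
  obtain N' where N': "negligible N'" "\<And>x. x > 0 \<Longrightarrow> x \<notin> N' \<Longrightarrow> (G has_vector_derivative g x) (at x)"
    by (rule primitive_of_deriv[OF G]) (erule that, blast)
  show ?thesis
  proof (rule lac_primitive_of)
    show "abs_continuous_on_Icc a b (\<lambda>x. F x * G x)" if "0 < a" "a < b" for a b
      using that by (intro ac_mult primitive_of_ac[OF F] primitive_of_ac[OF G]) auto
    show "negligible (N \<union> N')" using N(1) N'(1) by simp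
    show "((\<lambda>x. F x * G x) has_vector_derivative F x * g x + f x * G x) (at x)"
      if "x > 0" "x \<notin> N \<union> N'" for x
      using has_vector_derivative_mult[OF N(2)[of x] N'(2)[of x]] that by simp
  qed
qed

lemma primitive_of_linear:
  assumes F: "primitive_of f F" and G: "primitive_of g G"
  shows "primitive_of (\<lambda>x. c * f x + d * g x) (\<lambda>x. c * F x + d * G x)"
proof (rule primitive_ofI)
  fix x y :: real assume xy: "0 < x" "x \<le> y"
  show "(\<lambda>x. c * f x + d * g x) absolutely_integrable_on {x..y}"
    using primitive_ofD(1)[OF F xy] primitive_ofD(1)[OF G xy]
    by (intro set_integral_add set_integrable_mult_right) auto
  have "((\<lambda>x. c * f x + d * g x) has_integral (c * (F y - F x) + d * (G y - G x))) {x..y}"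
    by (intro has_integral_add has_integral_mult_right primitive_ofD(4)[OF F xy] primitive_ofD(4)[OF G xy])
  then show "((\<lambda>x. c * f x + d * g x) has_integral (c * F y + d * G y - (c * F x + d * G x))) {x..y}"
    by (simp add: algebra_simps)
qed

lemma primitive_of_cnj:
  assumes F: "primitive_of f F"
  shows "primitive_of (\<lambda>x. cnj (f x)) (\<lambda>x. cnj (F x))"
proof (rule primitive_ofI)
  fix x y :: real assume xy: "0 < x" "x \<le> y"
  show "(\<lambda>x. cnj (f x)) absolutely_integrable_on {x..y}"
    using absolutely_integrable_linear[OF primitive_ofD(1)[OF F xy] bounded_linear_cnj] by (simp add: o_def)
  show "((\<lambda>x. cnj (f x)) has_integral (cnj (F y) - cnj (F x))) {x..y}"
    using has_integral_linear[OF primitive_ofD(4)[OF F xy] bounded_linear_cnj] by (simp add: o_def)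
qed

lemma primitive_of_C1:
  assumes F: "\<And>x. x > 0 \<Longrightarrow> (F has_vector_derivative f x) (at x)" and f: "continuous_on {0<..} f"
  shows "primitive_of f F"
proof (rule primitive_ofI)
  fix x y :: real assume xy: "0 < x" "x \<le> y"
  show "f absolutely_integrable_on {x..y}"
    using xy by (intro absolutely_integrable_continuous_real continuous_on_subset[OF f]) auto
  show "(f has_integral (F y - F x)) {x..y}"
    using xy F by (intro fundamental_theorem_of_calculus) (auto intro: has_vector_derivative_at_within)
qed

lemma primitive_of_continuous:
  assumes "primitive_of f F" shows "continuous_on {0<..} F"
proof (rule continuous_at_imp_continuous_on, rule ballI)
  fix x :: real assume x: "x \<in> {0<..}"
  have "continuous_on {x/2..x+1} F"
    using x by (intro ac_continuous_on primitive_of_ac[OF assms]) auto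
  then show "isCont F x" using x by (intro continuous_on_interior[of "{x/2..x+1}"]) (auto simp: interior_atLeastAtMost_real)
qed

lemma primitive_of_spike:
  assumes F: "primitive_of f F" and N: "negligible N" and eq: "\<And>x. x > 0 \<Longrightarrow> x \<notin> N \<Longrightarrow> g x = f x"
  shows "primitive_of g F"
proof (rule primitive_ofI)
  fix x y :: real assume xy: "0 < x" "x \<le> y"
  show "g absolutely_integrable_on {x..y}"
    by (rule absolutely_integrable_spike[OF primitive_ofD(1)[OF F xy] N]) (use xy eq in auto)
  show "(g has_integral (F y - F x)) {x..y}"
    by (rule has_integral_spike[OF N _ primitive_ofD(4)[OF F xy]]) (use xy eq in auto)
qed

lemma primitive_of_cong:
  assumes "primitive_of f F" "\<And>x. x > 0 \<Longrightarrow> G x = F x"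
  shows "primitive_of f G"
  using assms unfolding primitive_of_def by auto

lemma primitive_of_continuous_deriv:
  assumes F: "primitive_of f F" and f: "continuous_on {0<..} f" and x: "x > 0"
  shows "(F has_vector_derivative f x) (at x)"
proof -
  have c: "continuous_on {x/2..x+1} f" using x by (intro continuous_on_subset[OF f]) auto
  have "((\<lambda>u. integral {x/2..u} f) has_vector_derivative f x) (at x within {x/2..x+1})"
    by (rule integral_has_vector_derivative[OF c]) (use x in auto)
  then have "((\<lambda>u. integral {x/2..u} f) has_vector_derivative f x) (at x)"
    using x at_within_interior[of x "{x/2..x+1}"] by (simp add: interior_atLeastAtMost_real)
  then have "((\<lambda>u. integral {x/2..u} f + F (x/2)) has_vector_derivative f x) (at x)"
    by (auto intro!: derivative_eq_intros)
  then show ?thesis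
    by (rule has_vector_derivative_transform_within_open[where S = "{x/2<..<x+1}"])
       (use x primitive_ofD(2)[OF F, of "x/2"] in auto)
qed

section \<open>The space of square-integrable functions\<close>

lemma borel_measurable_cnj [measurable]: "cnj \<in> borel_measurable borel"
  by (intro borel_measurable_continuous_onI continuous_intros)

lemma L2D:
  assumes "f \<in> L2 M"
  shows "f \<in> borel_measurable M" "integrable M (\<lambda>x. (cmod (f x))\<^sup>2)"
  using assms by (auto simp: L2_def)

lemma L2_norm_sq: "(L2_norm M f)\<^sup>2 = (LINT x|M. (cmod (f x))\<^sup>2)"
  by (simp add: L2_norm_def)

lemma L2_norm_nonneg: "L2_norm M f \<ge> 0"
  by (simp add: L2_norm_def)

lemma L2_cong_AE:
  assumes "f \<in> L2 M" "g \<in> borel_measurable M" "AE x in M. f x = g x"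
  shows "g \<in> L2 M"
proof -
  have "integrable M (\<lambda>x. (cmod (g x))\<^sup>2)"
    by (rule integrable_cong_AE_imp[OF L2D(2)[OF assms(1)]]) (use assms in \<open>auto elim!: eventually_mono\<close>)
  then show ?thesis using assms by (simp add: L2_def)
qed

lemma L2_norm_cong_AE:
  assumes "f \<in> borel_measurable M" "g \<in> borel_measurable M" "AE x in M. f x = g x"
  shows "L2_norm M f = L2_norm M g"
  unfolding L2_norm_def using assms
  by (intro arg_cong[where f = sqrt] integral_cong_AE) (auto elim!: eventually_mono)

lemma L2_zero: "(\<lambda>x. 0) \<in> L2 M" by (simp add: L2_def)

lemma L2_scale: "f \<in> L2 M \<Longrightarrow> (\<lambda>x. c * f x) \<in> L2 M"
  by (auto simp: L2_def norm_mult power_mult_distrib)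

lemma L2_cnj: "f \<in> L2 M \<Longrightarrow> (\<lambda>x. cnj (f x)) \<in> L2 M"
  by (auto simp: L2_def)

lemma sq_norm_add_le: "(cmod (a + b))\<^sup>2 \<le> 2 * (cmod a)\<^sup>2 + 2 * (cmod b)\<^sup>2"
proof -
  have "(cmod (a + b))\<^sup>2 \<le> (cmod a + cmod b)\<^sup>2"
    by (intro power_mono norm_triangle_ineq) auto
  also have "\<dots> \<le> 2 * (cmod a)\<^sup>2 + 2 * (cmod b)\<^sup>2"
    using zero_le_power2[of "cmod a - cmod b"] by (simp add: power2_eq_square algebra_simps)
  finally show ?thesis .
qed

lemma L2_add:
  assumes "f \<in> L2 M" "g \<in> L2 M"
  shows "(\<lambda>x. f x + g x) \<in> L2 M"
proof -
  have [measurable]: "f \<in> borel_measurable M" "g \<in> borel_measurable M" using assms L2D(1) by auto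
  have "integrable M (\<lambda>x. 2 * (cmod (f x))\<^sup>2 + 2 * (cmod (g x))\<^sup>2)"
    using L2D(2)[OF assms(1)] L2D(2)[OF assms(2)] by auto
  then have "integrable M (\<lambda>x. (cmod (f x + g x))\<^sup>2)"
    by (rule Bochner_Integration.integrable_bound) (use sq_norm_add_le in auto)
  then show ?thesis by (simp add: L2_def)
qed

lemma L2_diff: "f \<in> L2 M \<Longrightarrow> g \<in> L2 M \<Longrightarrow> (\<lambda>x. f x - g x) \<in> L2 M"
  using L2_add[of f M "\<lambda>x. (- 1) * g x"] L2_scale[of g M "-1"] by simp

lemma L2_sum: "(\<And>i. i \<in> I \<Longrightarrow> f i \<in> L2 M) \<Longrightarrow> (\<lambda>x. \<Sum>i\<in>I. f i x) \<in> L2 M"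
  by (induction I rule: infinite_finite_induct) (auto intro: L2_zero L2_add)

lemma L2_mult_integrable:
  assumes "f \<in> L2 M" "g \<in> L2 M"
  shows "integrable M (\<lambda>x. f x * g x)"
proof -
  have [measurable]: "f \<in> borel_measurable M" "g \<in> borel_measurable M" using assms L2D(1) by auto
  have "integrable M (\<lambda>x. (cmod (f x))\<^sup>2 + (cmod (g x))\<^sup>2)"
    using L2D(2)[OF assms(1)] L2D(2)[OF assms(2)] by auto
  then show ?thesis
  proof (rule Bochner_Integration.integrable_bound)
    show "AE x in M. norm (f x * g x) \<le> norm ((cmod (f x))\<^sup>2 + (cmod (g x))\<^sup>2)"
    proof (rule AE_I2)
      fix x
      have "cmod (f x) * cmod (g x) \<le> (cmod (f x))\<^sup>2 + (cmod (g x))\<^sup>2"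
        using sum_squares_bound[of "cmod (f x)" "cmod (g x)"]
          mult_nonneg_nonneg[OF norm_ge_zero norm_ge_zero, of "f x" "g x"] by linarith
      then show "norm (f x * g x) \<le> norm ((cmod (f x))\<^sup>2 + (cmod (g x))\<^sup>2)"
        by (simp add: norm_mult)
    qed
  qed auto
qed

lemma L2_inner_integrable:
  "f \<in> L2 M \<Longrightarrow> g \<in> L2 M \<Longrightarrow> integrable M (\<lambda>x. f x * cnj (g x))"
  by (intro L2_mult_integrable L2_cnj)

lemma L2_inner_self: "L2_inner M f f = of_real ((L2_norm M f)\<^sup>2)"
  unfolding L2_inner_def L2_norm_sq
  by (simp add: complex_norm_square[symmetric] del: of_real_power flip: integral_complex_of_real)

lemma L2_inner_cnj: "cnj (L2_inner M f g) = L2_inner M g f"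
proof -
  have "cnj (LINT x|M. f x * cnj (g x)) = (LINT x|M. cnj (f x * cnj (g x)))"
    by (rule integral_bounded_linear'[OF bounded_linear_cnj bounded_linear_cnj, symmetric]) simp
  then show ?thesis unfolding L2_inner_def by (simp add: mult.commute)
qed

lemma L2_inner_linear:
  assumes "f \<in> L2 M" "g \<in> L2 M" "h \<in> L2 M"
  shows "L2_inner M (\<lambda>x. f x + c * g x) h = L2_inner M f h + c * L2_inner M g h"
  unfolding L2_inner_def using L2_inner_integrable[OF assms(1,3)] L2_inner_integrable[OF assms(2,3)]
  by (simp add: distrib_right mult.assoc)

lemma L2_inner_diff:
  assumes "f \<in> L2 M" "g \<in> L2 M" "h \<in> L2 M"
  shows "L2_inner M (\<lambda>x. f x - g x) h = L2_inner M f h - L2_inner M g h"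
  using L2_inner_linear[OF assms, of "-1"] by simp

lemma L2_inner_scale: "L2_inner M (\<lambda>x. c * f x) g = c * L2_inner M f g"
  unfolding L2_inner_def by (simp add: mult.assoc)

lemma L2_inner_scale_right: "L2_inner M f (\<lambda>x. c * g x) = cnj c * L2_inner M f g"
  using L2_inner_scale[of M c g f] L2_inner_cnj by (metis complex_cnj_mult)

lemma L2_inner_sum:
  assumes "\<And>i. i \<in> I \<Longrightarrow> f i \<in> L2 M" "g \<in> L2 M"
  shows "L2_inner M (\<lambda>x. \<Sum>i\<in>I. c i * f i x) g = (\<Sum>i\<in>I. c i * L2_inner M (f i) g)"
  unfolding L2_inner_def sum_distrib_right using assms
  by (subst Bochner_Integration.integral_sum) (auto simp: mult.assoc intro!: L2_inner_integrable)

lemma L2_inner_cong_AE: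
  assumes "f \<in> borel_measurable M" "f' \<in> borel_measurable M" "g \<in> borel_measurable M"
    "AE x in M. f x = f' x"
  shows "L2_inner M f g = L2_inner M f' g"
  unfolding L2_inner_def using assms
  by (intro integral_cong_AE) (auto elim!: eventually_mono)

lemma L2_Cauchy_Schwarz_norm:
  assumes "f \<in> L2 M" "g \<in> L2 M"
  shows "(LINT x|M. cmod (f x) * cmod (g x)) \<le> L2_norm M f * L2_norm M g"
proof -
  define A where "A = L2_norm M f"
  define B where "B = L2_norm M g"
  have AB: "A \<ge> 0" "B \<ge> 0" by (auto simp: A_def B_def L2_norm_nonneg)
  have int: "integrable M (\<lambda>x. cmod (f x) * cmod (g x))"
    using integrable_norm[OF L2_mult_integrable[OF assms]] by (simp add: norm_mult)
  have *: "(LINT x|M. cmod (f x) * cmod (g x)) \<le> (A + d) * (B + d)" if d: "d > 0" for d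
  proof -
    \<comment> \<open>The minimising parameter in Young's inequality; \<open>d > 0\<close> excludes vanishing norms.\<close>
    define t where "t = (B + d) / (A + d)"
    have pos: "A + d > 0" "B + d > 0" "t > 0" using AB d by (auto simp: t_def)
    have "(LINT x|M. cmod (f x) * cmod (g x)) \<le> (LINT x|M. (t * (cmod (f x))\<^sup>2 + (cmod (g x))\<^sup>2 / t) / 2)"
    proof (rule integral_mono[OF int])
      show "integrable M (\<lambda>x. (t * (cmod (f x))\<^sup>2 + (cmod (g x))\<^sup>2 / t) / 2)"
        using L2D(2)[OF assms(1)] L2D(2)[OF assms(2)] by auto
      fix x
      have "0 \<le> (t * cmod (f x) - cmod (g x))\<^sup>2 / t" using pos by simp
      then show "cmod (f x) * cmod (g x) \<le> (t * (cmod (f x))\<^sup>2 + (cmod (g x))\<^sup>2 / t) / 2"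
        using pos by (simp add: power2_eq_square field_simps)
    qed
    also have "\<dots> = (t * A\<^sup>2 + B\<^sup>2 / t) / 2"
      using L2D(2)[OF assms(1)] L2D(2)[OF assms(2)] by (simp add: A_def B_def L2_norm_sq)
    also have "\<dots> \<le> (t * (A + d)\<^sup>2 + (B + d)\<^sup>2 / t) / 2"
      using pos AB d by (intro divide_right_mono add_mono mult_left_mono power_mono) auto
    also have "\<dots> = (A + d) * (B + d)" using pos by (simp add: t_def power2_eq_square)
    finally show ?thesis .
  qed
  have "((\<lambda>d. (A + d) * (B + d)) \<longlongrightarrow> (A + 0) * (B + 0)) (at_right 0)"
    by (intro tendsto_intros)
  then have "(LINT x|M. cmod (f x) * cmod (g x)) \<le> (A + 0) * (B + 0)"
    by (rule tendsto_lowerbound) (auto simp: eventually_at_filter * intro!: always_eventually)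
  then show ?thesis by (simp add: A_def B_def)
qed

lemma L2_Cauchy_Schwarz:
  assumes "f \<in> L2 M" "g \<in> L2 M"
  shows "cmod (L2_inner M f g) \<le> L2_norm M f * L2_norm M g"
proof -
  have "cmod (L2_inner M f g) \<le> (LINT x|M. cmod (f x * cnj (g x)))"
    unfolding L2_inner_def by (rule integral_norm_bound)
  also have "\<dots> \<le> L2_norm M f * L2_norm M g"
    using L2_Cauchy_Schwarz_norm[OF assms] by (simp add: norm_mult)
  finally show ?thesis .
qed

lemma L2_norm_minus_commute: "L2_norm M (\<lambda>x. f x - g x) = L2_norm M (\<lambda>x. g x - f x)"
  by (simp add: L2_norm_def norm_minus_commute)

lemma L2_norm_eq_0:
  assumes "f \<in> L2 M" shows "L2_norm M f = 0 \<longleftrightarrow> (AE x in M. f x = 0)"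
  using integral_nonneg_eq_0_iff_AE[OF L2D(2)[OF assms]] by (simp add: L2_norm_def)

lemma L2_nn_integral:
  assumes "f \<in> L2 M"
  shows "(\<integral>\<^sup>+ x. ennreal ((cmod (f x))\<^sup>2) \<partial>M) = ennreal ((L2_norm M f)\<^sup>2)"
  unfolding L2_norm_sq by (rule nn_integral_eq_integral[OF L2D(2)[OF assms]]) simp

text \<open>
  Square integrability together with a norm bound, in the form in which Fatou's lemma delivers it.
\<close>

lemma L2_of_nn_integral_le:
  assumes [measurable]: "f \<in> borel_measurable M"
    and le: "(\<integral>\<^sup>+ x. ennreal ((cmod (f x))\<^sup>2) \<partial>M) \<le> ennreal (C\<^sup>2)" and C: "C \<ge> 0"
  shows "f \<in> L2 M" "L2_norm M f \<le> C"
proof -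
  have "integrable M (\<lambda>x. (cmod (f x))\<^sup>2)"
    using le by (intro integrableI_bounded) (auto simp: less_top[symmetric] top_unique)
  then show f: "f \<in> L2 M" by (simp add: L2_def)
  have "(L2_norm M f)\<^sup>2 \<le> C\<^sup>2"
    using le L2_nn_integral[OF f] by simp
  then show "L2_norm M f \<le> C" using C power2_le_imp_le by blast
qed

text \<open>
  Riesz--Fischer.  Along a subsequence the consecutive differences \<open>g\<^sub>k\<close> have norm at most \<open>2\<^sup>-\<^sup>k\<close>; then
  \<open>\<Sum>k. 2\<^sup>k \<bar>g\<^sub>k\<bar>\<^sup>2\<close> is integrable, hence finite almost everywhere, so \<open>\<bar>g\<^sub>k\<bar>\<close> decays geometrically
  and the subsequence converges pointwise.  Fatou's lemma turns this into convergence in norm.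
\<close>

theorem L2_complete:
  assumes s: "\<And>n. s n \<in> L2 M"
    and cauchy: "\<And>e. e > 0 \<Longrightarrow> \<exists>N. \<forall>m\<ge>N. \<forall>n\<ge>N. L2_norm M (\<lambda>x. s m x - s n x) < e"
  obtains F where "F \<in> L2 M" "(\<lambda>n. L2_norm M (\<lambda>x. s n x - F x)) \<longlonglongrightarrow> 0"
proof -
  have [measurable]: "s n \<in> borel_measurable M" for n using L2D(1)[OF s] .
  have "\<forall>k. \<exists>N. \<forall>m\<ge>N. \<forall>n\<ge>N. L2_norm M (\<lambda>x. s m x - s n x) < (1/2)^k"
    using cauchy by simp
  then obtain N where N: "\<And>k m n. m \<ge> N k \<Longrightarrow> n \<ge> N k \<Longrightarrow> L2_norm M (\<lambda>x. s m x - s n x) < (1/2)^k"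
    by metis
  \<comment> \<open>Partial sums, so that \<open>r\<close> is increasing and \<open>r k \<ge> N k\<close>.\<close>
  define r where "r k = (\<Sum>j\<le>k. N j)" for k
  have rN: "r k \<ge> N k" for k unfolding r_def by (rule member_le_sum) auto
  have rmono: "r k \<le> r (Suc k)" for k by (simp add: r_def)
  define g where "g k x = s (r (Suc k)) x - s (r k) x" for k x
  have [measurable]: "g k \<in> borel_measurable M" for k by (simp add: g_def[abs_def])
  have gL: "g k \<in> L2 M" for k unfolding g_def[abs_def] by (intro L2_diff s)
  have gn: "L2_norm M (g k) \<le> (1/2)^k" for k
    unfolding g_def using N[of k "r (Suc k)" "r k"] rN[of k] rmono[of k] by (simp add: less_imp_le)
  have "(\<integral>\<^sup>+ x. (\<Sum>k. ennreal (2^k * (cmod (g k x))\<^sup>2)) \<partial>M) = (\<Sum>k. \<integral>\<^sup>+ x. ennreal (2^k * (cmod (g k x))\<^sup>2) \<partial>M)"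
    by (rule nn_integral_suminf) measurable
  also have "\<dots> \<le> (\<Sum>k. ennreal ((1/2)^k))"
  proof (intro suminf_le summableI)
    fix k
    have "(\<integral>\<^sup>+ x. ennreal (2^k * (cmod (g k x))\<^sup>2) \<partial>M) = ennreal (2^k * (L2_norm M (g k))\<^sup>2)"
      by (simp add: ennreal_mult nn_integral_cmult L2_nn_integral[OF gL])
    also have "\<dots> \<le> ennreal (2^k * ((1/2)^k)\<^sup>2)"
      using gn by (intro ennreal_leI mult_left_mono power_mono L2_norm_nonneg) auto
    also have "2^k * ((1/2)^k)\<^sup>2 = ((1/2)^k :: real)"
      by (simp add: power2_eq_square power_divide)
    finally show "(\<integral>\<^sup>+ x. ennreal (2^k * (cmod (g k x))\<^sup>2) \<partial>M) \<le> ennreal ((1/2)^k)" .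
  qed
  also have "\<dots> = ennreal 2"
    using geometric_sums[of "1/2::real"] by (intro suminf_ennreal_eq) auto
  finally have "AE x in M. (\<Sum>k. ennreal (2^k * (cmod (g k x))\<^sup>2)) \<noteq> \<infinity>"
    by (intro nn_integral_PInf_AE) (auto simp: top_unique)
  then have conv: "AE x in M. convergent (\<lambda>k. s (r k) x)"
  proof eventually_elim
    case (elim x)
    define C where "C = enn2real (\<Sum>k. ennreal (2^k * (cmod (g k x))\<^sup>2))"
    have C: "(\<Sum>k. ennreal (2^k * (cmod (g k x))\<^sup>2)) = ennreal C" "C \<ge> 0"
      unfolding C_def
      by (rule ennreal_enn2real[symmetric], rule iffD1[OF less_top], rule elim[unfolded infinity_ennreal_def]) (rule enn2real_nonneg)
    have le: "cmod (g k x) \<le> sqrt C * (sqrt (1/2))^k" for k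
    proof -
      have "ennreal (2^k * (cmod (g k x))\<^sup>2) \<le> ennreal C"
      proof -
        have "(\<Sum>k\<in>{k}. ennreal (2^k * (cmod (g k x))\<^sup>2)) \<le> (\<Sum>k. ennreal (2^k * (cmod (g k x))\<^sup>2))"
          by (rule sum_le_suminf) (auto intro: summableI)
        then show ?thesis unfolding C(1) by (simp only: sum.insert[OF finite.emptyI] sum.empty empty_iff not_False_eq_True add_0_right)
      qed
      then have "2^k * (cmod (g k x))\<^sup>2 \<le> C" using C(2) by simp
      then have "(cmod (g k x))\<^sup>2 \<le> C * (1/2)^k" by (simp add: field_simps power_divide)
      then have "cmod (g k x) \<le> sqrt (C * (1/2)^k)" by (rule real_le_rsqrt)
      then show ?thesis by (simp add: real_sqrt_mult real_sqrt_power)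
    qed
    have "summable (\<lambda>k. g k x)"
      by (rule summable_comparison_test'[where N = 0 and g = "\<lambda>k. sqrt C * (sqrt (1/2))^k"])
         (use le in \<open>auto intro!: summable_mult summable_geometric\<close>)
    then have "convergent (\<lambda>n. \<Sum>k<n. g k x)" by (simp add: summable_iff_convergent)
    then have "convergent (\<lambda>n. (\<Sum>k<n. g k x) + s (r 0) x)" by (intro convergent_add convergent_const)
    moreover have "(\<Sum>k<n. g k x) + s (r 0) x = s (r n) x" for n
      unfolding g_def using sum_lessThan_telescope[of "\<lambda>k. s (r k) x" n] by simp
    ultimately show ?case by simp
  qed
  define F where "F x = lim (\<lambda>k. s (r k) x)" for x
  have [measurable]: "F \<in> borel_measurable M" unfolding F_def[abs_def] by (rule borel_measurable_lim_metric) measurable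
  have lim: "AE x in M. (\<lambda>k. s (r k) x) \<longlonglongrightarrow> F x"
    using conv by eventually_elim (simp add: F_def convergent_LIMSEQ_iff)
  have close: "(\<lambda>x. s n x - F x) \<in> L2 M \<and> L2_norm M (\<lambda>x. s n x - F x) \<le> (1/2)^k" if n: "n \<ge> N k" for n k
  proof -
    have "(\<integral>\<^sup>+ x. ennreal ((cmod (s n x - F x))\<^sup>2) \<partial>M) =
        (\<integral>\<^sup>+ x. liminf (\<lambda>j. ennreal ((cmod (s n x - s (r j) x))\<^sup>2)) \<partial>M)"
    proof (rule nn_integral_cong_AE)
      show "AE x in M. ennreal ((cmod (s n x - F x))\<^sup>2) = liminf (\<lambda>j. ennreal ((cmod (s n x - s (r j) x))\<^sup>2))"
        using lim
      proof eventually_elim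
        case (elim x)
        have "(\<lambda>j. ennreal ((cmod (s n x - s (r j) x))\<^sup>2)) \<longlonglongrightarrow> ennreal ((cmod (s n x - F x))\<^sup>2)"
          by (intro tendsto_intros elim)
        then show ?case by (rule lim_imp_Liminf[OF sequentially_bot, symmetric])
      qed
    qed
    also have "\<dots> \<le> liminf (\<lambda>j. \<integral>\<^sup>+ x. ennreal ((cmod (s n x - s (r j) x))\<^sup>2) \<partial>M)"
      by (rule nn_integral_liminf) measurable
    also have "\<dots> \<le> ennreal (((1/2)^k)\<^sup>2)"
    proof (rule Liminf_le)
      show "\<forall>\<^sub>F j in sequentially. (\<integral>\<^sup>+ x. ennreal ((cmod (s n x - s (r j) x))\<^sup>2) \<partial>M) \<le> ennreal (((1/2)^k)\<^sup>2)"
      proof (rule eventually_sequentiallyI[of k])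
        fix j assume "k \<le> j"
        then have "r k \<le> r j" by (rule lift_Suc_mono_le[of r, OF rmono])
        then have "r j \<ge> N k" using rN[of k] by simp
        then have "L2_norm M (\<lambda>x. s n x - s (r j) x) \<le> (1/2)^k" using N[OF n] by (simp add: less_imp_le)
        then show "(\<integral>\<^sup>+ x. ennreal ((cmod (s n x - s (r j) x))\<^sup>2) \<partial>M) \<le> ennreal (((1/2)^k)\<^sup>2)"
          using L2_nn_integral[OF L2_diff[OF s s]] by (auto intro!: ennreal_leI power_mono L2_norm_nonneg)
      qed
    qed simp
    finally show ?thesis
      using L2_of_nn_integral_le[of "\<lambda>x. s n x - F x" M "(1/2)^k"] by auto
  qed
  show ?thesis
  proof (rule that)
    show "F \<in> L2 M"
      using L2_diff[OF s[of "N 0"] conjunct1[OF close[of 0 "N 0"]]] by simp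
    show "(\<lambda>n. L2_norm M (\<lambda>x. s n x - F x)) \<longlonglongrightarrow> 0"
    proof (rule LIMSEQ_I)
      fix e :: real assume "e > 0"
      then obtain k where k: "(1/2)^k < e" using real_arch_pow_inv[of e "1/2"] by auto
      show "\<exists>no. \<forall>n\<ge>no. norm (L2_norm M (\<lambda>x. s n x - F x) - 0) < e"
        using close[of k] k by (intro exI[of _ "N k"]) (auto simp: L2_norm_nonneg intro: le_less_trans)
    qed
  qed
qed

section \<open>Diagonal operators\<close>

lemma L2_norm_sq_inner: "of_real ((L2_norm M f)\<^sup>2) = L2_inner M f f"
  by (simp add: L2_inner_self)

text \<open>
  Totality is stated as triviality of the orthogonal complement; completeness of \<open>L\<^sup>2\<close> upgrades it
  to norm convergence of the Fourier expansion.
\<close>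

locale orthonormal_basis =
  fixes M :: "'a measure" and e :: "nat \<Rightarrow> 'a \<Rightarrow> complex"
  assumes e_L2: "e n \<in> L2 M"
    and ortho: "L2_inner M (e m) (e n) = (if m = n then 1 else 0)"
    and total: "f \<in> L2 M \<Longrightarrow> (\<And>n. L2_inner M f (e n) = 0) \<Longrightarrow> AE x in M. f x = 0"
begin

definition psum :: "(nat \<Rightarrow> complex) \<Rightarrow> nat \<Rightarrow> 'a \<Rightarrow> complex" where
  "psum c N x = (\<Sum>n<N. c n * e n x)"

definition coef :: "('a \<Rightarrow> complex) \<Rightarrow> nat \<Rightarrow> complex" where
  "coef f n = L2_inner M f (e n)"

lemma psum_L2: "psum c N \<in> L2 M"
  unfolding psum_def[abs_def] by (intro L2_sum L2_scale e_L2)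

lemma inner_psum: "g \<in> L2 M \<Longrightarrow> L2_inner M (psum c N) g = (\<Sum>n<N. c n * L2_inner M (e n) g)"
  unfolding psum_def[abs_def] by (rule L2_inner_sum) (auto intro: e_L2)

lemma coef_psum: "coef (psum c N) m = (if m < N then c m else 0)"
  unfolding coef_def by (auto simp: inner_psum e_L2 ortho if_distrib[of "(*) _"] cong: if_cong)

lemma coef_diff: "f \<in> L2 M \<Longrightarrow> g \<in> L2 M \<Longrightarrow> coef (\<lambda>x. f x - g x) n = coef f n - coef g n"
  unfolding coef_def by (rule L2_inner_diff[OF _ _ e_L2])

lemma inner_psum_coef:
  assumes "f \<in> L2 M"
  shows "L2_inner M (psum c N) f = (\<Sum>n<N. c n * cnj (coef f n))"
  unfolding inner_psum[OF assms] coef_def by (simp add: L2_inner_cnj)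

lemma norm_psum: "(L2_norm M (psum c N))\<^sup>2 = (\<Sum>n<N. (cmod (c n))\<^sup>2)"
proof -
  have "complex_of_real ((L2_norm M (psum c N))\<^sup>2) = (\<Sum>n<N. c n * cnj (coef (psum c N) n))"
    unfolding L2_norm_sq_inner by (rule inner_psum_coef[OF psum_L2])
  also have "\<dots> = (\<Sum>n<N. c n * cnj (c n))" by (intro sum.cong) (auto simp: coef_psum)
  also have "\<dots> = of_real (\<Sum>n<N. (cmod (c n))\<^sup>2)" by (simp add: complex_norm_square del: of_real_power)
  finally show ?thesis using of_real_eq_iff by blast
qed

lemma norm_diff_psum:
  assumes f: "f \<in> L2 M"
  shows "(L2_norm M (\<lambda>x. f x - psum (coef f) N x))\<^sup>2 = (L2_norm M f)\<^sup>2 - (\<Sum>n<N. (cmod (coef f n))\<^sup>2)"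
proof -
  let ?P = "psum (coef f) N" and ?d = "\<lambda>x. f x - psum (coef f) N x"
  have d: "?d \<in> L2 M" by (intro L2_diff f psum_L2)
  have "L2_inner M ?P ?d = (\<Sum>n<N. coef f n * cnj (coef ?d n))" by (rule inner_psum_coef[OF d])
  also have "\<dots> = 0" by (intro sum.neutral) (auto simp: coef_diff f psum_L2 coef_psum)
  finally have 1: "L2_inner M ?P ?d = 0" .
  have "L2_inner M ?d ?d = L2_inner M f ?d" using L2_inner_diff[OF f psum_L2 d] 1 by simp
  also have "\<dots> = cnj (L2_inner M ?d f)" by (simp add: L2_inner_cnj)
  also have "L2_inner M ?d f = L2_inner M f f - L2_inner M ?P f" by (rule L2_inner_diff[OF f psum_L2 f])
  also have "L2_inner M ?P f = of_real (\<Sum>n<N. (cmod (coef f n))\<^sup>2)"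
    unfolding inner_psum_coef[OF f] by (simp add: complex_norm_square del: of_real_power)
  finally have "complex_of_real ((L2_norm M ?d)\<^sup>2) = of_real ((L2_norm M f)\<^sup>2 - (\<Sum>n<N. (cmod (coef f n))\<^sup>2))"
    by (simp only: L2_inner_self) (simp del: of_real_power)
  then show ?thesis using of_real_eq_iff by blast
qed

lemma bessel: "f \<in> L2 M \<Longrightarrow> (\<Sum>n<N. (cmod (coef f n))\<^sup>2) \<le> (L2_norm M f)\<^sup>2"
  using norm_diff_psum[of f N] zero_le_power2[of "L2_norm M (\<lambda>x. f x - psum (coef f) N x)"] by linarith

lemma bessel_summable: "f \<in> L2 M \<Longrightarrow> summable (\<lambda>n. (cmod (coef f n))\<^sup>2)"
  by (rule summableI_nonneg_bounded) (auto intro: bessel)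

lemma riesz_fischer:
  assumes c: "summable (\<lambda>n. (cmod (c n))\<^sup>2)"
  obtains F where "F \<in> L2 M" "(\<lambda>N. L2_norm M (\<lambda>x. psum c N x - F x)) \<longlonglongrightarrow> 0" "\<And>n. coef F n = c n"
proof -
  have le: "(L2_norm M (\<lambda>x. psum c m x - psum c k x))\<^sup>2 = (\<Sum>n\<in>{k..<m}. (cmod (c n))\<^sup>2)" if "k \<le> m" for k m
  proof -
    have "(\<lambda>x. psum c m x - psum c k x) = psum (\<lambda>n. if n < k then 0 else c n) m"
    proof
      fix x
      have "(\<Sum>n<m. c n * e n x) = (\<Sum>n<k. c n * e n x) + (\<Sum>n\<in>{k..<m}. c n * e n x)"
        using that sum.atLeastLessThan_concat[of 0 k m "\<lambda>n. c n * e n x"] by (simp add: lessThan_atLeast0)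
      moreover have "(\<Sum>n<m. (if n < k then 0 else c n) * e n x) = (\<Sum>n\<in>{k..<m}. c n * e n x)"
        by (rule sum.mono_neutral_cong_right) auto
      ultimately show "psum c m x - psum c k x = psum (\<lambda>n. if n < k then 0 else c n) m x"
        by (simp add: psum_def)
    qed
    then have "(L2_norm M (\<lambda>x. psum c m x - psum c k x))\<^sup>2 = (\<Sum>n<m. (cmod (if n < k then 0 else c n))\<^sup>2)"
      by (simp add: norm_psum)
    also have "\<dots> = (\<Sum>n\<in>{k..<m}. (cmod (c n))\<^sup>2)" by (rule sum.mono_neutral_cong_right) auto
    finally show ?thesis .
  qed
  obtain F where F: "F \<in> L2 M" "(\<lambda>N. L2_norm M (\<lambda>x. psum c N x - F x)) \<longlonglongrightarrow> 0"
  proof (rule L2_complete[of "psum c" M, OF psum_L2])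
    fix \<epsilon> :: real assume \<epsilon>: "\<epsilon> > 0"
    then obtain N where N: "\<And>m n. m \<ge> N \<Longrightarrow> norm (\<Sum>k\<in>{m..<n}. (cmod (c k))\<^sup>2) < \<epsilon>\<^sup>2"
      using c[unfolded summable_Cauchy] by (metis zero_less_power)
    have *: "L2_norm M (\<lambda>x. psum c m x - psum c n x) < \<epsilon>" if "n \<ge> N" "n \<le> m" for m n
    proof (rule power2_less_imp_less)
      show "(L2_norm M (\<lambda>x. psum c m x - psum c n x))\<^sup>2 < \<epsilon>\<^sup>2"
        using N[OF that(1), of m] by (simp only: le[OF that(2)] real_norm_def abs_less_iff)
    qed (use \<epsilon> in simp)
    have "L2_norm M (\<lambda>x. psum c m x - psum c n x) < \<epsilon>" if "n \<ge> N" "m \<ge> N" for m n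
      using *[of n m] *[of m n] that L2_norm_minus_commute[of M "psum c m" "psum c n"] by (cases "n \<le> m") auto
    then show "\<exists>N. \<forall>m\<ge>N. \<forall>n\<ge>N. L2_norm M (\<lambda>x. psum c m x - psum c n x) < \<epsilon>" by blast
  qed (rule that)
  have "coef F n = c n" for n
  proof -
    have "eventually (\<lambda>N. cmod (c n - coef F n) \<le> L2_norm M (\<lambda>x. psum c N x - F x)) sequentially"
      using eventually_gt_at_top[of n]
    proof eventually_elim
      case (elim N)
      have "c n - coef F n = coef (\<lambda>x. psum c N x - F x) n"
        using elim by (simp add: coef_diff psum_L2 F(1) coef_psum)
      also have "cmod \<dots> \<le> L2_norm M (\<lambda>x. psum c N x - F x) * L2_norm M (e n)"
        unfolding coef_def by (intro L2_Cauchy_Schwarz L2_diff psum_L2 F(1) e_L2)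
      also have "L2_norm M (e n) = 1"
        using L2_inner_self[of M "e n"] ortho[of n n] L2_norm_nonneg[of M "e n"]
        by (simp add: power2_eq_1_iff flip: of_real_power)
      finally show ?case by simp
    qed
    then have "cmod (c n - coef F n) \<le> 0"
      by (rule tendsto_lowerbound[OF F(2)]) simp
    then show ?thesis by simp
  qed
  with F that show ?thesis by blast
qed

lemma expansion:
  assumes f: "f \<in> L2 M"
  shows "(\<lambda>N. L2_norm M (\<lambda>x. psum (coef f) N x - f x)) \<longlonglongrightarrow> 0"
proof -
  obtain F where F: "F \<in> L2 M" "(\<lambda>N. L2_norm M (\<lambda>x. psum (coef f) N x - F x)) \<longlonglongrightarrow> 0" "\<And>n. coef F n = coef f n"
    using riesz_fischer[OF bessel_summable[OF f]] by metis
  have "AE x in M. F x - f x = 0"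
  proof (rule total)
    show "(\<lambda>x. F x - f x) \<in> L2 M" by (intro L2_diff F(1) f)
    show "L2_inner M (\<lambda>x. F x - f x) (e n) = 0" for n
      using F(3)[of n] coef_diff[OF F(1) f, of n] by (simp add: coef_def)
  qed
  then have "L2_norm M (\<lambda>x. psum (coef f) N x - F x) = L2_norm M (\<lambda>x. psum (coef f) N x - f x)" for N
    by (intro L2_norm_cong_AE L2D(1)[OF L2_diff] psum_L2 F(1) f) (auto elim!: eventually_mono)
  then show ?thesis using F(2) by simp
qed

lemma parseval:
  assumes f: "f \<in> L2 M"
  shows "(\<lambda>n. (cmod (coef f n))\<^sup>2) sums (L2_norm M f)\<^sup>2"
proof -
  have "(\<lambda>N. (L2_norm M f)\<^sup>2 - (L2_norm M (\<lambda>x. psum (coef f) N x - f x))\<^sup>2) \<longlonglongrightarrow> (L2_norm M f)\<^sup>2 - 0\<^sup>2"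
    by (intro tendsto_intros expansion f)
  moreover have "(L2_norm M f)\<^sup>2 - (L2_norm M (\<lambda>x. psum (coef f) N x - f x))\<^sup>2 = (\<Sum>n<N. (cmod (coef f n))\<^sup>2)" for N
    using norm_diff_psum[OF f, of N] L2_norm_minus_commute[of M f "psum (coef f) N"] by simp
  ultimately show ?thesis by (simp add: sums_def)
qed

end

text \<open>
  A closed symmetric operator that has the basis vectors as eigenvectors.  The gap condition makes
  \<open>1 / (\<lambda>\<^sub>n - z)\<close> a bounded multiplier on coefficients, and so gives a bounded resolvent; isolation and
  injectivity make every eigenvalue discrete and simple.
\<close>

locale diagonal_operator = orthonormal_basis M e
  for M :: "'a measure" and e +
  fixes T :: "'a op_graph" and lam :: "nat \<Rightarrow> real"
  assumes T_L2: "(f, h) \<in> T \<Longrightarrow> f \<in> L2 M \<and> h \<in> L2 M"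
    and T_sum: "(\<And>i. i \<in> I \<Longrightarrow> (F i, H i) \<in> T) \<Longrightarrow> finite I \<Longrightarrow>
      ((\<lambda>x. \<Sum>i\<in>I. (c :: nat \<Rightarrow> complex) i * F i x), (\<lambda>x. \<Sum>i\<in>I. c i * H i x)) \<in> T"
    and T_eig: "(e n, \<lambda>x. of_real (lam n) * e n x) \<in> T"
    and T_sym: "(f, h) \<in> T \<Longrightarrow> (f', h') \<in> T \<Longrightarrow> L2_inner M h f' = L2_inner M f h'"
    and T_closed: "(\<And>N. (F N, H N) \<in> T) \<Longrightarrow> f \<in> L2 M \<Longrightarrow> h \<in> L2 M \<Longrightarrow>
      (\<lambda>N. L2_norm M (\<lambda>x. F N x - f x)) \<longlonglongrightarrow> 0 \<Longrightarrow> (\<lambda>N. L2_norm M (\<lambda>x. H N x - h x)) \<longlonglongrightarrow> 0 \<Longrightarrow> (f, h) \<in> T"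
    and lam_gap: "z \<notin> range (\<lambda>n. complex_of_real (lam n)) \<Longrightarrow> \<exists>\<delta>>0. \<forall>n. \<delta> \<le> cmod (of_real (lam n) - z)"
    and lam_isolated: "\<exists>U. open U \<and> U \<inter> range (\<lambda>n. complex_of_real (lam n)) = {complex_of_real (lam n)}"
    and lam_inj: "inj lam"
begin

lemma psum_T: "(psum c N, psum (\<lambda>n. of_real (lam n) * c n) N) \<in> T"
proof -
  have "((\<lambda>x. \<Sum>n<N. c n * e n x), (\<lambda>x. \<Sum>n<N. c n * (of_real (lam n) * e n x))) \<in> T"
    by (rule T_sum) (auto intro: T_eig)
  then show ?thesis by (simp add: psum_def[abs_def] mult_ac)
qed

text \<open>
  Membership in \<open>T\<close> can be read off from the Fourier coefficients: the partial sums of the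
  expansions lie in \<open>T\<close>, and \<open>T\<close> is closed.
\<close>

lemma T_of_coef:
  assumes f: "f \<in> L2 M" and h: "h \<in> L2 M" and coef: "\<And>n. coef h n = of_real (lam n) * coef f n"
  shows "(f, h) \<in> T"
proof (rule T_closed[OF psum_T[of "coef f"] f h])
  show "(\<lambda>N. L2_norm M (\<lambda>x. psum (coef f) N x - f x)) \<longlonglongrightarrow> 0" by (rule expansion[OF f])
  have "(\<lambda>n. of_real (lam n) * coef f n) = coef h" using coef by auto
  then show "(\<lambda>N. L2_norm M (\<lambda>x. psum (\<lambda>n. of_real (lam n) * coef f n) N x - h x)) \<longlonglongrightarrow> 0"
    using expansion[OF h] by simp
qed

text \<open>
  Testing the defining relation of the adjoint against the eigenvectors alone already determines
  the action of the adjoint on coefficients.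
\<close>

lemma coef_adjoint:
  assumes "(f, h) \<in> adjoint_op M T"
  shows "coef h n = of_real (lam n) * coef f n"
proof -
  have "L2_inner M (\<lambda>x. of_real (lam n) * e n x) f = L2_inner M (e n) h"
    using assms T_eig[of n] unfolding adjoint_op_def by auto
  then have "cnj (of_real (lam n) * L2_inner M (e n) f) = cnj (L2_inner M (e n) h)"
    by (simp add: L2_inner_scale)
  then show ?thesis unfolding coef_def by (simp add: L2_inner_cnj)
qed

lemma T_adjoint: "adjoint_op M T = T"
proof (intro equalityI subsetI)
  fix p assume "p \<in> adjoint_op M T"
  then obtain f h where p: "p = (f, h)" "(f, h) \<in> adjoint_op M T" by (cases p) auto
  then show "p \<in> T"
    using T_of_coef[OF _ _ coef_adjoint[OF p(2)]] by (auto simp: adjoint_op_def)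
next
  fix p assume "p \<in> T"
  then show "p \<in> adjoint_op M T"
    using T_L2 T_sym unfolding adjoint_op_def by (cases p) auto
qed

lemma coef_T: "(f, h) \<in> T \<Longrightarrow> coef h n = of_real (lam n) * coef f n"
  using coef_adjoint T_adjoint by blast

theorem T_self_adjoint: "self_adjoint_op M T"
  unfolding self_adjoint_op_def densely_defined_def
proof (intro conjI ballI allI impI T_adjoint)
  fix f and \<epsilon> :: real assume f: "f \<in> L2 M" and \<epsilon>: "\<epsilon> > 0"
  obtain N where "L2_norm M (\<lambda>x. psum (coef f) N x - f x) < \<epsilon>"
    using LIMSEQ_D[OF expansion[OF f] \<epsilon>] by (auto simp: L2_norm_nonneg)
  then show "\<exists>u\<in>Domain T. L2_norm M (\<lambda>x. f x - u x) < \<epsilon>"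
    using psum_T[of "coef f" N] L2_norm_minus_commute[of M f] by (intro bexI[of _ "psum (coef f) N"]) auto
qed

lemma eigenvalue_in_spectrum: "complex_of_real (lam n) \<in> spectrum_op M T"
proof -
  have "L2_norm M (e n) \<noteq> 0"
    using L2_inner_self[of M "e n"] ortho[of n n] by auto
  then have pos: "L2_norm M (e n) > 0" using L2_norm_nonneg[of M "e n"] by linarith
  have "complex_of_real (lam n) \<notin> resolvent_set_op M T"
  proof
    assume "complex_of_real (lam n) \<in> resolvent_set_op M T"
    then obtain C where "\<forall>(f, h)\<in>T. L2_norm M f \<le> C * L2_norm M (\<lambda>x. h x - of_real (lam n) * f x)"
      unfolding resolvent_set_op_def by blast
    from bspec[OF this T_eig[of n]] have "L2_norm M (e n) \<le> 0" by (simp add: L2_norm_def)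
    with pos show False by simp
  qed
  then show ?thesis by (simp add: spectrum_op_def)
qed

text \<open>
  The resolvent divides the \<open>n\<close>-th coefficient by \<open>\<lambda>\<^sub>n - z\<close>, which is bounded away from zero.
\<close>

lemma resolvent_point:
  assumes z: "z \<notin> range (\<lambda>n. complex_of_real (lam n))"
  shows "z \<in> resolvent_set_op M T"
proof -
  obtain \<delta> where \<delta>: "\<delta> > 0" "\<And>n. \<delta> \<le> cmod (of_real (lam n) - z)" using lam_gap[OF z] by blast
  have nz: "of_real (lam n) - z \<noteq> 0" for n using \<delta>(1) \<delta>(2)[of n] by auto
  have 1: "\<exists>(f, h)\<in>T. AE x in M. h x - z * f x = k x" if k: "k \<in> L2 M" for k
  proof -
    define c where "c n = coef k n / (of_real (lam n) - z)" for n
    have "(cmod (c n))\<^sup>2 \<le> (cmod (coef k n))\<^sup>2 * inverse (\<delta>\<^sup>2)" for n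
    proof -
      have "\<delta>\<^sup>2 \<le> (cmod (of_real (lam n) - z))\<^sup>2" using \<delta> by (intro power_mono) auto
      then have "(cmod (coef k n))\<^sup>2 / (cmod (of_real (lam n) - z))\<^sup>2 \<le> (cmod (coef k n))\<^sup>2 / \<delta>\<^sup>2"
        using \<delta>(1) nz[of n] by (intro divide_left_mono) auto
      then show ?thesis unfolding c_def norm_divide power_divide by (simp add: divide_inverse)
    qed
    then have "summable (\<lambda>n. (cmod (c n))\<^sup>2)"
      by (intro summable_comparison_test'[OF summable_mult2[OF bessel_summable[OF k]], of 0 _ "inverse (\<delta>\<^sup>2)"]) simp
    then obtain F where F: "F \<in> L2 M" "\<And>n. coef F n = c n" using riesz_fischer by metis
    have h: "(\<lambda>x. k x + z * F x) \<in> L2 M" by (intro L2_add k L2_scale F(1))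
    have "coef (\<lambda>x. k x + z * F x) n = of_real (lam n) * coef F n" for n
    proof -
      have "coef (\<lambda>x. k x + z * F x) n = coef k n + z * coef F n"
        unfolding coef_def by (rule L2_inner_linear[OF k F(1) e_L2])
      also have "coef k n = (of_real (lam n) - z) * c n" using nz[of n] by (simp add: c_def)
      finally show ?thesis by (simp add: F(2) algebra_simps)
    qed
    then have "(F, \<lambda>x. k x + z * F x) \<in> T" by (rule T_of_coef[OF F(1) h])
    then show ?thesis by force
  qed
  have 2: "L2_norm M f \<le> inverse \<delta> * L2_norm M (\<lambda>x. h x - z * f x)" if fh: "(f, h) \<in> T" for f h
  proof (rule power2_le_imp_le)
    have f: "f \<in> L2 M" and h: "h \<in> L2 M" using T_L2[OF fh] by auto
    have d: "(\<lambda>x. h x - z * f x) \<in> L2 M" by (intro L2_diff h L2_scale f)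
    have c: "coef (\<lambda>x. h x - z * f x) n = (of_real (lam n) - z) * coef f n" for n
    proof -
      have "coef (\<lambda>x. h x - z * f x) n = coef h n - coef (\<lambda>x. z * f x) n"
        by (rule coef_diff[OF h L2_scale[OF f]])
      then show ?thesis unfolding coef_T[OF fh] by (simp add: coef_def L2_inner_scale algebra_simps)
    qed
    have "(L2_norm M f)\<^sup>2 \<le> (inverse \<delta>)\<^sup>2 * (L2_norm M (\<lambda>x. h x - z * f x))\<^sup>2"
    proof (rule sums_le[OF _ parseval[OF f] sums_mult[OF parseval[OF d]]])
      fix n
      have "\<delta>\<^sup>2 * (cmod (coef f n))\<^sup>2 \<le> (cmod (of_real (lam n) - z))\<^sup>2 * (cmod (coef f n))\<^sup>2"
        using \<delta> by (intro mult_right_mono power_mono) auto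
      then show "(cmod (coef f n))\<^sup>2 \<le> (inverse \<delta>)\<^sup>2 * (cmod (coef (\<lambda>x. h x - z * f x) n))\<^sup>2"
        using \<delta>(1) unfolding c norm_mult power_mult_distrib by (simp add: field_simps)
    qed
    then show "(L2_norm M f)\<^sup>2 \<le> (inverse \<delta> * L2_norm M (\<lambda>x. h x - z * f x))\<^sup>2"
      by (simp add: power_mult_distrib)
  qed (use \<delta> in \<open>auto simp: L2_norm_nonneg\<close>)
  show ?thesis unfolding resolvent_set_op_def using 1 2 by blast
qed

theorem T_spectrum: "spectrum_op M T = range (\<lambda>n. complex_of_real (lam n))"
  using eigenvalue_in_spectrum resolvent_point unfolding spectrum_op_def by blast

lemma e_nonzero: "\<not> (AE x in M. e n x = 0)"
  using L2_norm_eq_0[OF e_L2, of n] L2_inner_self[of M "e n"] ortho[of n n] by auto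

theorem T_purely_discrete: "purely_discrete_spectrum M T"
  unfolding purely_discrete_spectrum_def T_spectrum
proof (intro ballI conjI)
  fix z assume "z \<in> range (\<lambda>n. complex_of_real (lam n))"
  then obtain m where z: "z = of_real (lam m)" by blast
  show "z isolated_in range (\<lambda>n. complex_of_real (lam n))"
    unfolding isolated_in_def z using lam_isolated[of m] by blast
  show "\<exists>f. eigenfunction_op M T z f"
    unfolding eigenfunction_op_def z using T_eig e_nonzero by blast
  show "finite_multiplicity_op M T z"
    unfolding finite_multiplicity_op_def
  proof (intro exI[of _ "{e m}"] conjI allI impI)
    fix f assume "eigenfunction_op M T z f"
    then have fT: "(f, \<lambda>x. z * f x) \<in> T" by (simp add: eigenfunction_op_def)
    have f: "f \<in> L2 M" using T_L2[OF fT] by auto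
    have 0: "coef f n = 0" if "n \<noteq> m" for n
    proof -
      have "z * coef f n = of_real (lam n) * coef f n"
        using coef_T[OF fT, of n] by (simp add: coef_def L2_inner_scale)
      moreover have "lam n \<noteq> lam m" using lam_inj that by (auto dest: injD)
      ultimately show ?thesis by (auto simp: z)
    qed
    have "AE x in M. f x - coef f m * e m x = 0"
    proof (rule total)
      show "(\<lambda>x. f x - coef f m * e m x) \<in> L2 M" by (intro L2_diff f L2_scale e_L2)
      show "L2_inner M (\<lambda>x. f x - coef f m * e m x) (e n) = 0" for n
        using L2_inner_diff[OF f L2_scale[OF e_L2] e_L2, of "coef f m" m n] 0[of n]
        by (simp add: L2_inner_scale ortho coef_def split: if_splits)
    qed
    then show "\<exists>c. AE x in M. f x = (\<Sum>b\<in>{e m}. c b * b x)"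
      by (intro exI[of _ "\<lambda>_. coef f m"]) (auto elim!: eventually_mono)
  qed simp
qed

end

section \<open>Limit point endpoints of a canonical system\<close>

lemma Cauchy_Schwarz_integral:
  fixes a b :: "real \<Rightarrow> complex"
  assumes S: "S \<in> sets lebesgue"
    and a: "a \<in> borel_measurable (lebesgue_on S)" "(\<lambda>t. (cmod (a t))\<^sup>2) integrable_on S"
    and b: "b \<in> borel_measurable (lebesgue_on S)" "(\<lambda>t. (cmod (b t))\<^sup>2) integrable_on S"
  shows "(\<lambda>t. a t * b t) absolutely_integrable_on S"
    "cmod (integral S (\<lambda>t. a t * b t)) \<le> sqrt (integral S (\<lambda>t. (cmod (a t))\<^sup>2)) * sqrt (integral S (\<lambda>t. (cmod (b t))\<^sup>2))"
proof -
  have sq: "integrable (lebesgue_on S) (\<lambda>t. (cmod (f t))\<^sup>2)" if "(\<lambda>t. (cmod (f t))\<^sup>2) integrable_on S" for f :: "real \<Rightarrow> complex"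
    using that S by (intro absolutely_integrable_imp_integrable nonnegative_absolutely_integrable_1) auto
  have A: "a \<in> L2 (lebesgue_on S)" and B: "b \<in> L2 (lebesgue_on S)"
    using a b sq by (auto simp: L2_def)
  have ab: "integrable (lebesgue_on S) (\<lambda>t. a t * b t)" by (rule L2_mult_integrable[OF A B])
  then show abs: "(\<lambda>t. a t * b t) absolutely_integrable_on S"
    using S by (simp add: integrable_restrict_space set_integrable_def)
  have norms: "L2_norm (lebesgue_on S) f = sqrt (integral S (\<lambda>t. (cmod (f t))\<^sup>2))"
    if "(\<lambda>t. (cmod (f t))\<^sup>2) integrable_on S" for f :: "real \<Rightarrow> complex"
    unfolding L2_norm_def using lebesgue_integral_eq_integral[OF sq[OF that] S] by simp
  have "integral S (\<lambda>t. a t * b t) = L2_inner (lebesgue_on S) a (\<lambda>t. cnj (b t))"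
    unfolding L2_inner_def using lebesgue_integral_eq_integral[OF ab S] by simp
  also have "cmod \<dots> \<le> L2_norm (lebesgue_on S) a * L2_norm (lebesgue_on S) (\<lambda>t. cnj (b t))"
    by (intro L2_Cauchy_Schwarz A L2_cnj B)
  finally show "cmod (integral S (\<lambda>t. a t * b t)) \<le> sqrt (integral S (\<lambda>t. (cmod (a t))\<^sup>2)) * sqrt (integral S (\<lambda>t. (cmod (b t))\<^sup>2))"
    using norms[OF a(2)] norms[of "\<lambda>t. cnj (b t)"] b(2) by simp
qed

text \<open>
  The interval \<open>I\<close> starts at \<open>c\<close> and is open at its right end, the singular endpoint, to which the
  points \<open>\<xi> n\<close> converge; the end may be finite or infinite.  On \<open>I\<close> the system \<open>u' = s J\<close>,
  \<open>J' = k\<close> is considered, with a function \<open>S\<close> such that \<open>S' = - s\<close>.  The two assumptions on \<open>m\<close> say that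
  of the two homogeneous solutions \<open>u = S\<close>, \<open>u = 1\<close> the first is square integrable near
  the endpoint and the second is not.
\<close>

locale singular_endpoint =
  fixes I :: "real set" and c :: real and \<xi> :: "nat \<Rightarrow> real" and m S :: "real \<Rightarrow> real"
  assumes c_in: "c \<in> I" and interval: "x \<in> I \<Longrightarrow> c \<le> x \<and> {c..x} \<subseteq> I"
    and I_sets: "I \<in> sets lebesgue"
    and no_max: "x \<in> I \<Longrightarrow> \<exists>y\<in>I. x < y"
    and xi_in: "\<xi> n \<in> I" and xi_cofinal: "x \<in> I \<Longrightarrow> \<exists>n. x \<le> \<xi> n" and xi_mono: "incseq \<xi>"
    and m_cont: "continuous_on I m" and m_pos: "x \<in> I \<Longrightarrow> m x > 0"
    and S_cont: "continuous_on I S" and S_pos: "x \<in> I \<Longrightarrow> S x > 0"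
    and S_antimono: "x \<in> I \<Longrightarrow> y \<in> I \<Longrightarrow> x \<le> y \<Longrightarrow> S y \<le> S x"
    and S_lim: "(\<lambda>n. S (\<xi> n)) \<longlonglongrightarrow> 0"
    and S_sq: "(\<lambda>t. (S t)\<^sup>2 * m t) integrable_on I"
    and m_not: "\<not> m integrable_on I"
begin

definition endpoint :: "real filter" where
  "endpoint = (INF x\<in>I. principal {t\<in>I. x \<le> t})"

lemma eventually_endpoint: "eventually P endpoint \<longleftrightarrow> (\<exists>x\<in>I. \<forall>t\<in>I. x \<le> t \<longrightarrow> P t)"
proof -
  have "eventually P (INF x\<in>I. principal {t\<in>I. x \<le> t}) \<longleftrightarrow> (\<exists>x\<in>I. eventually P (principal {t\<in>I. x \<le> t}))"
  proof (rule eventually_INF_base)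
    show "I \<noteq> {}" using c_in by auto
    fix x y assume xy: "x \<in> I" "y \<in> I"
    show "\<exists>z\<in>I. principal {t \<in> I. z \<le> t} \<le> inf (principal {t \<in> I. x \<le> t}) (principal {t \<in> I. y \<le> t})"
      using xy by (intro bexI[of _ "max x y"]) (auto simp: max_def)
  qed
  then show ?thesis by (simp add: endpoint_def eventually_principal) blast
qed

lemma endpoint_nontrivial: "endpoint \<noteq> bot"
  unfolding trivial_limit_def eventually_endpoint by auto

lemma Icc_sub: "x \<in> I \<Longrightarrow> y \<in> I \<Longrightarrow> {x..y} \<subseteq> I"
  using interval[of x] interval[of y] by fastforce

lemma filterlim_xi: "filterlim \<xi> endpoint sequentially"
  unfolding filterlim_iff eventually_endpoint
proof (intro allI impI)
  fix P assume "\<exists>x\<in>I. \<forall>t\<in>I. x \<le> t \<longrightarrow> P t"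
  then obtain x where x: "x \<in> I" "\<And>t. t \<in> I \<Longrightarrow> x \<le> t \<Longrightarrow> P t" by blast
  obtain n where n: "x \<le> \<xi> n" using xi_cofinal[OF x(1)] by blast
  show "\<forall>\<^sub>F n in sequentially. P (\<xi> n)"
    by (rule eventually_sequentiallyI[of n]) (use n xi_mono in \<open>auto intro!: x(2) xi_in dest: incseqD intro: order_trans\<close>)
qed

definition tail :: "(real \<Rightarrow> real) \<Rightarrow> real \<Rightarrow> real" where
  "tail q x = integral I q - integral {c..x} q"

context
  fixes q :: "real \<Rightarrow> real"
  assumes q: "q integrable_on I" and q0: "\<And>t. t \<in> I \<Longrightarrow> q t \<ge> 0"
begin

lemma weight_integrable_Icc: "x \<in> I \<Longrightarrow> y \<in> I \<Longrightarrow> q integrable_on {x..y}"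
proof -
  assume "x \<in> I" "y \<in> I"
  then have "q absolutely_integrable_on {x..y}"
    by (intro set_integrable_subset[OF nonnegative_absolutely_integrable_1[OF q q0]] Icc_sub) auto
  then show ?thesis by (rule set_lebesgue_integral_eq_integral(1))
qed

lemma tail_diff: "x \<in> I \<Longrightarrow> y \<in> I \<Longrightarrow> x \<le> y \<Longrightarrow> tail q x - tail q y = integral {x..y} q"
  unfolding tail_def using Henstock_Kurzweil_Integration.integral_combine[of c x y q] interval weight_integrable_Icc[OF c_in] by fastforce

lemma tail_nonneg: "x \<in> I \<Longrightarrow> tail q x \<ge> 0"
  unfolding tail_def using integral_subset_le[of "{c..x}" I q] interval q q0 weight_integrable_Icc[OF c_in] by fastforce

lemma integral_le_tail: "x \<in> I \<Longrightarrow> y \<in> I \<Longrightarrow> x \<le> y \<Longrightarrow> integral {x..y} q \<le> tail q x"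
  using tail_diff[of x y] tail_nonneg[of y] by linarith

lemma tail_antimono: "x \<in> I \<Longrightarrow> y \<in> I \<Longrightarrow> x \<le> y \<Longrightarrow> tail q y \<le> tail q x"
proof -
  assume xy: "x \<in> I" "y \<in> I" "x \<le> y"
  have "integral {x..y} q \<ge> 0" using xy Icc_sub[of x y] weight_integrable_Icc q0 by (intro Henstock_Kurzweil_Integration.integral_nonneg) auto
  then show ?thesis using tail_diff[OF xy] by linarith
qed

lemma tail_tendsto: "(tail q \<longlongrightarrow> 0) endpoint"
proof -
  have "(\<lambda>n. integral I (\<lambda>t. if t \<in> {c..\<xi> n} then q t else 0)) \<longlonglongrightarrow> integral I q"
  proof (rule dominated_convergence(2)[OF _ q])
    show "(\<lambda>t. if t \<in> {c..\<xi> n} then q t else 0) integrable_on I" for n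
      using weight_integrable_Icc[OF c_in xi_in, of n] interval[OF xi_in, of n]
      unfolding integrable_restrict_Int by (simp add: Int_absorb2)
    show "norm (if t \<in> {c..\<xi> n} then q t else 0) \<le> q t" if "t \<in> I" for n t
      using q0[OF that] by auto
    show "(\<lambda>n. if t \<in> {c..\<xi> n} then q t else 0) \<longlonglongrightarrow> q t" if "t \<in> I" for t
    proof (rule tendsto_eventually)
      obtain n where "t \<le> \<xi> n" using xi_cofinal[OF \<open>t \<in> I\<close>] by blast
      then show "\<forall>\<^sub>F n in sequentially. (if t \<in> {c..\<xi> n} then q t else 0) = q t"
        using interval[OF \<open>t \<in> I\<close>] xi_mono
        by (intro eventually_sequentiallyI[of n]) (auto dest: incseqD intro: order_trans)
    qed
  qed
  moreover have "integral I (\<lambda>t. if t \<in> {c..\<xi> n} then q t else 0) = integral {c..\<xi> n} q" for n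
    using interval[OF xi_in, of n] unfolding integral_restrict_Int by (simp add: Int_absorb2)
  ultimately have "(\<lambda>n. integral I q - integral {c..\<xi> n} q) \<longlonglongrightarrow> integral I q - integral I q"
    by (intro tendsto_diff tendsto_const) simp
  then have lim: "(\<lambda>n. tail q (\<xi> n)) \<longlonglongrightarrow> 0" by (simp add: tail_def)
  show ?thesis
  proof (rule tendstoI)
    fix e :: real assume "e > 0"
    then obtain n where n: "\<bar>tail q (\<xi> n)\<bar> < e" using LIMSEQ_D[OF lim, of e] by auto
    show "\<forall>\<^sub>F x in endpoint. dist (tail q x) 0 < e"
      unfolding eventually_endpoint
      using n tail_antimono[OF xi_in] tail_nonneg by (intro bexI[of _ "\<xi> n"] xi_in) fastforce
  qed
qed

end

lemma S_tendsto: "(S \<longlongrightarrow> 0) endpoint"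
proof (rule tendstoI)
  fix e :: real assume "e > 0"
  then obtain n where n: "\<bar>S (\<xi> n)\<bar> < e" using LIMSEQ_D[OF S_lim, of e] by auto
  show "\<forall>\<^sub>F x in endpoint. dist (S x) 0 < e"
    unfolding eventually_endpoint
    using n S_antimono[OF xi_in] S_pos by (intro bexI[of _ "\<xi> n"] xi_in) fastforce
qed

definition sigma :: "real \<Rightarrow> real" where "sigma = tail (\<lambda>t. (S t)\<^sup>2 * m t)"

lemma S_sq_nonneg: "t \<in> I \<Longrightarrow> 0 \<le> (S t)\<^sup>2 * m t"
  using m_pos[of t] by simp

lemma sigma_nonneg: "x \<in> I \<Longrightarrow> sigma x \<ge> 0"
  unfolding sigma_def by (rule tail_nonneg[OF S_sq]) (auto intro: S_sq_nonneg)

lemma sigma_diff: "x \<in> I \<Longrightarrow> y \<in> I \<Longrightarrow> x \<le> y \<Longrightarrow> sigma x - sigma y = integral {x..y} (\<lambda>t. (S t)\<^sup>2 * m t)"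
  unfolding sigma_def by (rule tail_diff[OF S_sq]) (auto intro: S_sq_nonneg)

lemma sigma_antimono: "x \<in> I \<Longrightarrow> y \<in> I \<Longrightarrow> x \<le> y \<Longrightarrow> sigma y \<le> sigma x"
  unfolding sigma_def by (rule tail_antimono[OF S_sq]) (auto intro: S_sq_nonneg)

lemma sigma_tendsto: "(sigma \<longlongrightarrow> 0) endpoint"
  unfolding sigma_def by (rule tail_tendsto[OF S_sq]) (auto intro: S_sq_nonneg)

lemma S_sq_integrable: "x \<in> I \<Longrightarrow> y \<in> I \<Longrightarrow> (\<lambda>t. (S t)\<^sup>2 * m t) integrable_on {x..y}"
  by (rule weight_integrable_Icc[OF S_sq]) (auto intro: S_sq_nonneg)

lemma integral_S_sq_le: "x \<in> I \<Longrightarrow> y \<in> I \<Longrightarrow> x \<le> y \<Longrightarrow> integral {x..y} (\<lambda>t. (S t)\<^sup>2 * m t) \<le> sigma x"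
  unfolding sigma_def by (rule integral_le_tail[OF S_sq]) (auto intro: S_sq_nonneg)

text \<open>
  The equation \<open>u' = s J\<close> enters only through the boundary combination \<open>u + S J\<close>, whose
  derivative is \<open>S k\<close>; so \<open>s\<close> itself does not appear.
\<close>

definition end_triple :: "(real \<Rightarrow> complex) \<Rightarrow> (real \<Rightarrow> complex) \<Rightarrow> (real \<Rightarrow> complex) \<Rightarrow> bool" where
  "end_triple u J k \<longleftrightarrow> continuous_on I u \<and> k \<in> borel_measurable (lebesgue_on I) \<and>
     (\<lambda>t. (cmod (u t))\<^sup>2 * m t) integrable_on I \<and> (\<lambda>t. (cmod (k t))\<^sup>2 / m t) integrable_on I \<and>
     (\<forall>x\<in>I. \<forall>y\<in>I. x \<le> y \<longrightarrow> (k has_integral (J y - J x)) {x..y} \<and>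
        ((\<lambda>t. of_real (S t) * k t) has_integral
           ((u y + of_real (S y) * J y) - (u x + of_real (S x) * J x))) {x..y})"

lemma m_integrable: "x \<in> I \<Longrightarrow> y \<in> I \<Longrightarrow> m integrable_on {x..y}"
  by (intro integrable_continuous_real continuous_on_subset[OF m_cont] Icc_sub)

text \<open>
  Cauchy--Schwarz with the splitting \<open>h k = (h \<surd>m) (k / \<surd>m)\<close>; the constant is the norm of \<open>k\<close> in
  the space with weight \<open>1 / m\<close>.
\<close>

lemma source_bound:
  assumes st: "end_triple u J k"
  obtains K where "K \<ge> 0"
    "\<And>x y h. x \<in> I \<Longrightarrow> y \<in> I \<Longrightarrow> continuous_on I h \<Longrightarrow>
       cmod (integral {x..y} (\<lambda>t. of_real (h t) * k t)) \<le> K * sqrt (integral {x..y} (\<lambda>t. (h t)\<^sup>2 * m t))"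
proof -
  have k: "k \<in> borel_measurable (lebesgue_on I)" "(\<lambda>t. (cmod (k t))\<^sup>2 / m t) integrable_on I"
    using st by (auto simp: end_triple_def)
  have k0: "0 \<le> (cmod (k t))\<^sup>2 / m t" if "t \<in> I" for t using m_pos[OF that] by simp
  define K where "K = sqrt (integral I (\<lambda>t. (cmod (k t))\<^sup>2 / m t))"
  have K0: "K \<ge> 0" unfolding K_def using k0 k(2) by (simp add: Henstock_Kurzweil_Integration.integral_nonneg)
  have "cmod (integral {x..y} (\<lambda>t. of_real (h t) * k t)) \<le> K * sqrt (integral {x..y} (\<lambda>t. (h t)\<^sup>2 * m t))"
    if xy: "x \<in> I" "y \<in> I" and h: "continuous_on I h" for x y h
  proof -
    define a where "a t = complex_of_real (h t * sqrt (m t))" for t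
    define b where "b t = k t / complex_of_real (sqrt (m t))" for t
    note s = Icc_sub[OF xy]
    have mc: "continuous_on {x..y} m" and hc: "continuous_on {x..y} h"
      using s m_cont h continuous_on_subset by blast+
    have mp: "m t > 0" if "t \<in> {x..y}" for t using that s m_pos by blast
    have asq: "(cmod (a t))\<^sup>2 = (h t)\<^sup>2 * m t" if "t \<in> {x..y}" for t
      using mp[OF that] by (simp add: a_def norm_mult power_mult_distrib del: of_real_mult)
    have bsq: "(cmod (b t))\<^sup>2 = (cmod (k t))\<^sup>2 / m t" if "t \<in> {x..y}" for t
      using mp[OF that] by (simp add: b_def norm_divide power_divide)
    have ab: "a t * b t = of_real (h t) * k t" if "t \<in> {x..y}" for t
      using mp[OF that] by (simp add: a_def b_def)
    have am: "a \<in> borel_measurable (lebesgue_on {x..y})"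
      unfolding a_def[abs_def] using mp
      by (intro continuous_imp_measurable_on_sets_lebesgue continuous_intros hc mc) auto
    have km: "k \<in> borel_measurable (lebesgue_on {x..y})"
      using borel_measurable_subalgebra measurable_restrict_mono[OF k(1) s] by blast
    have "(\<lambda>t. complex_of_real (inverse (sqrt (m t)))) \<in> borel_measurable (lebesgue_on {x..y})"
      by (intro continuous_imp_measurable_on_sets_lebesgue continuous_intros mc) (use mp in \<open>force+\<close>)
    then have bm: "b \<in> borel_measurable (lebesgue_on {x..y})"
      unfolding b_def[abs_def] divide_inverse using km by (simp flip: of_real_inverse)
    have ai: "(\<lambda>t. (cmod (a t))\<^sup>2) integrable_on {x..y}"
    proof -
      have "(\<lambda>t. (h t)\<^sup>2 * m t) integrable_on {x..y}"
        by (intro integrable_continuous_real continuous_intros hc mc)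
      then show ?thesis by (rule integrable_eq) (simp add: asq)
    qed
    have ki: "(\<lambda>t. (cmod (k t))\<^sup>2 / m t) integrable_on {x..y}" by (rule weight_integrable_Icc[OF k(2) k0 xy])
    have bi: "(\<lambda>t. (cmod (b t))\<^sup>2) integrable_on {x..y}"
      using ki by (rule integrable_eq) (simp add: bsq)
    have "integral {x..y} (\<lambda>t. of_real (h t) * k t) = integral {x..y} (\<lambda>t. a t * b t)"
      by (intro integral_cong) (simp add: ab)
    also have "cmod \<dots> \<le> sqrt (integral {x..y} (\<lambda>t. (cmod (a t))\<^sup>2)) * sqrt (integral {x..y} (\<lambda>t. (cmod (b t))\<^sup>2))"
      by (rule Cauchy_Schwarz_integral(2)[OF _ am ai bm bi]) simp
    also have "integral {x..y} (\<lambda>t. (cmod (a t))\<^sup>2) = integral {x..y} (\<lambda>t. (h t)\<^sup>2 * m t)"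
      by (intro integral_cong) (simp add: asq)
    also have "integral {x..y} (\<lambda>t. (cmod (b t))\<^sup>2) = integral {x..y} (\<lambda>t. (cmod (k t))\<^sup>2 / m t)"
      by (intro integral_cong) (simp add: bsq)
    also have "sqrt (integral {x..y} (\<lambda>t. (h t)\<^sup>2 * m t)) * sqrt (integral {x..y} (\<lambda>t. (cmod (k t))\<^sup>2 / m t))
        \<le> sqrt (integral {x..y} (\<lambda>t. (h t)\<^sup>2 * m t)) * K"
      unfolding K_def
    proof (intro mult_left_mono real_sqrt_le_mono integral_subset_le s ki k(2) k0)
      show "0 \<le> sqrt (integral {x..y} (\<lambda>t. (h t)\<^sup>2 * m t))"
        using mp by (auto intro!: Henstock_Kurzweil_Integration.integral_nonneg integrable_continuous_real continuous_intros hc mc simp: less_imp_le)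
    qed (use k0 in auto)
    finally show ?thesis by (simp add: mult.commute)
  qed
  with K0 that show ?thesis by blast
qed
end

context singular_endpoint begin

lemma endpoint_Cauchy:
  fixes B :: "real \<Rightarrow> complex"
  assumes B: "\<And>x y. x \<in> I \<Longrightarrow> y \<in> I \<Longrightarrow> x \<le> y \<Longrightarrow> cmod (B y - B x) \<le> r x" and r: "(r \<longlongrightarrow> 0) endpoint"
  obtains B0 where "(B \<longlongrightarrow> B0) endpoint" "\<And>x. x \<in> I \<Longrightarrow> cmod (B0 - B x) \<le> r x"
proof -
  have rx: "(\<lambda>n. r (\<xi> n)) \<longlonglongrightarrow> 0" by (rule filterlim_compose[OF r filterlim_xi])
  have "Cauchy (\<lambda>n. B (\<xi> n))"
  proof (rule metric_CauchyI)
    fix e :: real assume "e > 0"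
    then obtain n where n: "r (\<xi> n) < e / 2" using order_tendstoD(2)[OF rx, of "e / 2"] by (auto simp: eventually_sequentially)
    have *: "dist (B (\<xi> j)) (B (\<xi> n)) < e / 2" if "j \<ge> n" for j
      using B[OF xi_in xi_in incseqD[OF xi_mono that]] n by (simp add: dist_norm)
    show "\<exists>M. \<forall>m\<ge>M. \<forall>n\<ge>M. dist (B (\<xi> m)) (B (\<xi> n)) < e"
      using * by (intro exI[of _ n]) (metis dist_commute dist_triangle_half_l)
  qed
  then obtain B0 where B0: "(\<lambda>n. B (\<xi> n)) \<longlonglongrightarrow> B0"
    using Cauchy_convergent_iff convergent_def by blast
  have le: "cmod (B0 - B x) \<le> r x" if x: "x \<in> I" for x
  proof (rule tendsto_upperbound)
    show "(\<lambda>n. cmod (B (\<xi> n) - B x)) \<longlonglongrightarrow> cmod (B0 - B x)" by (intro tendsto_intros B0)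
    have "\<forall>\<^sub>F t in endpoint. t \<in> I \<and> x \<le> t" unfolding eventually_endpoint using x by blast
    then have "\<forall>\<^sub>F n in sequentially. \<xi> n \<in> I \<and> x \<le> \<xi> n"
      by (rule filterlim_xi[unfolded filterlim_iff, rule_format])
    then show "\<forall>\<^sub>F n in sequentially. cmod (B (\<xi> n) - B x) \<le> r x"
      by eventually_elim (use B x in auto)
  qed simp
  have "((\<lambda>x. B x - B0) \<longlongrightarrow> 0) endpoint"
  proof (rule Lim_null_comparison[OF _ r])
    show "\<forall>\<^sub>F x in endpoint. norm (B x - B0) \<le> r x"
      unfolding eventually_endpoint using c_in le by (auto simp: norm_minus_commute)
  qed
  then have "(B \<longlongrightarrow> B0) endpoint" by (simp add: LIM_zero_iff)
  with le that show ?thesis by blast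
qed

lemma sigma_pos:
  assumes x: "x \<in> I" shows "sigma x > 0"
proof -
  obtain y where y: "y \<in> I" "x < y" using no_max[OF x] by blast
  have sub': "{x..y} \<subseteq> I" by (rule Icc_sub[OF x y(1)])
  have cont: "continuous_on (cbox x y) (\<lambda>t. (S t)\<^sup>2 * m t)"
    using sub' by (intro continuous_intros continuous_on_subset[OF S_cont] continuous_on_subset[OF m_cont]) auto
  have "integral {x..y} (\<lambda>t. (S t)\<^sup>2 * m t) \<noteq> 0"
  proof
    assume "integral {x..y} (\<lambda>t. (S t)\<^sup>2 * m t) = 0"
    then have "(S x)\<^sup>2 * m x = 0"
      using integral_cbox_eq_0_iff[OF cont] y(2) sub' S_sq_nonneg by (auto simp: subset_iff)
    then show False using S_pos[OF x] m_pos[OF x] by simp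
  qed
  moreover have "integral {x..y} (\<lambda>t. (S t)\<^sup>2 * m t) \<ge> 0"
    using sub' S_sq_nonneg by (intro Henstock_Kurzweil_Integration.integral_nonneg S_sq_integrable x y(1)) auto
  ultimately show ?thesis using integral_S_sq_le[OF x y(1)] y(2) by simp
qed

text \<open>
  By \<open>source_bound\<close> the combination \<open>B = u + S J\<close> converges at the endpoint at rate \<open>\<surd>\<sigma>\<close>, and
  \<open>S J\<close> tends to zero.  So \<open>u\<close> has the same limit as \<open>B\<close>, which must vanish because constants are not
  square integrable.
\<close>

lemma boundary_value_bound:
  assumes st: "end_triple u J k"
  obtains K where "K \<ge> 0" "\<And>x. x \<in> I \<Longrightarrow> cmod (u x + of_real (S x) * J x) \<le> K * sqrt (sigma x)"
proof -
  obtain K where K: "K \<ge> 0"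
    "\<And>x y h. x \<in> I \<Longrightarrow> y \<in> I \<Longrightarrow> continuous_on I h \<Longrightarrow>
       cmod (integral {x..y} (\<lambda>t. of_real (h t) * k t)) \<le> K * sqrt (integral {x..y} (\<lambda>t. (h t)\<^sup>2 * m t))"
    using source_bound[OF st] by blast
  define B where "B x = u x + of_real (S x) * J x" for x
  have Bint: "integral {x..y} (\<lambda>t. of_real (S t) * k t) = B y - B x" if "x \<in> I" "y \<in> I" "x \<le> y" for x y
    using st that unfolding end_triple_def B_def by (blast intro: integral_unique)
  have Jint: "integral {x..y} k = J y - J x" if "x \<in> I" "y \<in> I" "x \<le> y" for x y
    using st that unfolding end_triple_def by (blast intro: integral_unique)
  have Bxy: "cmod (B y - B x) \<le> K * sqrt (sigma x)" if xy: "x \<in> I" "y \<in> I" "x \<le> y" for x y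
  proof -
    have "cmod (B y - B x) \<le> K * sqrt (integral {x..y} (\<lambda>t. (S t)\<^sup>2 * m t))"
      using K(2)[OF xy(1,2) S_cont] Bint[OF xy] by simp
    also have "\<dots> \<le> K * sqrt (sigma x)"
      by (intro mult_left_mono real_sqrt_le_mono integral_S_sq_le xy K(1))
    finally show ?thesis .
  qed
  have "((\<lambda>x. K * sqrt (sigma x)) \<longlongrightarrow> K * sqrt 0) endpoint" by (intro tendsto_intros sigma_tendsto)
  then have rlim: "((\<lambda>x. K * sqrt (sigma x)) \<longlongrightarrow> 0) endpoint" by simp
  obtain B0 where B0: "(B \<longlongrightarrow> B0) endpoint" "\<And>x. x \<in> I \<Longrightarrow> cmod (B0 - B x) \<le> K * sqrt (sigma x)"
    using endpoint_Cauchy[OF Bxy rlim] by blast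
  have Sm: "((\<lambda>x. (S x)\<^sup>2 * integral {c..x} m) \<longlongrightarrow> 0) endpoint"
  proof (rule tendstoI)
    fix e :: real assume e: "e > 0"
    have "\<forall>\<^sub>F x in endpoint. dist (sigma x) 0 < e / 2" using tendstoD[OF sigma_tendsto, of "e / 2"] e by simp
    then obtain x1 where x1: "x1 \<in> I" "sigma x1 < e / 2" unfolding eventually_endpoint by auto
    have "((\<lambda>x. (S x)\<^sup>2 * integral {c..x1} m) \<longlongrightarrow> 0\<^sup>2 * integral {c..x1} m) endpoint"
      by (intro tendsto_intros S_tendsto)
    then have "\<forall>\<^sub>F x in endpoint. dist ((S x)\<^sup>2 * integral {c..x1} m) 0 < e / 2"
      using e by (intro tendstoD) auto
    moreover have "\<forall>\<^sub>F x in endpoint. x \<in> I \<and> x1 \<le> x" unfolding eventually_endpoint using x1 by blast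
    ultimately show "\<forall>\<^sub>F x in endpoint. dist ((S x)\<^sup>2 * integral {c..x} m) 0 < e"
    proof eventually_elim
      case (elim x)
      then have x: "x \<in> I" "x1 \<le> x" by auto
      have cx: "c \<le> x1" using interval[OF x1(1)] by simp
      have "integral {c..x} m = integral {c..x1} m + integral {x1..x} m"
        using Henstock_Kurzweil_Integration.integral_combine[OF cx x(2) m_integrable[OF c_in x(1)]] by simp
      moreover have "(S x)\<^sup>2 * integral {x1..x} m \<le> sigma x1"
      proof -
        have "(S x)\<^sup>2 * integral {x1..x} m = integral {x1..x} (\<lambda>t. (S x)\<^sup>2 * m t)" by simp
        also have "\<dots> \<le> integral {x1..x} (\<lambda>t. (S t)\<^sup>2 * m t)"
        proof (rule integral_le)
          show "(\<lambda>t. (S x)\<^sup>2 * m t) integrable_on {x1..x}"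
            by (intro integrable_on_mult_right m_integrable x1 x)
          show "(\<lambda>t. (S t)\<^sup>2 * m t) integrable_on {x1..x}" by (intro S_sq_integrable x1 x)
          fix t assume t: "t \<in> {x1..x}"
          then have tI: "t \<in> I" using Icc_sub[OF x1(1) x(1)] by blast
          have "0 \<le> S x" using S_pos[OF x(1)] by simp
          then show "(S x)\<^sup>2 * m t \<le> (S t)\<^sup>2 * m t"
            using S_antimono[OF tI x(1)] t m_pos[OF tI] by (intro mult_right_mono power_mono) auto
        qed
        also have "\<dots> \<le> sigma x1" by (rule integral_S_sq_le[OF x1(1) x])
        finally show ?thesis .
      qed
      moreover have "0 \<le> (S x)\<^sup>2 * integral {c..x} m"
        using Icc_sub[OF c_in x(1)] m_pos
        by (intro mult_nonneg_nonneg Henstock_Kurzweil_Integration.integral_nonneg m_integrable c_in x) (auto simp: less_imp_le)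
      ultimately show ?case using elim x1(2) by (auto simp: algebra_simps)
    qed
  qed
  have "((\<lambda>x. S x * cmod (J c) + K * sqrt ((S x)\<^sup>2 * integral {c..x} m)) \<longlongrightarrow> 0 * cmod (J c) + K * sqrt 0) endpoint"
    by (intro tendsto_intros S_tendsto Sm)
  then have SJb: "((\<lambda>x. S x * cmod (J c) + K * sqrt ((S x)\<^sup>2 * integral {c..x} m)) \<longlongrightarrow> 0) endpoint" by simp
  have "((\<lambda>x. of_real (S x) * J x) \<longlongrightarrow> 0) endpoint"
  proof (rule Lim_null_comparison[OF _ SJb])
    have "cmod (of_real (S x) * J x) \<le> S x * cmod (J c) + K * sqrt ((S x)\<^sup>2 * integral {c..x} m)" if x: "x \<in> I" for x
    proof -
      have cx: "c \<le> x" using interval[OF x] by simp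
      have S0: "S x \<ge> 0" using S_pos[OF x] by simp
      have "cmod (J x - J c) \<le> K * sqrt (integral {c..x} m)"
        using K(2)[OF c_in x, of "\<lambda>_. 1"] Jint[OF c_in x cx] by simp
      then have "cmod (J x) \<le> cmod (J c) + K * sqrt (integral {c..x} m)"
        using norm_triangle_sub[of "J x" "J c"] by linarith
      then have "S x * cmod (J x) \<le> S x * (cmod (J c) + K * sqrt (integral {c..x} m))" using S0 by (rule mult_left_mono)
      then show ?thesis using S0 by (simp add: norm_mult real_sqrt_mult algebra_simps)
    qed
    then show "\<forall>\<^sub>F x in endpoint. norm (of_real (S x) * J x) \<le> S x * cmod (J c) + K * sqrt ((S x)\<^sup>2 * integral {c..x} m)"
      unfolding eventually_endpoint using c_in by blast
  qed
  then have "((\<lambda>x. B x - of_real (S x) * J x) \<longlongrightarrow> B0 - 0) endpoint" by (intro tendsto_diff B0(1))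
  then have ulim: "(u \<longlongrightarrow> B0) endpoint" by (simp add: B_def)
  have "B0 = 0"
  proof (rule ccontr)
    assume "B0 \<noteq> 0"
    then have pos: "cmod B0 / 2 > 0" "cmod B0 / 2 < cmod B0" by auto
    have "\<forall>\<^sub>F x in endpoint. cmod B0 / 2 < cmod (u x)"
      using order_tendstoD(1)[OF tendsto_norm[OF ulim] pos(2)] .
    then obtain x0 where x0: "x0 \<in> I" "\<And>x. x \<in> I \<Longrightarrow> x0 \<le> x \<Longrightarrow> cmod B0 / 2 < cmod (u x)"
      unfolding eventually_endpoint by blast
    define C where "C = 1 / (cmod B0 / 2)\<^sup>2"
    have C: "C \<ge> 0" "C * (cmod B0 / 2)\<^sup>2 = 1" using pos by (auto simp: C_def)
    have "m integrable_on I"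
    proof (rule measurable_bounded_by_integrable_imp_integrable)
      show "m \<in> borel_measurable (lebesgue_on I)"
        by (rule continuous_imp_measurable_on_sets_lebesgue[OF m_cont I_sets])
      have "(\<lambda>t. if t \<in> {c..x0} then m t else 0) integrable_on I"
        using m_integrable[OF c_in x0(1)] interval[OF x0(1)] unfolding integrable_restrict_Int by (simp add: Int_absorb2)
      moreover have "(\<lambda>t. (cmod (u t))\<^sup>2 * m t) integrable_on I" using st by (simp add: end_triple_def)
      ultimately show "(\<lambda>t. (if t \<in> {c..x0} then m t else 0) + C * ((cmod (u t))\<^sup>2 * m t)) integrable_on I"
        by (intro integrable_add integrable_on_mult_right)
      fix t assume t: "t \<in> I"
      have mt: "m t > 0" by (rule m_pos[OF t])
      show "norm (m t) \<le> (if t \<in> {c..x0} then m t else 0) + C * ((cmod (u t))\<^sup>2 * m t)"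
      proof (cases "t \<le> x0")
        case True
        then show ?thesis using interval[OF t] mt C(1) by simp
      next
        case False
        then have "(cmod B0 / 2)\<^sup>2 \<le> (cmod (u t))\<^sup>2" using x0(2)[OF t] pos by (intro power_mono) auto
        then have "C * (cmod B0 / 2)\<^sup>2 * m t \<le> C * (cmod (u t))\<^sup>2 * m t"
          using C(1) mt by (intro mult_right_mono mult_left_mono) auto
        then show ?thesis using False mt C(2) by (simp add: mult.assoc)
      qed
    qed (rule I_sets)
    with m_not show False by simp
  qed
  then have "cmod (u x + of_real (S x) * J x) \<le> K * sqrt (sigma x)" if "x \<in> I" for x
    using B0(2)[OF that] unfolding B_def by (metis diff_0 norm_minus_cancel)
  with K(1) that show ?thesis by blast
qed

text \<open>
  The Wronskian has an integrable derivative, hence a limit \<open>w\<^sub>0\<close>.  From \<open>S W = u B\<^sub>v - B\<^sub>u v\<close> and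
  the bounds on \<open>B\<^sub>u\<close>, \<open>B\<^sub>v\<close> follows \<open>\<bar>W\<bar>\<^sup>2 S\<^sup>2 m \<le> 2 K\<^sup>2 \<sigma> q\<close> with
  \<open>q = (\<bar>u\<bar>\<^sup>2 + \<bar>v\<bar>\<^sup>2) m\<close>.  Integrated from \<open>x\<close> to the endpoint, where \<open>\<sigma>\<close> decreases from
  \<open>\<sigma>(x)\<close> to \<open>0\<close>, this bounds \<open>\<bar>w\<^sub>0\<bar>\<^sup>2 / 4\<close> by a multiple of the tail of the integral of \<open>q\<close>.
\<close>

theorem wronskian_tendsto:
  assumes u: "end_triple u J k" and v: "end_triple v L l"
    and W: "\<And>x y. x \<in> I \<Longrightarrow> y \<in> I \<Longrightarrow> x \<le> y \<Longrightarrow> ((\<lambda>t. u t * l t - k t * v t) has_integral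
      ((u y * L y - J y * v y) - (u x * L x - J x * v x))) {x..y}"
  shows "((\<lambda>x. u x * L x - J x * v x) \<longlongrightarrow> 0) endpoint"
proof -
  define w where "w x = u x * L x - J x * v x" for x
  define p where "p t = ((cmod (u t))\<^sup>2 * m t + (cmod (l t))\<^sup>2 / m t) + ((cmod (k t))\<^sup>2 / m t + (cmod (v t))\<^sup>2 * m t)" for t
  define q where "q t = (cmod (u t))\<^sup>2 * m t + (cmod (v t))\<^sup>2 * m t" for t
  have pI: "p integrable_on I" and qI: "q integrable_on I"
    unfolding p_def q_def using u v by (auto simp: end_triple_def intro!: integrable_add)
  have p0: "0 \<le> p t" and q0: "0 \<le> q t" if "t \<in> I" for t using m_pos[OF that] by (auto simp: p_def q_def)
  have young: "cmod (a * b) \<le> (cmod a)\<^sup>2 * m t + (cmod b)\<^sup>2 / m t" if "t \<in> I" for a b t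
  proof -
    have mt: "m t > 0" by (rule m_pos[OF that])
    have "2 * (cmod a * sqrt (m t)) * (cmod b / sqrt (m t)) \<le> (cmod a * sqrt (m t))\<^sup>2 + (cmod b / sqrt (m t))\<^sup>2"
      by (rule sum_squares_bound)
    then have "2 * (cmod a * cmod b) \<le> (cmod a)\<^sup>2 * m t + (cmod b)\<^sup>2 / m t"
      using mt by (simp add: power_mult_distrib power_divide)
    moreover have "0 \<le> cmod a * cmod b" by simp
    ultimately show ?thesis unfolding norm_mult by linarith
  qed
  have Wxy: "cmod (w y - w x) \<le> tail p x" if xy: "x \<in> I" "y \<in> I" "x \<le> y" for x y
  proof -
    have "cmod (integral {x..y} (\<lambda>t. u t * l t - k t * v t)) \<le> integral {x..y} p"
    proof (rule integral_norm_bound_integral)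
      show "(\<lambda>t. u t * l t - k t * v t) integrable_on {x..y}" using W[OF xy] by blast
      show "p integrable_on {x..y}" by (rule weight_integrable_Icc[OF pI p0 xy(1,2)])
      fix t assume "t \<in> {x..y}"
      then have t: "t \<in> I" using Icc_sub[OF xy(1,2)] by blast
      show "norm (u t * l t - k t * v t) \<le> p t"
        unfolding p_def using norm_triangle_ineq4[of "u t * l t" "k t * v t"] young[OF t, of "u t" "l t"]
          young[OF t, of "v t" "k t"] by (simp add: mult.commute)
    qed
    also have "\<dots> \<le> tail p x" by (rule integral_le_tail[OF pI p0 xy])
    finally show ?thesis using integral_unique[OF W[OF xy]] by (simp add: w_def)
  qed
  obtain w0 where w0: "(w \<longlongrightarrow> w0) endpoint"
    using endpoint_Cauchy[OF Wxy tail_tendsto[OF pI p0]] by blast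
  obtain K1 where K1: "K1 \<ge> 0" "\<And>x. x \<in> I \<Longrightarrow> cmod (u x + of_real (S x) * J x) \<le> K1 * sqrt (sigma x)"
    using boundary_value_bound[OF u] by blast
  obtain K2 where K2: "K2 \<ge> 0" "\<And>x. x \<in> I \<Longrightarrow> cmod (v x + of_real (S x) * L x) \<le> K2 * sqrt (sigma x)"
    using boundary_value_bound[OF v] by blast
  define K where "K = K1 + K2"
  have bound: "(cmod (w t))\<^sup>2 * ((S t)\<^sup>2 * m t) \<le> 2 * K\<^sup>2 * sigma t * q t" if t: "t \<in> I" for t
  proof -
    define Bu where "Bu = u t + of_real (S t) * J t"
    define Bv where "Bv = v t + of_real (S t) * L t"
    have b: "cmod Bu \<le> K * sqrt (sigma t)" "cmod Bv \<le> K * sqrt (sigma t)"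
      using K1(2)[OF t] K2(2)[OF t] K1(1) K2(1) sigma_nonneg[OF t]
      by (auto simp: Bu_def Bv_def K_def distrib_right intro: order_trans)
    have b2: "(cmod Bu)\<^sup>2 \<le> K\<^sup>2 * sigma t" "(cmod Bv)\<^sup>2 \<le> K\<^sup>2 * sigma t"
      using power_mono[OF b(1) norm_ge_zero, of 2] power_mono[OF b(2) norm_ge_zero, of 2] sigma_nonneg[OF t]
      by (simp_all add: power_mult_distrib)
    have "of_real (S t) * w t = u t * Bv - Bu * v t"
      by (simp add: w_def Bu_def Bv_def algebra_simps)
    then have "(S t)\<^sup>2 * (cmod (w t))\<^sup>2 = (cmod (u t * Bv + - (Bu * v t)))\<^sup>2"
      by (metis norm_mult norm_of_real power2_abs power_mult_distrib uminus_add_conv_diff add.commute)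
    also have "\<dots> \<le> 2 * (cmod (u t * Bv))\<^sup>2 + 2 * (cmod (- (Bu * v t)))\<^sup>2" by (rule sq_norm_add_le)
    also have "\<dots> = 2 * ((cmod (u t))\<^sup>2 * (cmod Bv)\<^sup>2) + 2 * ((cmod Bu)\<^sup>2 * (cmod (v t))\<^sup>2)"
      by (simp add: norm_mult power_mult_distrib)
    also have "\<dots> \<le> 2 * ((cmod (u t))\<^sup>2 * (K\<^sup>2 * sigma t)) + 2 * ((K\<^sup>2 * sigma t) * (cmod (v t))\<^sup>2)"
      using b2 by (intro add_mono mult_left_mono mult_right_mono) auto
    finally have "(S t)\<^sup>2 * (cmod (w t))\<^sup>2 * m t \<le> (2 * ((cmod (u t))\<^sup>2 * (K\<^sup>2 * sigma t)) + 2 * ((K\<^sup>2 * sigma t) * (cmod (v t))\<^sup>2)) * m t"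
      using m_pos[OF t] by (intro mult_right_mono) auto
    then show ?thesis by (simp add: q_def algebra_simps)
  qed
  have "w0 = 0"
  proof (rule ccontr)
    assume "w0 \<noteq> 0"
    define a where "a = (cmod w0 / 2)\<^sup>2"
    have a: "a > 0" "cmod w0 / 2 < cmod w0" using \<open>w0 \<noteq> 0\<close> by (auto simp: a_def)
    have "\<forall>\<^sub>F x in endpoint. cmod w0 / 2 < cmod (w x)"
      using order_tendstoD(1)[OF tendsto_norm[OF w0] a(2)] .
    then obtain x0 where x0: "x0 \<in> I" "\<And>x. x \<in> I \<Longrightarrow> x0 \<le> x \<Longrightarrow> cmod w0 / 2 < cmod (w x)"
      unfolding eventually_endpoint by blast
    have key: "a * (sigma x - sigma y) \<le> 2 * K\<^sup>2 * sigma x * tail q x"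
      if xy: "x \<in> I" "y \<in> I" "x0 \<le> x" "x \<le> y" for x y
    proof -
      have "a * (sigma x - sigma y) = integral {x..y} (\<lambda>t. a * ((S t)\<^sup>2 * m t))"
        using sigma_diff[OF xy(1,2,4)] by simp
      also have "\<dots> \<le> integral {x..y} (\<lambda>t. (2 * K\<^sup>2 * sigma x) * q t)"
      proof (rule integral_le)
        show "(\<lambda>t. a * ((S t)\<^sup>2 * m t)) integrable_on {x..y}"
          by (intro integrable_on_mult_right S_sq_integrable xy)
        show "(\<lambda>t. (2 * K\<^sup>2 * sigma x) * q t) integrable_on {x..y}"
          by (intro integrable_on_mult_right weight_integrable_Icc[OF qI q0] xy)
        fix t assume tt: "t \<in> {x..y}"
        then have t: "t \<in> I" using Icc_sub[OF xy(1,2)] by blast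
        have "a \<le> (cmod (w t))\<^sup>2" unfolding a_def using x0(2)[OF t] tt xy by (intro power_mono) auto
        then have "a * ((S t)\<^sup>2 * m t) \<le> (cmod (w t))\<^sup>2 * ((S t)\<^sup>2 * m t)"
          using S_sq_nonneg[OF t] by (rule mult_right_mono)
        also have "\<dots> \<le> 2 * K\<^sup>2 * sigma t * q t" by (rule bound[OF t])
        also have "\<dots> \<le> 2 * K\<^sup>2 * sigma x * q t"
          using sigma_antimono[OF xy(1) t] tt q0[OF t] by (intro mult_right_mono mult_left_mono) auto
        finally show "a * ((S t)\<^sup>2 * m t) \<le> (2 * K\<^sup>2 * sigma x) * q t" .
      qed
      also have "\<dots> = 2 * K\<^sup>2 * sigma x * integral {x..y} q" by simp
      also have "\<dots> \<le> 2 * K\<^sup>2 * sigma x * tail q x"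
        using sigma_nonneg[OF xy(1)] integral_le_tail[OF qI q0 xy(1,2,4)] by (intro mult_left_mono) auto
      finally show ?thesis .
    qed
    have key2: "a \<le> 2 * K\<^sup>2 * tail q x" if x: "x \<in> I" "x0 \<le> x" for x
    proof -
      have "((\<lambda>y. a * (sigma x - sigma y)) \<longlongrightarrow> a * (sigma x - 0)) endpoint"
        by (intro tendsto_intros sigma_tendsto)
      then have "a * (sigma x - 0) \<le> 2 * K\<^sup>2 * sigma x * tail q x"
        by (rule tendsto_upperbound) (use x key endpoint_nontrivial in \<open>auto simp: eventually_endpoint\<close>)
      then have "sigma x * a \<le> sigma x * (2 * K\<^sup>2 * tail q x)" by (simp add: algebra_simps)
      then show ?thesis using sigma_pos[OF x(1)] by simp
    qed
    have "((\<lambda>x. 2 * K\<^sup>2 * tail q x) \<longlongrightarrow> 2 * K\<^sup>2 * 0) endpoint"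
      by (intro tendsto_intros tail_tendsto qI q0)
    then have "a \<le> 2 * K\<^sup>2 * 0"
      by (rule tendsto_lowerbound) (use x0(1) key2 endpoint_nontrivial in \<open>auto simp: eventually_endpoint\<close>)
    with a show False by simp
  qed
  with w0 show ?thesis by (simp add: w_def[abs_def])
qed

end

section \<open>The Fokker--Planck operator as a canonical system\<close>

lemma primitive_of_measurable:
  assumes F: "primitive_of f F"
  shows "f \<in> borel_measurable (lebesgue_on {0<..})"
proof -
  have "(\<lambda>x. if x \<in> {0<..} then f x else 0) \<in> borel_measurable lebesgue"
  proof (rule borel_measurable_LIMSEQ_metric)
    fix n :: nat
    let ?S = "{inverse (real (Suc n))..real (Suc n)}"
    have "inverse (real (Suc n)) \<le> real (Suc n)"
      using inverse_le_1_iff[of "real (Suc n)"] by (auto intro: order_trans[of _ 1])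
    then have "integrable (lebesgue_on ?S) f"
      by (intro absolutely_integrable_imp_integrable primitive_ofD(1)[OF F]) auto
    then show "(\<lambda>x. if x \<in> ?S then f x else 0) \<in> borel_measurable lebesgue"
      by (subst borel_measurable_if) auto
  next
    fix x :: real
    show "(\<lambda>n. if x \<in> {inverse (real (Suc n))..real (Suc n)} then f x else 0) \<longlonglongrightarrow> (if x \<in> {0<..} then f x else 0)"
    proof (cases "x > 0")
      case True
      obtain N :: nat where N: "x \<in> {inverse (real (Suc N))<..<real (Suc N)}" using exhaust_halfline[OF True] by blast
      have "x \<in> {inverse (real (Suc n))..real (Suc n)}" if "n \<ge> N" for n
      proof -
        have "inverse (real (Suc n)) \<le> inverse (real (Suc N))" using that by (intro le_imp_inverse_le) auto
        moreover have "real (Suc N) \<le> real (Suc n)" using that by simp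
        moreover have "inverse (real (Suc N)) < x" "x < real (Suc N)"
          using N by (simp_all only: greaterThanLessThan_iff)
        ultimately show ?thesis by (simp only: atLeastAtMost_iff) linarith
      qed
      then show ?thesis using True by (intro tendsto_eventually eventually_sequentiallyI[of N]) simp
    next
      case False
      have "x \<notin> {inverse (real (Suc n))..real (Suc n)}" for n
      proof -
        have "inverse (real (Suc n)) > 0" by simp
        then show ?thesis using False by (simp only: atLeastAtMost_iff) linarith
      qed
      then show ?thesis using False by simp
    qed
  qed
  then show ?thesis by (subst (asm) borel_measurable_if) auto
qed

lemma borel_measurable_lebesgue_on_spike:
  fixes f g :: "real \<Rightarrow> complex"
  assumes f: "f \<in> borel_measurable (lebesgue_on S)" and S: "S \<in> sets lebesgue"
    and N: "negligible N" and eq: "\<And>x. x \<in> S \<Longrightarrow> x \<notin> N \<Longrightarrow> f x = g x"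
  shows "g \<in> borel_measurable (lebesgue_on S)"
proof -
  have "(\<lambda>x. if x \<in> S then f x else 0) \<in> borel_measurable lebesgue"
    using f S by (subst borel_measurable_if) auto
  then have "(\<lambda>x. if x \<in> S then g x else 0) \<in> borel_measurable lebesgue"
    by (rule borel_measurable_AE) (use N eq in \<open>auto simp: eventually_ae_filter_negligible intro!: exI[of _ N]\<close>)
  then show ?thesis using S by (subst (asm) borel_measurable_if) auto
qed

locale cev =
  fixes \<mu> \<sigma> \<gamma> :: real
  assumes mu: "\<mu> > 0" and sigma: "\<sigma> > 0" and gamma1: "1 \<le> \<gamma>" and gamma2: "\<gamma> < 2"
begin

abbreviation "w \<equiv> cev_weight \<mu> \<sigma> \<gamma>"
abbreviation "M \<equiv> cev_measure \<mu> \<sigma> \<gamma>"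
abbreviation "Dmax \<equiv> cev_Dmax \<mu> \<sigma> \<gamma>"
abbreviation "expr \<equiv> cev_expr \<mu> \<sigma> \<gamma>"

definition \<alpha> :: real where "\<alpha> = - cev_nu \<mu> \<sigma> \<gamma>"

definition diffusion :: "real \<Rightarrow> real" where "diffusion x = \<sigma>\<^sup>2 / 2 * x powr \<gamma>"

definition drift :: "real \<Rightarrow> real" where
  "drift x = \<sigma>\<^sup>2 / 2 * (\<gamma> * x powr (\<gamma> - 1)) - \<mu> * x"

definition scale :: "real \<Rightarrow> real" where
  "scale x = 2 / \<sigma>\<^sup>2 * exp (- \<alpha> * x powr (2 - \<gamma>))"

text \<open>
  The probability flux: by \<open>diffusion_deriv\<close> it equals \<open>(\<sigma>\<^sup>2/2 x\<^sup>\<gamma> p)' - \<mu> x p\<close>, and its derivative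
  is the Fokker--Planck expression.
\<close>

definition flux :: "(real \<Rightarrow> complex) \<Rightarrow> real \<Rightarrow> complex" where
  "flux p x = of_real (diffusion x) * vderiv p x + of_real (drift x) * p x"

lemma alpha_pos: "\<alpha> > 0"
  using cev_nu_neg[OF mu sigma gamma2] by (simp add: \<alpha>_def)

lemma alpha_delta: "\<alpha> * (2 - \<gamma>) = 2 * \<mu> / \<sigma>\<^sup>2"
  using gamma2 sigma by (simp add: \<alpha>_def cev_nu_def divide_simps) (simp add: algebra_simps)

lemma w_pos: "x > 0 \<Longrightarrow> w x > 0" by (rule cev_weight_pos)

lemma w_eq: "w x = x powr \<gamma> * exp (- \<alpha> * x powr (2 - \<gamma>))"
  by (simp add: cev_weight_def \<alpha>_def)

lemma scale_pos: "scale x > 0" using sigma by (simp add: scale_def)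

lemma scale_diffusion: "scale x * diffusion x = w x"
  using sigma by (simp add: scale_def diffusion_def w_eq)

lemma Q2_eq: "cev_Q2 \<mu> \<sigma> \<gamma> x = diffusion x * w x"
  by (simp add: cev_Q2_def diffusion_def)

lemma w_deriv:
  assumes "x > 0" shows "(w has_real_derivative scale x * drift x) (at x)"
proof -
  have "scale x * drift x = scale x * diffusion x * (\<gamma> / x - 2 * \<mu> / \<sigma>\<^sup>2 * x powr (1 - \<gamma>))"
  proof -
    have 1: "x powr \<gamma> * (\<gamma> / x) = \<gamma> * x powr (\<gamma> - 1)" using assms by (simp add: powr_diff)
    have 2: "x powr \<gamma> * x powr (1 - \<gamma>) = x" using assms by (simp flip: powr_add)
    have "diffusion x * (\<gamma> / x - 2 * \<mu> / \<sigma>\<^sup>2 * x powr (1 - \<gamma>)) =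
        \<sigma>\<^sup>2 / 2 * (x powr \<gamma> * (\<gamma> / x)) - \<mu> * (x powr \<gamma> * x powr (1 - \<gamma>))"
      using sigma by (simp add: diffusion_def right_diff_distrib)
    also have "\<dots> = drift x" unfolding 1 2 by (simp add: drift_def)
    finally have "drift x = diffusion x * (\<gamma> / x - 2 * \<mu> / \<sigma>\<^sup>2 * x powr (1 - \<gamma>))" ..
    then show ?thesis by simp
  qed
  then show ?thesis
    using cev_weight_deriv[of \<sigma> \<gamma> x \<mu>] sigma gamma2 assms scale_diffusion[of x] by simp
qed

lemma powr_cont: "continuous_on {0<..} (\<lambda>x::real. x powr a)"
  by (intro continuous_intros) auto

lemma w_cont: "continuous_on {0<..} w"
  unfolding w_eq[abs_def] by (intro continuous_intros powr_cont)

lemma scale_cont: "continuous_on {0<..} scale"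
  unfolding scale_def[abs_def] by (intro continuous_intros powr_cont)

lemma drift_cont: "continuous_on {0<..} drift"
  unfolding drift_def[abs_def] by (intro continuous_intros powr_cont)

lemma powr_deriv: "y > 0 \<Longrightarrow> ((\<lambda>y::real. y powr a) has_real_derivative a * y powr (a - 1)) (at y)"
  by (auto intro!: derivative_eq_intros)

lemma of_real_deriv:
  "(f has_real_derivative d) (at y) \<Longrightarrow> ((\<lambda>y. complex_of_real (f y)) has_vector_derivative of_real d) (at y)"
  using has_vector_derivative_of_real[of f d "at y"] by simp

lemma prod_deriv:
  assumes "(f has_real_derivative d) (at y)" "(g has_vector_derivative g') (at y)"
  shows "((\<lambda>y. complex_of_real (f y) * g y) has_vector_derivative of_real (f y) * g' + of_real d * g y) (at y)"
  using has_vector_derivative_mult[OF of_real_deriv[OF assms(1)] assms(2)] by simp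

lemma primitive_real:
  assumes "\<And>x. x > 0 \<Longrightarrow> (f has_real_derivative d x) (at x)" "continuous_on {0<..} d"
  shows "primitive_of (\<lambda>x. of_real (d x)) (\<lambda>x. of_real (f x))"
  by (rule primitive_of_C1) (use assms in \<open>auto intro!: of_real_deriv continuous_intros\<close>)

lemma w_primitive: "primitive_of (\<lambda>x. of_real (scale x * drift x)) (\<lambda>x. of_real (w x))"
  by (intro primitive_real w_deriv continuous_intros scale_cont drift_cont)

lemma winv_primitive:
  "primitive_of (\<lambda>x. of_real (- (inverse (w x) * (scale x * drift x) * inverse (w x)))) (\<lambda>x. of_real (inverse (w x)))"
proof (rule primitive_real)
  show "((\<lambda>x. inverse (w x)) has_real_derivative - (inverse (w x) * (scale x * drift x) * inverse (w x))) (at x)" if "x > 0" for x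
    using DERIV_inverse'[OF w_deriv[OF that]] w_pos[OF that] by simp
  show "continuous_on {0<..} (\<lambda>x. - (inverse (w x) * (scale x * drift x) * inverse (w x)))"
    by (intro continuous_intros w_cont scale_cont drift_cont) (use w_pos in force)+
qed

lemma drift_primitive:
  "primitive_of (\<lambda>x. of_real (\<sigma>\<^sup>2 / 2 * (\<gamma> * ((\<gamma> - 1) * x powr (\<gamma> - 1 - 1))) - \<mu>)) (\<lambda>x. of_real (drift x))"
proof (rule primitive_real)
  show "(drift has_real_derivative \<sigma>\<^sup>2 / 2 * (\<gamma> * ((\<gamma> - 1) * x powr (\<gamma> - 1 - 1))) - \<mu>) (at x)" if "x > 0" for x
    unfolding drift_def[abs_def]
    by (intro DERIV_diff DERIV_cmult powr_deriv that DERIV_cmult_Id)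
  show "continuous_on {0<..} (\<lambda>x. \<sigma>\<^sup>2 / 2 * (\<gamma> * ((\<gamma> - 1) * x powr (\<gamma> - 1 - 1))) - \<mu>)"
    by (intro continuous_intros powr_cont)
qed

lemma diffusion_deriv:
  "x > 0 \<Longrightarrow> (diffusion has_real_derivative drift x + \<mu> * x) (at x)"
  using DERIV_cmult[OF powr_deriv[of x \<gamma>], of "\<sigma>\<^sup>2 / 2"] by (simp add: diffusion_def[abs_def] drift_def)

lemma expr_eq_flux_deriv:
  assumes dp: "\<And>y. y > 0 \<Longrightarrow> (p has_vector_derivative vderiv p y) (at y)"
    and fl: "(flux p has_vector_derivative D) (at x)" and x: "x > 0"
  shows "expr p x = D"
proof -
  have A: "vderiv (\<lambda>y. of_real (diffusion y) * p y) y = flux p y + of_real (\<mu> * y) * p y" if "y > 0" for y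
    using vector_derivative_at[OF prod_deriv[OF diffusion_deriv[OF that] dp[OF that]]]
    by (simp add: flux_def distrib_right)
  have B: "((\<lambda>y. of_real y * p y) has_vector_derivative (of_real x * vderiv p x + p x)) (at x)"
    using prod_deriv[OF DERIV_ident dp[OF x]] by simp
  have "((\<lambda>y. of_real (\<mu> * y) * p y) has_vector_derivative of_real \<mu> * (of_real x * vderiv p x + p x)) (at x)"
    using has_vector_derivative_mult_right[OF B, of "of_real \<mu>"] by (simp add: mult.assoc)
  with fl have "((\<lambda>y. flux p y + of_real (\<mu> * y) * p y) has_vector_derivative D + of_real \<mu> * (of_real x * vderiv p x + p x)) (at x)"
    by (rule has_vector_derivative_add)
  then have "(vderiv (\<lambda>y. of_real (diffusion y) * p y) has_vector_derivative D + of_real \<mu> * (of_real x * vderiv p x + p x)) (at x)"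
    by (rule has_vector_derivative_transform_within_open[where S = "{0<..}"]) (use x A in auto)
  from vector_derivative_at[OF this] vector_derivative_at[OF B] show ?thesis
    by (simp add: cev_expr_def diffusion_def)
qed

lemma wp_deriv:
  assumes dp: "(p has_vector_derivative vderiv p x) (at x)" and x: "x > 0"
  shows "((\<lambda>x. of_real (w x) * p x) has_vector_derivative of_real (scale x) * flux p x) (at x)"
proof -
  have "of_real (w x) * vderiv p x + of_real (scale x * drift x) * p x = of_real (scale x) * flux p x"
    unfolding scale_diffusion[symmetric] by (simp add: flux_def algebra_simps)
  then show ?thesis using prod_deriv[OF w_deriv[OF x] dp] by simp
qed

lemma Dmax_deriv: "p \<in> Dmax \<Longrightarrow> y > 0 \<Longrightarrow> (p has_vector_derivative vderiv p y) (at y)"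
  unfolding cev_Dmax_def
  by (metis (no_types, lifting) at_within_open differentiable_on_def greaterThan_iff mem_Collect_eq open_greaterThan
        vector_derivative_works)

text \<open>
  The derivative of \<open>Q\<^sub>2 p'\<close> exists almost everywhere by absolute continuity; wherever it exists, the
  flux is differentiable and its derivative is the Fokker--Planck expression.
\<close>

theorem Dmax_primitives:
  assumes p: "p \<in> Dmax"
  shows "primitive_of (expr p) (flux p)"
    "primitive_of (\<lambda>x. of_real (scale x) * flux p x) (\<lambda>x. of_real (w x) * p x)"
proof -
  note dp = Dmax_deriv[OF p]
  define q where "q x = of_real (cev_Q2 \<mu> \<sigma> \<gamma> x) * vderiv p x" for x
  have lac: "locally_abs_continuous p" "locally_abs_continuous q"
    using p by (auto simp: cev_Dmax_def q_def[abs_def])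
  obtain N where N: "negligible N" "\<And>x. x > 0 \<Longrightarrow> x \<notin> N \<Longrightarrow> (q has_vector_derivative vderiv q x) (at x)"
    by (rule lac_differentiable_ae[OF lac(2)]) (erule that, blast)
  have q_prim: "primitive_of (vderiv q) q"
    using lac(2) by (intro lac_primitive_of[OF _ N]) (auto simp: locally_abs_continuous_def)
  have p_prim: "primitive_of (vderiv p) p"
    using lac(1) by (intro lac_primitive_of[OF _ negligible_empty]) (auto simp: locally_abs_continuous_def intro: dp)
  have flux_eq: "flux p x = 1 * (of_real (inverse (w x)) * q x) + 1 * (of_real (drift x) * p x)" if "x > 0" for x
    using w_pos[OF that] by (simp add: flux_def q_def Q2_eq)
  have "\<exists>f. primitive_of f (\<lambda>x. 1 * (of_real (inverse (w x)) * q x) + 1 * (of_real (drift x) * p x))"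
    by (rule exI, rule primitive_of_linear[OF primitive_of_mult[OF winv_primitive q_prim] primitive_of_mult[OF drift_primitive p_prim]])
  then obtain f where "primitive_of f (\<lambda>x. 1 * (of_real (inverse (w x)) * q x) + 1 * (of_real (drift x) * p x))" ..
  then have f: "primitive_of f (flux p)" by (rule primitive_of_cong) (rule flux_eq)
  obtain N' where N': "negligible N'" "\<And>x. x > 0 \<Longrightarrow> x \<notin> N' \<Longrightarrow> (flux p has_vector_derivative f x) (at x)"
    by (rule primitive_of_deriv[OF f]) (erule that, blast)
  show "primitive_of (expr p) (flux p)"
    by (rule primitive_of_spike[OF f N'(1)]) (rule expr_eq_flux_deriv[OF dp N'(2)])
  show "primitive_of (\<lambda>x. of_real (scale x) * flux p x) (\<lambda>x. of_real (w x) * p x)"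
    by (intro primitive_of_C1 wp_deriv dp continuous_intros scale_cont primitive_of_continuous[OF f])
qed

text \<open>
  The converse of \<open>Dmax_primitives\<close>: solutions of the first-order system, with \<open>k\<close> given only
  almost everywhere, produce elements of the maximal domain.
\<close>

theorem Dmax_of_primitives:
  assumes J: "primitive_of k J" and u: "primitive_of (\<lambda>x. of_real (scale x) * J x) u"
    and p: "\<And>x. x > 0 \<Longrightarrow> p x = u x / of_real (w x)"
  shows "\<And>x. x > 0 \<Longrightarrow> flux p x = J x" "\<And>y. y > 0 \<Longrightarrow> (p has_vector_derivative vderiv p y) (at y)"
    "\<exists>N. negligible N \<and> (\<forall>x>0. x \<notin> N \<longrightarrow> expr p x = k x)"
    "p \<in> L2 M \<Longrightarrow> expr p \<in> L2 M \<Longrightarrow> p \<in> Dmax"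
proof -
  have Jc: "continuous_on {0<..} J" by (rule primitive_of_continuous[OF J])
  have du: "(u has_vector_derivative of_real (scale x) * J x) (at x)" if "x > 0" for x
    by (rule primitive_of_continuous_deriv[OF u _ that]) (intro continuous_intros scale_cont Jc)
  have p': "p x = of_real (inverse (w x)) * u x" if "x > 0" for x using p[OF that] by (simp add: divide_inverse)
  have dp0: "(p has_vector_derivative of_real (inverse (w x)) * (of_real (scale x) * J x)
      + of_real (- (inverse (w x) * (scale x * drift x) * inverse (w x))) * u x) (at x)" if x: "x > 0" for x
  proof -
    have "((\<lambda>x. inverse (w x)) has_real_derivative - (inverse (w x) * (scale x * drift x) * inverse (w x))) (at x)"
      using DERIV_inverse'[OF w_deriv[OF x]] w_pos[OF x] by simp
    from prod_deriv[OF this du[OF x]] show ?thesis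
      by (rule has_vector_derivative_transform_within_open[where S = "{0<..}"]) (use x p' in auto)
  qed
  then show dp: "(p has_vector_derivative vderiv p x) (at x)" if "x > 0" for x
    using that by (metis vector_derivative_at)
  show flux: "flux p x = J x" if x: "x > 0" for x
  proof -
    have wn: "complex_of_real (w x) \<noteq> 0" using w_pos[OF x] by simp
    have "of_real (w x) * flux p x = of_real (diffusion x) * (of_real (w x) * vderiv p x) + of_real (drift x) * (of_real (w x) * p x)"
      by (simp add: flux_def algebra_simps)
    also have "of_real (w x) * vderiv p x = of_real (scale x) * J x - of_real (scale x * drift x) * (u x / of_real (w x))"
      unfolding vector_derivative_at[OF dp0[OF x]] using wn by (simp add: field_simps)
    also have "of_real (diffusion x) * (of_real (scale x) * J x - of_real (scale x * drift x) * (u x / of_real (w x))) + of_real (drift x) * (of_real (w x) * p x)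
      = of_real (scale x * diffusion x) * J x - of_real (scale x * diffusion x) * of_real (drift x) * (u x / of_real (w x)) + of_real (drift x) * (of_real (w x) * p x)"
      by (simp add: algebra_simps)
    also have "\<dots> = of_real (w x) * J x" unfolding scale_diffusion p[OF x] by simp
    finally show ?thesis using wn by simp
  qed
  obtain N where N: "negligible N" "\<And>x. x > 0 \<Longrightarrow> x \<notin> N \<Longrightarrow> (J has_vector_derivative k x) (at x)"
    by (rule primitive_of_deriv[OF J]) (erule that, blast)
  have "expr p x = k x" if "x > 0" "x \<notin> N" for x
  proof (rule expr_eq_flux_deriv[OF dp _ that(1)])
    show "(flux p has_vector_derivative k x) (at x)"
      by (rule has_vector_derivative_transform_within_open[OF N(2)[OF that], where S = "{0<..}"]) (use that flux in auto)
  qed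
  with N(1) show "\<exists>N. negligible N \<and> (\<forall>x>0. x \<notin> N \<longrightarrow> expr p x = k x)" by blast
  assume L2: "p \<in> L2 M" "expr p \<in> L2 M"
  have lacp: "locally_abs_continuous p"
    by (rule primitive_of_lac[OF primitive_of_cong[OF primitive_of_mult[OF winv_primitive u]]]) (use p' in simp)
  have q_eq: "of_real (cev_Q2 \<mu> \<sigma> \<gamma> x) * vderiv p x = 1 * (of_real (w x) * J x) + (-1) * (of_real (drift x) * u x)" if x: "x > 0" for x
  proof -
    have wn: "complex_of_real (w x) \<noteq> 0" using w_pos[OF x] by simp
    have "of_real (cev_Q2 \<mu> \<sigma> \<gamma> x) * vderiv p x = of_real (w x) * (flux p x - of_real (drift x) * p x)"
      by (simp add: Q2_eq flux_def)
    then show ?thesis using wn by (simp add: flux[OF x] p[OF x] algebra_simps)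
  qed
  have lacq: "locally_abs_continuous (\<lambda>x. of_real (cev_Q2 \<mu> \<sigma> \<gamma> x) * vderiv p x)"
    by (rule primitive_of_lac[OF primitive_of_cong[OF primitive_of_linear[OF primitive_of_mult[OF w_primitive J] primitive_of_mult[OF drift_primitive u]]]])
       (rule q_eq)
  have "p differentiable_on {0<..}"
    unfolding differentiable_on_def using dp
    by (metis at_within_open differentiableI_vector greaterThan_iff open_greaterThan)
  with L2 lacp lacq show "p \<in> Dmax" by (simp add: cev_Dmax_def)
qed

lemma wronskian_eq:
  "cev_wronskian \<mu> \<sigma> \<gamma> f g x = (of_real (w x) * f x) * flux g x - flux f x * (of_real (w x) * g x)"
  by (simp add: cev_wronskian_def Q2_eq flux_def algebra_simps)

lemma w_measurable: "w \<in> borel_measurable (lebesgue_on {0<..})"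
  by (rule continuous_imp_measurable_on_sets_lebesgue[OF w_cont]) simp

lemma measurable_M: "f \<in> borel_measurable M \<longleftrightarrow> f \<in> borel_measurable (lebesgue_on {0<..})"
  by (simp add: cev_measure_def)

lemma AE_M: "(AE x in M. P x) \<longleftrightarrow> (\<exists>N. negligible N \<and> (\<forall>x>0. x \<notin> N \<longrightarrow> P x))"
proof -
  have "(AE x in M. P x) \<longleftrightarrow> (AE x in lebesgue_on {0<..}. P x)"
    unfolding cev_measure_def using w_measurable
    by (subst AE_density) (auto simp: w_pos AE_restrict_space_iff intro!: eventually_cong)
  also have "\<dots> \<longleftrightarrow> (AE x in lebesgue. x \<in> {0<..} \<longrightarrow> P x)" by (subst AE_restrict_space_iff) auto
  also have "\<dots> \<longleftrightarrow> (\<exists>N. negligible N \<and> (\<forall>x>0. x \<notin> N \<longrightarrow> P x))"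
    unfolding eventually_ae_filter_negligible by auto
  finally show ?thesis .
qed

lemma integrable_M:
  fixes f :: "real \<Rightarrow> 'b::euclidean_space"
  assumes "f \<in> borel_measurable (lebesgue_on {0<..})"
  shows "integrable M f \<longleftrightarrow> (\<lambda>x. w x *\<^sub>R f x) absolutely_integrable_on {0<..}"
    "integral\<^sup>L M f = integral\<^sup>L (lebesgue_on {0<..}) (\<lambda>x. w x *\<^sub>R f x)"
proof -
  have ae: "AE x in lebesgue_on {0<..}. 0 \<le> w x"
    by (rule AE_I2) (auto simp: less_imp_le w_pos)
  have "integrable M f \<longleftrightarrow> integrable (lebesgue_on {0<..}) (\<lambda>x. w x *\<^sub>R f x)"
    unfolding cev_measure_def by (rule integrable_density[OF assms w_measurable ae])
  then show "integrable M f \<longleftrightarrow> (\<lambda>x. w x *\<^sub>R f x) absolutely_integrable_on {0<..}"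
    by (simp add: integrable_restrict_space set_integrable_def)
  show "integral\<^sup>L M f = integral\<^sup>L (lebesgue_on {0<..}) (\<lambda>x. w x *\<^sub>R f x)"
    unfolding cev_measure_def by (rule integral_density[OF assms w_measurable ae])
qed

lemma L2_M_iff: "f \<in> L2 M \<longleftrightarrow> f \<in> borel_measurable (lebesgue_on {0<..}) \<and>
    (\<lambda>x. w x * (cmod (f x))\<^sup>2) integrable_on {0<..}"
proof -
  have "(\<lambda>x. w x * (cmod (f x))\<^sup>2) absolutely_integrable_on {0<..} \<longleftrightarrow> (\<lambda>x. w x * (cmod (f x))\<^sup>2) integrable_on {0<..}"
    by (intro absolutely_integrable_on_iff_nonneg) (auto simp: w_pos less_imp_le)
  moreover have "(\<lambda>x. (cmod (f x))\<^sup>2) \<in> borel_measurable (lebesgue_on {0<..})" if "f \<in> borel_measurable (lebesgue_on {0<..})"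
    using that by simp
  ultimately show ?thesis
    unfolding L2_def measurable_M using integrable_M(1)[of "\<lambda>x. (cmod (f x))\<^sup>2"] by auto
qed

lemma L2_inner_M:
  assumes "f \<in> L2 M" "g \<in> L2 M"
  shows "(\<lambda>x. of_real (w x) * (f x * cnj (g x))) absolutely_integrable_on {0<..}"
    "L2_inner M f g = integral {0<..} (\<lambda>x. of_real (w x) * (f x * cnj (g x)))"
proof -
  have m: "(\<lambda>x. f x * cnj (g x)) \<in> borel_measurable (lebesgue_on {0<..})"
    using assms by (intro borel_measurable_times) (auto simp: L2_M_iff)
  show 1: "(\<lambda>x. of_real (w x) * (f x * cnj (g x))) absolutely_integrable_on {0<..}"
    using integrable_M(1)[OF m] L2_inner_integrable[OF assms] by (simp add: scaleR_conv_of_real)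
  show "L2_inner M f g = integral {0<..} (\<lambda>x. of_real (w x) * (f x * cnj (g x)))"
    unfolding L2_inner_def integrable_M(2)[OF m] scaleR_conv_of_real
    by (rule lebesgue_integral_eq_integral[OF absolutely_integrable_imp_integrable[OF 1]]) auto
qed

end

section \<open>The two endpoints\<close>

lemma power_div_fact_le_exp:
  assumes "(x::real) \<ge> 0" shows "x ^ N / fact N \<le> exp x"
proof -
  have "(\<Sum>n\<in>{N}. x ^ n /\<^sub>R fact n) \<le> (\<Sum>n. x ^ n /\<^sub>R fact n)"
    by (rule sum_le_suminf[OF summable_exp_generic]) (use assms in auto)
  then show ?thesis by (simp add: exp_def divide_inverse mult.commute)
qed

text \<open>
  For large \<open>N\<close>, \<open>x\<^sup>b \<le> (x\<^sup>d)\<^sup>N\<close> on \<open>[1,\<infinity>)\<close>, and one term of the exponential series dominates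
  the right-hand side.
\<close>

lemma stretched_exponential_lower_bound:
  fixes b c d :: real
  assumes c: "c > 0" and d: "d > 0"
  obtains K where "K > 0" "\<And>x. x \<ge> 1 \<Longrightarrow> K * x powr b \<le> exp (c * x powr d)"
proof -
  obtain N :: nat where N: "b / d \<le> real N" using real_arch_simple by blast
  then have N': "b \<le> d * real N" using d by (simp add: field_simps)
  show ?thesis
  proof (rule that[of "c ^ N / fact N"])
    show "c ^ N / fact N > 0" using c by simp
    fix x :: real assume x: "x \<ge> 1"
    have "x powr b \<le> x powr (d * real N)" using x N' by (intro powr_mono) auto
    also have "\<dots> = (x powr d) ^ N" using x by (simp add: powr_powr[symmetric] powr_realpow)
    finally have "c ^ N / fact N * x powr b \<le> c ^ N / fact N * (x powr d) ^ N"
      using c by (intro mult_left_mono) auto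
    also have "\<dots> = (c * x powr d) ^ N / fact N" by (simp add: power_mult_distrib)
    also have "\<dots> \<le> exp (c * x powr d)" using c by (intro power_div_fact_le_exp) auto
    finally show "c ^ N / fact N * x powr b \<le> exp (c * x powr d)" .
  qed
qed

lemma stretched_exponential_integrable:
  fixes b c d :: real
  assumes b: "b \<ge> 0" and c: "c > 0" and d: "d > 0"
  shows "(\<lambda>x. x powr b * exp (- c * x powr d)) integrable_on {0<..}"
proof -
  obtain K where K: "K > 0" "\<And>x. x \<ge> 1 \<Longrightarrow> K * x powr (b + 2) \<le> exp (c * x powr d)"
    using stretched_exponential_lower_bound[OF c d] by blast
  have p: "(\<lambda>x::real. x powr -2) integrable_on {1..}"
    using has_integral_powr_to_inf[of "-2" 1] by (auto intro: has_integral_integrable)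
  show ?thesis
  proof (rule measurable_bounded_by_integrable_imp_integrable)
    show "(\<lambda>x. x powr b * exp (- c * x powr d)) \<in> borel_measurable (lebesgue_on {0<..})"
      by (intro continuous_imp_measurable_on_sets_lebesgue continuous_intros) auto
    have 1: "(\<lambda>x. if x \<in> {0..1::real} then (1::real) else 0) integrable_on {0<..}"
    proof -
      have "(\<lambda>x. if x \<in> {0..1::real} then (1::real) else 0) absolutely_integrable_on UNIV"
        by (subst absolutely_integrable_restrict_UNIV) (auto intro: absolutely_integrable_continuous_real)
      then show ?thesis using set_integrable_subset[of lebesgue UNIV _ "{0<..}"] set_lebesgue_integral_eq_integral(1) by fastforce
    qed
    have 2: "(\<lambda>x::real. if x \<in> {1..} then x powr -2 else 0) integrable_on {0<..}"
    proof -
      have "{1..} \<inter> {0<..} = {1::real..}" by auto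
      then show ?thesis using p unfolding integrable_restrict_Int by simp
    qed
    show "(\<lambda>x. (if x \<in> {0..1::real} then 1 else 0) + inverse K * (if x \<in> {1..} then x powr -2 else 0)) integrable_on {0<..}"
      by (intro integrable_add integrable_on_mult_right 1 2)
    fix x :: real assume x: "x \<in> {0<..}"
    show "norm (x powr b * exp (- c * x powr d)) \<le> (if x \<in> {0..1} then 1 else 0) + inverse K * (if x \<in> {1..} then x powr -2 else 0)"
    proof (cases "x \<le> 1")
      case True
      have "x powr b * exp (- c * x powr d) \<le> 1 * 1"
        using True x b c powr_mono2[of b x 1] by (intro mult_mono) auto
      moreover have "0 \<le> inverse K * (if x \<in> {1..} then x powr -2 else 0)" using K by simp
      ultimately show ?thesis using True x by simp
    next
      case False
      have e: "K * (x powr b * x powr 2) \<le> exp (c * x powr d)" using K(2)[of x] False by (simp add: powr_add)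
      have "exp (- c * x powr d) = inverse (exp (c * x powr d))" by (simp add: exp_minus)
      also have "\<dots> \<le> inverse (K * (x powr b * x powr 2))"
        using K(1) x e by (intro le_imp_inverse_le) auto
      finally have "x powr b * exp (- c * x powr d) \<le> x powr b * inverse (K * (x powr b * x powr 2))"
        by (intro mult_left_mono) auto
      also have "\<dots> = inverse K * x powr -2" using x K(1) by (simp add: powr_minus field_simps)
      finally show ?thesis using False x by simp
    qed
  qed simp
qed

context cev begin

abbreviation "\<delta> \<equiv> 2 - \<gamma>"

lemma delta_pos: "\<delta> > 0" using gamma2 by simp

definition S_lo :: "real \<Rightarrow> real" where "S_lo x = integral {0..x} scale"
definition S_hi :: "real \<Rightarrow> real" where "S_hi x = integral {x..} scale"

lemma scale_antimono: "0 \<le> x \<Longrightarrow> x \<le> y \<Longrightarrow> scale y \<le> scale x"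
  unfolding scale_def using alpha_pos sigma delta_pos by (intro mult_left_mono) (auto intro: powr_mono2)

lemma scale_le: "x \<ge> 0 \<Longrightarrow> scale x \<le> 2 / \<sigma>\<^sup>2"
  unfolding scale_def using alpha_pos sigma by (intro mult_left_le) auto

lemma scale_cont0: "continuous_on {0..} scale"
  unfolding scale_def[abs_def] using delta_pos
  by (intro continuous_intros continuous_on_powr') auto

lemma scale_integrable: "0 \<le> x \<Longrightarrow> scale integrable_on {x..y}"
  by (intro integrable_continuous_real continuous_on_subset[OF scale_cont0]) auto

lemma scale_integrable_inf: "0 < x \<Longrightarrow> scale integrable_on {x..}"
proof -
  assume x: "0 < x"
  have "(\<lambda>x. 2 / \<sigma>\<^sup>2 * (x powr 0 * exp (- \<alpha> * x powr \<delta>))) integrable_on {0<..}"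
    by (intro integrable_on_mult_right stretched_exponential_integrable alpha_pos delta_pos) auto
  then have "scale integrable_on {0<..}" by (rule integrable_eq) (simp add: scale_def)
  then have "scale absolutely_integrable_on {0<..}"
    by (intro nonnegative_absolutely_integrable_1) (auto simp: less_imp_le scale_pos)
  then have "scale absolutely_integrable_on {x..}" by (rule set_integrable_subset) (use x in auto)
  then show ?thesis by (rule set_lebesgue_integral_eq_integral(1))
qed

lemma S_lo_diff: "0 \<le> x \<Longrightarrow> x \<le> y \<Longrightarrow> S_lo y - S_lo x = integral {x..y} scale"
  unfolding S_lo_def
  using Henstock_Kurzweil_Integration.integral_combine[of 0 x y scale] scale_integrable[of 0 y] by simp

lemma S_hi_diff:
  assumes "0 < x" "x \<le> y" shows "S_hi x - S_hi y = integral {x..y} scale"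
proof -
  have "(scale has_integral (integral {x..y} scale + integral {y..} scale)) ({x..y} \<union> {y..})"
    using assms by (intro has_integral_Un integrable_integral scale_integrable scale_integrable_inf)
       (auto intro: negligible_subset[of "{y}"])
  moreover have "{x..y} \<union> {y..} = {x..}" using assms by auto
  ultimately show ?thesis by (simp add: S_hi_def integral_unique)
qed

lemma scale_integral_pos: "0 \<le> x \<Longrightarrow> x < y \<Longrightarrow> integral {x..y} scale > 0"
proof -
  assume xy: "0 \<le> x" "x < y"
  have "integral {x..y} (\<lambda>_. scale y) \<le> integral {x..y} scale"
    using xy by (intro integral_le scale_integrable scale_antimono) auto
  moreover have "integral {x..y} (\<lambda>_. scale y) > 0" using xy scale_pos[of y] by simp
  ultimately show ?thesis by linarith
qed

lemma S_deriv:
  assumes x: "x > 0"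
  shows "(S_lo has_real_derivative scale x) (at x)" "(S_hi has_real_derivative - scale x) (at x)"
proof -
  have lo: "(S_lo has_real_derivative scale x) (at x)" if "x > 0" for x
  proof -
    have "((\<lambda>u. integral {0..u} scale) has_real_derivative scale x) (at x within {0..x+1})"
      by (rule integral_has_real_derivative[OF continuous_on_subset[OF scale_cont0]]) (use that in auto)
    then show ?thesis
      using that at_within_interior[of x "{0..x+1}"] by (simp add: S_lo_def[abs_def])
  qed
  show "(S_lo has_real_derivative scale x) (at x)" by (rule lo[OF x])
  have eq: "S_hi y = (S_hi (x/2) + S_lo (x/2)) - S_lo y" if "y > x / 2" for y
    using that x S_hi_diff[of "x/2" y] S_lo_diff[of "x/2" y] by simp
  have "((\<lambda>y. (S_hi (x/2) + S_lo (x/2)) - S_lo y) has_real_derivative - scale x) (at x)"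
    using lo[OF x] by (auto intro!: derivative_eq_intros)
  then show "(S_hi has_real_derivative - scale x) (at x)"
    by (rule has_field_derivative_transform_within_open[where S = "{x/2<..}"]) (use x eq in auto)
qed

lemma S_cont: "continuous_on {0<..} S_lo" "continuous_on {0<..} S_hi"
  using S_deriv by (auto intro!: continuous_at_imp_continuous_on intro: DERIV_isCont)

lemma S_lo_bounds: "x > 0 \<Longrightarrow> 0 < S_lo x" "x \<ge> 0 \<Longrightarrow> S_lo x \<le> 2 / \<sigma>\<^sup>2 * x"
proof -
  show "x > 0 \<Longrightarrow> 0 < S_lo x" unfolding S_lo_def by (intro scale_integral_pos) auto
  assume "x \<ge> 0"
  then have "S_lo x \<le> integral {0..x} (\<lambda>_. 2 / \<sigma>\<^sup>2)"
    unfolding S_lo_def by (intro integral_le scale_integrable scale_le) auto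
  then show "S_lo x \<le> 2 / \<sigma>\<^sup>2 * x" using \<open>x \<ge> 0\<close> by (simp add: mult.commute)
qed

lemma S_hi_pos: "x > 0 \<Longrightarrow> 0 < S_hi x"
proof -
  assume x: "x > 0"
  have "S_hi (x + 1) \<ge> 0"
    unfolding S_hi_def using x scale_integrable_inf[of "x+1"] scale_pos
    by (intro Henstock_Kurzweil_Integration.integral_nonneg) (auto simp: less_imp_le)
  then show ?thesis using S_hi_diff[of x "x + 1"] scale_integral_pos[of x "x+1"] x by simp
qed

text \<open>
  For \<open>t \<ge> x\<close> three quarters of the exponent of the scale density can be evaluated at \<open>x\<close>, and the
  remaining quarter keeps the integral finite.  More than one half is needed, since \<open>S\<^sup>2\<close> is
  compared with \<open>m \<approx> e\<^sup>y\<close>.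
\<close>

lemma S_hi_bound:
  obtains C where "C \<ge> 0" "\<And>x. x > 0 \<Longrightarrow> S_hi x \<le> C * exp (- (3/4 * \<alpha>) * x powr \<delta>)"
proof -
  define h where "h t = 2 / \<sigma>\<^sup>2 * (t powr 0 * exp (- (\<alpha> / 4) * t powr \<delta>))" for t
  have h: "h integrable_on {0<..}"
    unfolding h_def[abs_def] using alpha_pos
    by (intro integrable_on_mult_right stretched_exponential_integrable delta_pos) auto
  have h0: "h t \<ge> 0" for t by (simp add: h_def)
  define C where "C = integral {0<..} h"
  have C0: "C \<ge> 0" unfolding C_def by (intro Henstock_Kurzweil_Integration.integral_nonneg h h0)
  have "S_hi x \<le> C * exp (- (3/4 * \<alpha>) * x powr \<delta>)" if x: "x > 0" for x
  proof -
    define a where "a = exp (- (3/4 * \<alpha>) * x powr \<delta>)"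
    have "h absolutely_integrable_on {0<..}" using h h0 by (intro nonnegative_absolutely_integrable_1) auto
    then have "h absolutely_integrable_on {x..}" by (rule set_integrable_subset) (use x in auto)
    then have hx: "h integrable_on {x..}" by (rule set_lebesgue_integral_eq_integral(1))
    have "S_hi x \<le> integral {x..} (\<lambda>t. a * h t)"
      unfolding S_hi_def
    proof (rule integral_le[OF scale_integrable_inf[OF x] integrable_on_mult_right[OF hx]])
      fix t assume t: "t \<in> {x..}"
      have "x powr \<delta> \<le> t powr \<delta>" using t x delta_pos by (intro powr_mono2) auto
      then have "\<alpha> * x powr \<delta> \<le> \<alpha> * t powr \<delta>" using alpha_pos by (intro mult_left_mono) auto
      then have "exp (- \<alpha> * t powr \<delta>) \<le> exp (- (3/4 * \<alpha>) * x powr \<delta>) * exp (- (\<alpha> / 4) * t powr \<delta>)"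
        unfolding exp_add[symmetric] by simp
      then have "2 / \<sigma>\<^sup>2 * exp (- \<alpha> * t powr \<delta>) \<le> 2 / \<sigma>\<^sup>2 * (a * exp (- (\<alpha> / 4) * t powr \<delta>))"
        unfolding a_def by (intro mult_left_mono) auto
      then show "scale t \<le> a * h t" using t x by (simp add: scale_def h_def mult_ac)
    qed
    also have "\<dots> = a * integral {x..} h" by simp
    also have "\<dots> \<le> a * C"
      unfolding C_def using x h hx h0 by (intro mult_left_mono integral_subset_le) (auto simp: a_def)
    finally show ?thesis by (simp add: a_def mult.commute)
  qed
  with C0 that show ?thesis by blast
qed

text \<open>
The speed density of the diffusion.
\<close>

definition m :: "real \<Rightarrow> real" where "m x = inverse (w x)"

lemma m_eq: "m x = x powr (- \<gamma>) * exp (\<alpha> * x powr \<delta>)"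
  by (simp add: m_def w_eq powr_minus exp_minus)

lemma m_pos: "x > 0 \<Longrightarrow> m x > 0" using w_pos by (simp add: m_def)

lemma m_cont: "continuous_on {0<..} m"
  unfolding m_def[abs_def] by (intro continuous_intros w_cont) (use w_pos in force)

text \<open>
  At infinity the decaying solution is \<open>S_hi x\<close>, the integral of the scale density over \<open>[x,\<infinity>)\<close>,
  while \<open>m\<close> itself grows like \<open>e\<^sup>y\<close>.
\<close>

sublocale at_inf: singular_endpoint "{1..}" 1 "\<lambda>n. real n + 1" m S_hi
proof
  show "continuous_on {1..} m" "continuous_on {1..} S_hi"
    by (rule continuous_on_subset[OF m_cont] continuous_on_subset[OF S_cont(2)]; force)+
  show "\<exists>y\<in>{1..}. x < y" if "x \<in> {1..}" for x :: real
    using that by (intro bexI[of _ "x + 1"]) auto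
  show "incseq (\<lambda>n. real n + 1)" by (simp add: incseq_def)
  show "\<exists>n. x \<le> real n + 1" for x :: real
  proof -
    obtain n :: nat where "x \<le> real n" using real_arch_simple by blast
    then show ?thesis by (intro exI[of _ n]) simp
  qed
  show "S_hi y \<le> S_hi x" if "x \<in> {1..}" "x \<le> y" for x y
    using that S_hi_diff[of x y] scale_integral_pos[of x y] by (cases "x = y") auto
  obtain C where C: "C \<ge> 0" "\<And>x. x > 0 \<Longrightarrow> S_hi x \<le> C * exp (- (3/4 * \<alpha>) * x powr \<delta>)"
    using S_hi_bound by blast
  show "(\<lambda>n. S_hi (real n + 1)) \<longlonglongrightarrow> 0"
  proof (rule tendsto_sandwich[OF _ _ tendsto_const])
    have "((\<lambda>n::nat. exp (- (3/4 * \<alpha>) * (real n + 1) powr \<delta>)) \<longlongrightarrow> 0) sequentially"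
      using alpha_pos delta_pos by real_asymp
    then show "(\<lambda>n. C * exp (- (3/4 * \<alpha>) * (real n + 1) powr \<delta>)) \<longlonglongrightarrow> 0"
      using tendsto_mult_right_zero by blast
    show "\<forall>\<^sub>F n in sequentially. S_hi (real n + 1) \<le> C * exp (- (3/4 * \<alpha>) * (real n + 1) powr \<delta>)"
      using C(2) by (intro always_eventually) (metis of_nat_0_le_iff add_nonneg_pos zero_less_one)
    show "\<forall>\<^sub>F n in sequentially. 0 \<le> S_hi (real n + 1)"
      by (intro always_eventually allI less_imp_le S_hi_pos) simp
  qed
  show "(\<lambda>t. (S_hi t)\<^sup>2 * m t) integrable_on {1..}"
  proof (rule measurable_bounded_by_integrable_imp_integrable)
    show "(\<lambda>t. (S_hi t)\<^sup>2 * m t) \<in> borel_measurable (lebesgue_on {1..})"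
      by (intro continuous_imp_measurable_on_sets_lebesgue continuous_intros
          continuous_on_subset[OF m_cont] continuous_on_subset[OF S_cont(2)]) auto
    have "(\<lambda>t. C\<^sup>2 * (t powr 0 * exp (- (\<alpha> / 2) * t powr \<delta>))) absolutely_integrable_on {0<..}"
      using alpha_pos by (intro nonnegative_absolutely_integrable_1 integrable_on_mult_right stretched_exponential_integrable delta_pos) auto
    then have "(\<lambda>t. C\<^sup>2 * (t powr 0 * exp (- (\<alpha> / 2) * t powr \<delta>))) absolutely_integrable_on {1..}"
      by (rule set_integrable_subset) auto
    then show "(\<lambda>t. C\<^sup>2 * (t powr 0 * exp (- (\<alpha> / 2) * t powr \<delta>))) integrable_on {1..}"
      by (rule set_lebesgue_integral_eq_integral(1))
    fix t :: real assume t: "t \<in> {1..}"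
    have "t powr (- \<gamma>) \<le> 1" using t gamma1 powr_mono[of "- \<gamma>" 0 t] by simp
    then have mt: "m t \<le> exp (\<alpha> * t powr \<delta>)" unfolding m_eq by (simp add: mult_left_le_one_le)
    have "(S_hi t)\<^sup>2 \<le> (C * exp (- (3/4 * \<alpha>) * t powr \<delta>))\<^sup>2"
      using t S_hi_pos[of t] C(2)[of t] by (intro power_mono) auto
    then have "(S_hi t)\<^sup>2 * m t \<le> (C * exp (- (3/4 * \<alpha>) * t powr \<delta>))\<^sup>2 * exp (\<alpha> * t powr \<delta>)"
      using mt m_pos[of t] t by (intro mult_mono) auto
    also have "\<dots> = C\<^sup>2 * exp (- (\<alpha> / 2) * t powr \<delta>)"
      by (simp add: power2_eq_square mult_ac flip: exp_add)
    finally show "norm ((S_hi t)\<^sup>2 * m t) \<le> C\<^sup>2 * (t powr 0 * exp (- (\<alpha> / 2) * t powr \<delta>))"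
      using t m_pos[of t] by simp
  qed simp
  show "\<not> m integrable_on {1..}"
  proof
    assume int: "m integrable_on {1..}"
    obtain K where K: "K > 0" "\<And>x. x \<ge> 1 \<Longrightarrow> K * x powr \<gamma> \<le> exp (\<alpha> * x powr \<delta>)"
      using stretched_exponential_lower_bound[OF alpha_pos delta_pos] by blast
    have mK: "K \<le> m x" if "x \<ge> 1" for x
    proof -
      have "K = x powr (- \<gamma>) * (K * x powr \<gamma>)" using that by (simp add: powr_minus)
      also have "\<dots> \<le> m x" unfolding m_eq by (intro mult_left_mono K(2) that) simp
      finally show ?thesis .
    qed
    have "K * (b - 1) \<le> integral {1..} m" if "b \<ge> 1" for b
    proof -
      have mb: "m integrable_on {1..b}"
        by (intro integrable_continuous_real continuous_on_subset[OF m_cont]) auto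
      have "K * (b - 1) = integral {1..b} (\<lambda>_. K)" using that by simp
      also have "\<dots> \<le> integral {1..b} m" using mK mb by (intro integral_le) auto
      also have "\<dots> \<le> integral {1..} m" using mK K(1) mb int by (intro integral_subset_le) (auto intro: order_trans less_imp_le)
      finally show ?thesis .
    qed
    from this[of "1 + (\<bar>integral {1..} m\<bar> + 1) / K"] show False using K(1) by simp
  qed
qed (auto simp: m_pos S_hi_pos)

text \<open>
  The endpoint \<open>0\<close> is moved to the right end of an interval by the reflection \<open>t = - x\<close>.  Here
  \<open>\<gamma> \<ge> 1\<close> enters: it makes \<open>m \<approx> x\<^sup>-\<^sup>\<gamma>\<close> non-integrable at \<open>0\<close>.
\<close>

sublocale at_zero: singular_endpoint "{-1..<0}" "-1" "\<lambda>n. - inverse (real n + 1)" "\<lambda>t. m (- t)" "\<lambda>t. S_lo (- t)"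
proof
  show "continuous_on {-1..<0} (\<lambda>t. m (- t))" "continuous_on {-1..<0} (\<lambda>t. S_lo (- t))"
    by (rule continuous_on_compose2[OF m_cont] continuous_on_compose2[OF S_cont(1)]; force intro!: continuous_intros)+
  show "\<exists>y\<in>{-1..<0}. x < y" if "x \<in> {-1..<0}" for x :: real
    using that by (intro bexI[of _ "x / 2"]) auto
  show "- inverse (real n + 1) \<in> {-1..<0}" for n by (auto simp: inverse_le_1_iff)
  show "incseq (\<lambda>n. - inverse (real n + 1))" unfolding incseq_def by (auto intro!: le_imp_inverse_le)
  show "\<exists>n. x \<le> - inverse (real n + 1)" if "x \<in> {-1..<0}" for x :: real
  proof -
    have "0 < - x" using that by simp
    then obtain n where "inverse (real (Suc n)) < - x" using reals_Archimedean by blast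
    then show ?thesis by (intro exI[of _ n]) (simp add: add.commute)
  qed
  show "S_lo (- y) \<le> S_lo (- x)" if "x \<in> {-1..<0}" "y \<in> {-1..<0}" "x \<le> y" for x y
    using that S_lo_diff[of "-y" "-x"] scale_integral_pos[of "-y" "-x"] by (cases "x = y") auto
  show "(\<lambda>n. S_lo (- (- inverse (real n + 1)))) \<longlonglongrightarrow> 0"
  proof (rule tendsto_sandwich[OF _ _ tendsto_const])
    have "((\<lambda>n::nat. inverse (real n + 1)) \<longlongrightarrow> 0) sequentially" by real_asymp
    then show "(\<lambda>n. 2 / \<sigma>\<^sup>2 * inverse (real n + 1)) \<longlonglongrightarrow> 0"
      using tendsto_mult_right_zero by blast
    show "\<forall>\<^sub>F n in sequentially. S_lo (- (- inverse (real n + 1))) \<le> 2 / \<sigma>\<^sup>2 * inverse (real n + 1)"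
      using S_lo_bounds(2)[of "inverse (real _ + 1)"] by (intro always_eventually) simp
    show "\<forall>\<^sub>F n in sequentially. 0 \<le> S_lo (- (- inverse (real n + 1)))"
      by (intro always_eventually allI less_imp_le S_lo_bounds) simp
  qed
  show "(\<lambda>t. (S_lo (- t))\<^sup>2 * m (- t)) integrable_on {-1..<0}"
  proof (rule measurable_bounded_by_integrable_imp_integrable)
    show "(\<lambda>t. (S_lo (- t))\<^sup>2 * m (- t)) \<in> borel_measurable (lebesgue_on {-1..<0})"
      by (intro continuous_imp_measurable_on_sets_lebesgue continuous_intros
          continuous_on_compose2[OF m_cont] continuous_on_compose2[OF S_cont(1)]) auto
    show "(\<lambda>t::real. (2 / \<sigma>\<^sup>2)\<^sup>2 * exp \<alpha>) integrable_on {-1..<0}"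
    proof -
      have "bounded {-1..<0::real}" by (rule bounded_subset[of "{-1..0}"]) auto
      then show ?thesis by (intro integrable_on_const bounded_set_imp_lmeasurable) simp_all
    qed
    fix t :: real assume "t \<in> {-1..<0}"
    then have x: "0 < - t" "- t \<le> 1" by auto
    have "(S_lo (- t))\<^sup>2 \<le> (2 / \<sigma>\<^sup>2 * (- t))\<^sup>2"
      using x S_lo_bounds(1)[of "-t"] S_lo_bounds(2)[of "-t"] by (intro power_mono) auto
    then have "(S_lo (- t))\<^sup>2 * m (- t) \<le> (2 / \<sigma>\<^sup>2 * (- t))\<^sup>2 * m (- t)"
      using m_pos[of "-t"] x by (intro mult_right_mono) auto
    also have "\<dots> = (2 / \<sigma>\<^sup>2)\<^sup>2 * ((- t) powr (2 - \<gamma>) * exp (\<alpha> * (- t) powr \<delta>))"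
      using x unfolding m_eq power_mult_distrib by (simp add: powr_diff powr_minus divide_inverse)
    also have "\<dots> \<le> (2 / \<sigma>\<^sup>2)\<^sup>2 * (1 * exp \<alpha>)"
      using x alpha_pos delta_pos powr_mono2[of \<delta> "-t" 1]
      by (intro mult_left_mono mult_mono) (auto intro: mult_left_le)
    finally show "norm ((S_lo (- t))\<^sup>2 * m (- t)) \<le> (2 / \<sigma>\<^sup>2)\<^sup>2 * exp \<alpha>"
      using m_pos[of "-t"] x by simp
  qed simp
  show "\<not> (\<lambda>t. m (- t)) integrable_on {-1..<0}"
  proof
    assume int: "(\<lambda>t. m (- t)) integrable_on {-1..<0}"
    have mx: "inverse x \<le> m x" if "0 < x" "x \<le> 1" for x
    proof -
      have "inverse x = x powr (-1) * 1" using that by (simp add: powr_minus)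
      also have "\<dots> \<le> m x" unfolding m_eq using that gamma1 alpha_pos
        by (intro mult_mono powr_mono') auto
      finally show ?thesis .
    qed
    have "- ln b \<le> integral {-1..<0} (\<lambda>t. m (- t))" if b: "0 < b" "b \<le> 1" for b
    proof -
      have mb: "(\<lambda>t. m (- t)) integrable_on {-1..-b}"
        by (intro integrable_continuous_real continuous_on_compose2[OF m_cont] continuous_intros) (use b in auto)
      have "((\<lambda>t. inverse (- t)) has_integral (- ln (- (- b)) - - ln (- (-1)))) {-1..-b}"
        using b by (intro fundamental_theorem_of_calculus)
          (auto intro!: derivative_eq_intros simp: has_real_derivative_iff_has_vector_derivative[symmetric] divide_inverse)
      then have l: "((\<lambda>t. inverse (- t)) has_integral (- ln b)) {-1..-b}" by simp
      have "- ln b = integral {-1..-b} (\<lambda>t. inverse (- t))" using integral_unique[OF l] by (rule sym)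
      also have "\<dots> \<le> integral {-1..-b} (\<lambda>t. m (- t))"
      proof (rule integral_le[OF has_integral_integrable[OF l] mb])
        fix t assume "t \<in> {-1..-b}"
        then show "inverse (- t) \<le> m (- t)" using mx[of "-t"] b by auto
      qed
      also have "\<dots> \<le> integral {-1..<0} (\<lambda>t. m (- t))"
        by (intro integral_subset_le mb int) (use b m_pos in \<open>auto simp: less_imp_le\<close>)
      finally show ?thesis .
    qed
    moreover have "exp (- (\<bar>integral {-1..<0} (\<lambda>t. m (- t))\<bar> + 1)) \<le> 1" by simp
    ultimately have "- ln (exp (- (\<bar>integral {-1..<0} (\<lambda>t. m (- t))\<bar> + 1))) \<le> integral {-1..<0} (\<lambda>t. m (- t))"
      using exp_gt_zero by blast
    then show False unfolding ln_exp by linarith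
  qed
qed (auto simp: m_pos S_lo_bounds)


text \<open>
  \<open>(u, J, k)\<close> solves the system, and \<open>u\<close>, \<open>k\<close> have finite norms; these are the norms of \<open>p = u / w\<close> and
  \<open>k\<close> in \<open>L\<^sup>2\<close> with weight \<open>w\<close>.
\<close>

definition canonical_triple :: "(real \<Rightarrow> complex) \<Rightarrow> (real \<Rightarrow> complex) \<Rightarrow> (real \<Rightarrow> complex) \<Rightarrow> bool" where
  "canonical_triple u J k \<longleftrightarrow> primitive_of k J \<and> primitive_of (\<lambda>x. of_real (scale x) * J x) u \<and>
     (\<lambda>x. (cmod (u x))\<^sup>2 * m x) integrable_on {0<..} \<and> (\<lambda>x. (cmod (k x))\<^sup>2 / m x) integrable_on {0<..}"

lemma Dmax_L2: "p \<in> Dmax \<Longrightarrow> p \<in> L2 M" "p \<in> Dmax \<Longrightarrow> expr p \<in> L2 M"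
  by (auto simp: cev_Dmax_def)

lemma Dmax_canonical_triple:
  assumes p: "p \<in> Dmax"
  shows "canonical_triple (\<lambda>x. of_real (w x) * p x) (flux p) (expr p)"
proof -
  have 1: "(\<lambda>x. (cmod (of_real (w x) * p x))\<^sup>2 * m x) integrable_on {0<..}"
  proof (rule integrable_eq)
    show "(\<lambda>x. w x * (cmod (p x))\<^sup>2) integrable_on {0<..}" using Dmax_L2(1)[OF p] by (simp add: L2_M_iff)
    show "w x * (cmod (p x))\<^sup>2 = (cmod (of_real (w x) * p x))\<^sup>2 * m x" if "x \<in> {0<..}" for x
      using that w_pos[of x] by (simp add: m_def norm_mult power_mult_distrib) (simp add: power2_eq_square)
  qed
  have 2: "(\<lambda>x. (cmod (expr p x))\<^sup>2 / m x) integrable_on {0<..}"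
  proof (rule integrable_eq)
    show "(\<lambda>x. w x * (cmod (expr p x))\<^sup>2) integrable_on {0<..}" using Dmax_L2(2)[OF p] by (simp add: L2_M_iff)
    show "w x * (cmod (expr p x))\<^sup>2 = (cmod (expr p x))\<^sup>2 / m x" if "x \<in> {0<..}" for x
      by (simp add: m_def divide_inverse mult.commute)
  qed
  show ?thesis unfolding canonical_triple_def using 1 2 Dmax_primitives[OF p] by blast
qed

lemma canonical_triple_cnj:
  assumes "canonical_triple u J k" shows "canonical_triple (\<lambda>x. cnj (u x)) (\<lambda>x. cnj (J x)) (\<lambda>x. cnj (k x))"
  using assms primitive_of_cnj[of k J] primitive_of_cnj[of "\<lambda>x. of_real (scale x) * J x" u]
  by (simp add: canonical_triple_def)

lemma canonical_triple_wronskian: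
  assumes u: "canonical_triple u J k" and v: "canonical_triple v L l"
  shows "primitive_of (\<lambda>x. u x * l x - k x * v x) (\<lambda>x. u x * L x - J x * v x)"
proof -
  have 1: "primitive_of (\<lambda>x. u x * l x + of_real (scale x) * J x * L x) (\<lambda>x. u x * L x)"
    using primitive_of_mult[of _ u l L] u v by (simp add: canonical_triple_def)
  have 2: "primitive_of (\<lambda>x. J x * (of_real (scale x) * L x) + k x * v x) (\<lambda>x. J x * v x)"
    using primitive_of_mult[of k J _ v] u v by (simp add: canonical_triple_def)
  from primitive_of_linear[OF 1 2, of 1 "-1"] show ?thesis by (simp add: algebra_simps)
qed

lemma canonical_triple_boundary_primitives:
  assumes u: "canonical_triple u J k"
  shows "primitive_of (\<lambda>x. of_real (S_hi x) * k x) (\<lambda>x. u x + of_real (S_hi x) * J x)"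
    "primitive_of (\<lambda>x. - (of_real (S_lo x) * k x)) (\<lambda>x. u x - of_real (S_lo x) * J x)"
proof -
  have hi: "primitive_of (\<lambda>x. of_real (- scale x)) (\<lambda>x. of_real (S_hi x))"
    and lo: "primitive_of (\<lambda>x. of_real (scale x)) (\<lambda>x. of_real (S_lo x))"
    by (intro primitive_real S_deriv continuous_intros scale_cont; assumption)+
  have J: "primitive_of k J" and u': "primitive_of (\<lambda>x. of_real (scale x) * J x) u" using u by (auto simp: canonical_triple_def)
  show "primitive_of (\<lambda>x. of_real (S_hi x) * k x) (\<lambda>x. u x + of_real (S_hi x) * J x)"
    using primitive_of_linear[OF u' primitive_of_mult[OF hi J], of 1 1] by (simp add: algebra_simps)
  show "primitive_of (\<lambda>x. - (of_real (S_lo x) * k x)) (\<lambda>x. u x - of_real (S_lo x) * J x)"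
    using primitive_of_linear[OF u' primitive_of_mult[OF lo J], of 1 "-1"] by (simp add: algebra_simps)
qed

lemma integrable_on_subset_nonneg:
  fixes f :: "real \<Rightarrow> real"
  assumes "f integrable_on S" "\<And>x. x \<in> S \<Longrightarrow> f x \<ge> 0" "T \<subseteq> S" "T \<in> sets lebesgue"
  shows "f integrable_on T"
  using set_integrable_subset[OF nonnegative_absolutely_integrable_1[OF assms(1,2)] assms(4,3)]
  by (auto intro: set_lebesgue_integral_eq_integral(1))

lemma canonical_triple_end_inf:
  assumes u: "canonical_triple u J k" shows "at_inf.end_triple u J k"
  unfolding at_inf.end_triple_def
proof (intro conjI ballI impI)
  have J: "primitive_of k J" and u': "primitive_of (\<lambda>x. of_real (scale x) * J x) u" using u by (auto simp: canonical_triple_def)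
  show "continuous_on {1..} u" by (rule continuous_on_subset[OF primitive_of_continuous[OF u']]) auto
  show "k \<in> borel_measurable (lebesgue_on {1..})"
    by (rule measurable_restrict_mono[OF primitive_of_measurable[OF J]]) auto
  show "(\<lambda>t. (cmod (u t))\<^sup>2 * m t) integrable_on {1..}" "(\<lambda>t. (cmod (k t))\<^sup>2 / m t) integrable_on {1..}"
    using u m_pos unfolding canonical_triple_def by (auto intro!: integrable_on_subset_nonneg[of _ "{0<..}"] simp: less_imp_le)
  fix x y :: real assume xy: "x \<in> {1..}" "x \<le> y"
  show "(k has_integral J y - J x) {x..y}" using xy by (intro primitive_ofD(4)[OF J]) auto
  show "((\<lambda>t. of_real (S_hi t) * k t) has_integral u y + of_real (S_hi y) * J y - (u x + of_real (S_hi x) * J x)) {x..y}"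
    using xy by (intro primitive_ofD(4)[OF canonical_triple_boundary_primitives(1)[OF u]]) auto
qed

lemma has_integral_reflect:
  fixes f :: "real \<Rightarrow> 'b::euclidean_space"
  assumes "(f has_integral i) {-y..-x}"
  shows "((\<lambda>t. f (- t)) has_integral i) {x..y}"
  using has_integral_reflect_real[of "\<lambda>t. f (- t)" i y x] assms by simp

lemma integrable_reflect_zero:
  fixes f :: "real \<Rightarrow> real"
  assumes "f integrable_on {0<..}" "\<And>x. x \<in> {0<..} \<Longrightarrow> f x \<ge> 0"
  shows "(\<lambda>t. f (- t)) integrable_on {-1..<0}"
proof -
  have "f integrable_on {0<..1}" by (rule integrable_on_subset_nonneg[OF assms]) auto
  then have "(\<lambda>x. if x \<in> {0<..1} then f x else 0) integrable_on {0..1}"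
    unfolding integrable_restrict_Int by (simp add: Int_absorb2 greaterThanAtMost_subseteq_atLeastAtMost_iff)
  then obtain i where "((\<lambda>x. if x \<in> {0<..1} then f x else 0) has_integral i) {-0..-(-1)}"
    unfolding integrable_on_def by auto
  from has_integral_integrable[OF has_integral_reflect[OF this]]
  have "(\<lambda>t. if - t \<in> {0<..1} then f (- t) else 0) integrable_on {-1..0}" .
  then have "(\<lambda>t. if t \<in> {-1..<0} then f (- t) else 0) integrable_on {-1..0}"
    by (rule integrable_eq) auto
  then have "(\<lambda>t. f (- t)) integrable_on ({-1..<0} \<inter> {-1..0})" unfolding integrable_restrict_Int .
  moreover have "{-1..<0} \<inter> {-1..0} = {-1..<0::real}" by auto
  ultimately show ?thesis by simp
qed

text \<open>
  Under \<open>t = - x\<close> the flux changes sign, so that the system keeps its form.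
\<close>

lemma canonical_triple_end_zero:
  assumes u: "canonical_triple u J k" shows "at_zero.end_triple (\<lambda>t. u (- t)) (\<lambda>t. - J (- t)) (\<lambda>t. k (- t))"
  unfolding at_zero.end_triple_def
proof (intro conjI ballI impI)
  have J: "primitive_of k J" and u': "primitive_of (\<lambda>x. of_real (scale x) * J x) u" using u by (auto simp: canonical_triple_def)
  show "continuous_on {-1..<0} (\<lambda>t. u (- t))"
    by (rule continuous_on_compose2[OF primitive_of_continuous[OF u']]) (auto intro!: continuous_intros)
  have km: "(\<lambda>x. if x \<in> {0<..} then k x else 0) \<in> borel_measurable lebesgue"
    using primitive_of_measurable[OF J] by (subst borel_measurable_if) auto
  show "(\<lambda>t. k (- t)) \<in> borel_measurable (lebesgue_on {-1..<0})"
  proof -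
    have "(\<lambda>t. if - t \<in> {0<..} then k (- t) else 0) \<in> borel_measurable lebesgue"
    proof -
      have eq: "(*\<^sub>R) (- 1) = (uminus :: real \<Rightarrow> real)" by (rule ext) simp
      have "uminus \<in> lebesgue \<rightarrow>\<^sub>M (lebesgue :: real measure)"
        by (rule subst[OF eq, of "\<lambda>h. h \<in> lebesgue \<rightarrow>\<^sub>M lebesgue"]) (rule lebesgue_measurable_scaling)
      from measurable_compose[OF this km] show ?thesis .
    qed
    then have "(\<lambda>t. if t \<in> {..<0} then k (- t) else 0) \<in> borel_measurable lebesgue" by simp
    then have "(\<lambda>t. k (- t)) \<in> borel_measurable (lebesgue_on {..<0})" by (subst (asm) borel_measurable_if) auto
    then show ?thesis by (rule measurable_restrict_mono) auto
  qed
  show "(\<lambda>t. (cmod (u (- t)))\<^sup>2 * m (- t)) integrable_on {-1..<0}" "(\<lambda>t. (cmod (k (- t)))\<^sup>2 / m (- t)) integrable_on {-1..<0}"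
    using u m_pos unfolding canonical_triple_def
    by (auto intro!: integrable_reflect_zero[of "\<lambda>t. (cmod (u t))\<^sup>2 * m t"] integrable_reflect_zero[of "\<lambda>t. (cmod (k t))\<^sup>2 / m t"] simp: less_imp_le)
  fix x y :: real assume xy: "x \<in> {-1..<0}" "y \<in> {-1..<0}" "x \<le> y"
  have "(k has_integral (- J (- y) - - J (- x))) {-y..-x}"
    using primitive_ofD(4)[OF J, of "-y" "-x"] xy by simp
  then show "((\<lambda>t. k (- t)) has_integral (- J (- y) - - J (- x))) {x..y}" by (rule has_integral_reflect)
  have "((\<lambda>t. of_real (S_lo t) * k t) has_integral - ((u (- x) - of_real (S_lo (- x)) * J (- x)) - (u (- y) - of_real (S_lo (- y)) * J (- y)))) {-y..-x}"
    using has_integral_neg[OF primitive_ofD(4)[OF canonical_triple_boundary_primitives(2)[OF u], of "-y" "-x"]] xy by simp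
  from has_integral_reflect[OF this]
  show "((\<lambda>t. of_real (S_lo (- t)) * k (- t)) has_integral u (- y) + of_real (S_lo (- y)) * - J (- y) - (u (- x) + of_real (S_lo (- x)) * - J (- x))) {x..y}"
    by (simp add: algebra_simps)
qed

theorem canonical_triple_wronskian_limits:
  assumes u: "canonical_triple u J k" and v: "canonical_triple v L l"
  shows "((\<lambda>x. u x * L x - J x * v x) \<longlongrightarrow> 0) at_top"
    "((\<lambda>x. u x * L x - J x * v x) \<longlongrightarrow> 0) (at_right 0)"
proof -
  note W = canonical_triple_wronskian[OF u v]
  have "((\<lambda>x. u x * L x - J x * v x) \<longlongrightarrow> 0) at_inf.endpoint"
    by (rule at_inf.wronskian_tendsto[OF canonical_triple_end_inf[OF u] canonical_triple_end_inf[OF v]])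
       (rule primitive_ofD(4)[OF W]; simp)
  then show "((\<lambda>x. u x * L x - J x * v x) \<longlongrightarrow> 0) at_top"
  proof (rule filterlim_mono[OF _ order_refl])
    show "at_top \<le> at_inf.endpoint"
    proof (rule filter_leI)
      fix P :: "real \<Rightarrow> bool" assume "eventually P at_inf.endpoint"
      then obtain x where "x \<ge> 1" "\<And>t. t \<ge> 1 \<Longrightarrow> x \<le> t \<Longrightarrow> P t"
        unfolding at_inf.eventually_endpoint by auto
      then show "eventually P at_top"
        unfolding eventually_at_top_linorder by (intro exI[of _ x]) auto
    qed
  qed
  have "((\<lambda>t. u (- t) * (- L (- t)) - (- J (- t)) * v (- t)) \<longlongrightarrow> 0) at_zero.endpoint"
  proof (rule at_zero.wronskian_tendsto[OF canonical_triple_end_zero[OF u] canonical_triple_end_zero[OF v]])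
    fix x y :: real assume xy: "x \<in> {-1..<0}" "y \<in> {-1..<0}" "x \<le> y"
    have "((\<lambda>x. u x * l x - k x * v x) has_integral (u (- x) * L (- x) - J (- x) * v (- x) - (u (- y) * L (- y) - J (- y) * v (- y)))) {-y..-x}"
      by (rule primitive_ofD(4)[OF W]) (use xy in auto)
    from has_integral_reflect[OF this]
    show "((\<lambda>t. u (- t) * l (- t) - k (- t) * v (- t)) has_integral
       u (- y) * - L (- y) - - J (- y) * v (- y) - (u (- x) * - L (- x) - - J (- x) * v (- x))) {x..y}"
      by (simp add: algebra_simps)
  qed
  from tendsto_minus[OF this] have z: "((\<lambda>t. u (- t) * L (- t) - J (- t) * v (- t)) \<longlongrightarrow> 0) at_zero.endpoint"
    by (simp add: algebra_simps)
  show "((\<lambda>x. u x * L x - J x * v x) \<longlongrightarrow> 0) (at_right 0)"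
  proof (rule tendstoI)
    fix e :: real assume "e > 0"
    then have "\<forall>\<^sub>F t in at_zero.endpoint. dist (u (- t) * L (- t) - J (- t) * v (- t)) 0 < e" by (rule tendstoD[OF z])
    then obtain t0 where t0: "t0 \<in> {-1..<0}" "\<And>t. t \<in> {-1..<0} \<Longrightarrow> t0 \<le> t \<Longrightarrow> dist (u (- t) * L (- t) - J (- t) * v (- t)) 0 < e"
      unfolding at_zero.eventually_endpoint by blast
    have "dist (u x * L x - J x * v x) 0 < e" if "0 < x" "x < - t0" for x
      using t0(2)[of "-x"] t0(1) that by simp
    then show "\<forall>\<^sub>F x in at_right 0. dist (u x * L x - J x * v x) 0 < e"
      unfolding eventually_at_right_field using t0(1) by (intro exI[of _ "- t0"]) auto
  qed
qed

theorem limit_point: "cev_limit_point \<mu> \<sigma> \<gamma> (at_right 0)" "cev_limit_point \<mu> \<sigma> \<gamma> at_top"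
  unfolding cev_limit_point_def wronskian_eq[abs_def]
  using canonical_triple_wronskian_limits[OF Dmax_canonical_triple Dmax_canonical_triple] by blast+

lemma integral_halfline_limit:
  fixes f :: "real \<Rightarrow> complex"
  assumes f: "f absolutely_integrable_on {0<..}"
  shows "(\<lambda>n. integral {inverse (real (Suc n))..real (Suc n)} f) \<longlonglongrightarrow> integral {0<..} f"
proof -
  let ?S = "\<lambda>n. {inverse (real (Suc n))..real (Suc n)}"
  have sub: "?S n \<inter> {0<..} = ?S n" for n
  proof -
    have "0 < inverse (real (Suc n))" by simp
    then have "x > 0" if "x \<in> ?S n" for x using that by (simp only: atLeastAtMost_iff) linarith
    then show ?thesis by blast
  qed
  have fi: "f integrable_on ?S n" for n
  proof -
    have "f absolutely_integrable_on ?S n"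
      by (rule set_integrable_subset[OF f]) (use sub[of n] in auto)
    then show ?thesis by (rule set_lebesgue_integral_eq_integral(1))
  qed
  have "(\<lambda>n. integral {0<..} (\<lambda>x. if x \<in> ?S n then f x else 0)) \<longlonglongrightarrow> integral {0<..} f"
  proof (rule dominated_convergence(2))
    show "(\<lambda>x. if x \<in> ?S n then f x else 0) integrable_on {0<..}" for n
      unfolding integrable_restrict_Int sub by (rule fi)
    show "(\<lambda>x. norm (f x)) integrable_on {0<..}"
      using absolutely_integrable_norm[OF f] by (auto simp: o_def intro: set_lebesgue_integral_eq_integral(1))
    show "norm (if x \<in> ?S n then f x else 0) \<le> norm (f x)" for n x by simp
    fix x :: real assume "x \<in> {0<..}"
    then have "0 < x" by simp
    then obtain N :: nat where N: "x \<in> {inverse (real (Suc N))<..<real (Suc N)}" using exhaust_halfline by blast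
    have "x \<in> ?S n" if "n \<ge> N" for n
    proof -
      have "inverse (real (Suc n)) \<le> inverse (real (Suc N))" using that by (intro le_imp_inverse_le) auto
      moreover have "real (Suc N) \<le> real (Suc n)" using that by simp
      moreover have "inverse (real (Suc N)) < x" "x < real (Suc N)"
        using N by (simp_all only: greaterThanLessThan_iff)
      ultimately show ?thesis by (simp only: atLeastAtMost_iff) linarith
    qed
    then show "(\<lambda>n. if x \<in> ?S n then f x else 0) \<longlonglongrightarrow> f x"
      by (intro tendsto_eventually eventually_sequentiallyI[of N]) simp
  qed
  then show ?thesis unfolding integral_restrict_Int sub .
qed

text \<open>
  Green's identity: the difference of the two sides is the limit of boundary values of a
  Wronskian.  Conjugation preserves the system because its coefficients are real.
\<close>

theorem Dmax_symmetric:
  assumes f: "f \<in> Dmax" and g: "g \<in> Dmax"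
  shows "L2_inner M (expr f) g = L2_inner M f (expr g)"
proof -
  note L = Dmax_L2[OF f] Dmax_L2[OF g]
  let ?u = "\<lambda>x. of_real (w x) * f x" and ?v = "\<lambda>x. cnj (of_real (w x) * g x)"
  define W where "W x = ?u x * cnj (flux g x) - flux f x * ?v x" for x
  define \<phi> where "\<phi> x = ?u x * cnj (expr g x) - expr f x * ?v x" for x
  have st: "canonical_triple ?u (flux f) (expr f)" "canonical_triple ?v (\<lambda>x. cnj (flux g x)) (\<lambda>x. cnj (expr g x))"
    using Dmax_canonical_triple[OF f] canonical_triple_cnj[OF Dmax_canonical_triple[OF g]] by simp_all
  have prim: "primitive_of \<phi> W" unfolding \<phi>_def[abs_def] W_def[abs_def] by (rule canonical_triple_wronskian[OF st])
  have lim: "(W \<longlongrightarrow> 0) at_top" "(W \<longlongrightarrow> 0) (at_right 0)"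
    unfolding W_def[abs_def] by (rule canonical_triple_wronskian_limits[OF st])+
  have phi: "\<phi> x = of_real (w x) * (f x * cnj (expr g x)) - of_real (w x) * (expr f x * cnj (g x))" for x
    by (simp add: \<phi>_def algebra_simps)
  have abs: "\<phi> absolutely_integrable_on {0<..}"
    unfolding phi[abs_def] by (intro set_integral_diff(1) L2_inner_M(1) L)
  have eq: "integral {0<..} \<phi> = L2_inner M f (expr g) - L2_inner M (expr f) g"
    unfolding phi[abs_def] L2_inner_M(2)[OF L(1,4)] L2_inner_M(2)[OF L(2,3)]
    by (intro integral_diff set_lebesgue_integral_eq_integral(1) L2_inner_M(1) L)
  have "(\<lambda>n. W (real (Suc n)) - W (inverse (real (Suc n)))) \<longlonglongrightarrow> integral {0<..} \<phi>"
  proof -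
    have "integral {inverse (real (Suc n))..real (Suc n)} \<phi> = W (real (Suc n)) - W (inverse (real (Suc n)))" for n
    proof -
      have "inverse (real (Suc n)) \<le> real (Suc n)"
        using inverse_le_1_iff[of "real (Suc n)"] by (auto intro: order_trans[of _ 1])
      then show ?thesis by (intro primitive_ofD(2)[OF prim]) simp_all
    qed
    then show ?thesis using integral_halfline_limit[OF abs] by simp
  qed
  moreover have "(\<lambda>n. W (real (Suc n)) - W (inverse (real (Suc n)))) \<longlonglongrightarrow> 0 - 0"
  proof (intro tendsto_diff)
    have "filterlim (\<lambda>n. real (Suc n)) at_top sequentially" by real_asymp
    then show "(\<lambda>n. W (real (Suc n))) \<longlonglongrightarrow> 0" by (rule filterlim_compose[OF lim(1)])
    have "filterlim (\<lambda>n. inverse (real (Suc n))) (at_right 0) sequentially" by real_asymp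
    then show "(\<lambda>n. W (inverse (real (Suc n)))) \<longlonglongrightarrow> 0" by (rule filterlim_compose[OF lim(2)])
  qed
  ultimately have "integral {0<..} \<phi> = 0" using LIMSEQ_unique by fastforce
  then show ?thesis using eq by simp
qed

end

section \<open>The maximal operator is closed\<close>

text \<open>
  The integral from \<open>1\<close> to \<open>x\<close> with orientation: for \<open>x \<noteq> 1\<close> one of the two intervals is empty, and its
  integral is \<open>0\<close>.
\<close>

definition antideriv :: "(real \<Rightarrow> complex) \<Rightarrow> real \<Rightarrow> complex" where
  "antideriv k x = integral {1..x} k - integral {x..1} k"

lemma antideriv_primitive:
  assumes k: "\<And>x y. 0 < x \<Longrightarrow> x \<le> y \<Longrightarrow> k absolutely_integrable_on {x..y}"
  shows "primitive_of k (antideriv k)"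
  unfolding primitive_of_def
proof (intro allI impI)
  fix x y :: real assume xy: "0 < x \<and> x \<le> y"
  have ki: "k integrable_on {u..v}" if "0 < u" for u v
    using k[of u v] that set_lebesgue_integral_eq_integral(1) by (cases "u \<le> v") auto
  have comb: "integral {u..t} k + integral {t..v} k = integral {u..v} k" if "0 < u" "u \<le> t" "t \<le> v" for u t v
    using Henstock_Kurzweil_Integration.integral_combine[OF that(2,3) ki[OF that(1)]] .
  have emp: "integral {1..u} k = 0" if "u \<le> 1" for u using that by (cases "u = 1") auto
  have emp': "integral {u..1} k = 0" if "1 \<le> u" for u using that by (cases "u = 1") auto
  consider "1 \<le> x" | "x < 1" "1 \<le> y" | "x < 1" "y < 1" by linarith
  then have "integral {x..y} k = antideriv k y - antideriv k x"
  proof cases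
    case 1
    then show ?thesis using comb[of 1 x y] xy emp' by (simp add: antideriv_def algebra_simps)
  next
    case 2
    then show ?thesis using comb[of x 1 y] xy emp emp' by (simp add: antideriv_def algebra_simps)
  next
    case 3
    then show ?thesis using comb[of x y 1] xy emp by (simp add: antideriv_def algebra_simps)
  qed
  then show "k absolutely_integrable_on {x..y} \<and> integral {x..y} k = antideriv k y - antideriv k x"
    using k xy by blast
qed

lemma antideriv_1: "antideriv k 1 = 0" by (simp add: antideriv_def)

lemma primitive_antideriv:
  assumes F: "primitive_of f F" and x: "x > 0" shows "F x = F 1 + antideriv f x"
proof (cases "1 \<le> x")
  case True
  have "integral {x..1} f = 0" using True by (cases "x = 1") auto
  then show ?thesis using primitive_ofD(2)[OF F _ True] by (simp add: antideriv_def)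
next
  case False
  then have "integral {1..x} f = 0" by simp
  then show ?thesis using primitive_ofD(2)[OF F x, of 1] False by (simp add: antideriv_def)
qed

lemma antideriv_diff:
  assumes f: "\<And>x y. 0 < x \<Longrightarrow> x \<le> y \<Longrightarrow> f integrable_on {x..y}"
    and g: "\<And>x y. 0 < x \<Longrightarrow> x \<le> y \<Longrightarrow> g integrable_on {x..y}" and x: "x > 0"
  shows "antideriv (\<lambda>t. f t - g t) x = antideriv f x - antideriv g x"
proof -
  have fi: "f integrable_on {u..v}" if "0 < u" for u v using f[OF that, of v] by (cases "u \<le> v") auto
  have gi: "g integrable_on {u..v}" if "0 < u" for u v using g[OF that, of v] by (cases "u \<le> v") auto
  show ?thesis unfolding antideriv_def
    by (simp only: integral_diff[OF fi[OF zero_less_one] gi[OF zero_less_one]] integral_diff[OF fi[OF x] gi[OF x]]) simp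
qed

lemma antideriv_bound:
  assumes f: "\<And>x y. 0 < x \<Longrightarrow> x \<le> y \<Longrightarrow> f integrable_on {x..y}"
    and b: "\<And>t. t \<in> {min x 1..max x 1} \<Longrightarrow> cmod (f t) \<le> B" and x: "x > 0"
  shows "cmod (antideriv f x) \<le> B * \<bar>x - 1\<bar>"
proof (cases "1 \<le> x")
  case True
  have "integral {x..1} f = 0" using True by (cases "x = 1") auto
  moreover have "cmod (integral {1..x} f) \<le> integral {1..x} (\<lambda>_. B)"
    using True b by (intro integral_norm_bound_integral f) auto
  ultimately show ?thesis using True by (simp add: antideriv_def mult.commute)
next
  case False
  then have "integral {1..x} f = 0" by simp
  moreover have "cmod (integral {x..1} f) \<le> integral {x..1} (\<lambda>_. B)"
    using False x b by (intro integral_norm_bound_integral f) auto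
  ultimately show ?thesis using False by (simp add: antideriv_def mult.commute)
qed

lemma primitive_of_zero: "primitive_of (\<lambda>x. 0) (\<lambda>x. 0)"
  by (rule primitive_ofI) auto

lemma primitive_of_sum:
  assumes "finite I" "\<And>i. i \<in> I \<Longrightarrow> primitive_of (f i) (F i)"
  shows "primitive_of (\<lambda>x. \<Sum>i\<in>I. c i * f i x) (\<lambda>x. \<Sum>i\<in>I. c i * F i x)"
  using assms
proof (induction I rule: finite_induct)
  case (insert j I)
  have "primitive_of (\<lambda>x. c j * f j x + 1 * (\<Sum>i\<in>I. c i * f i x)) (\<lambda>x. c j * F j x + 1 * (\<Sum>i\<in>I. c i * F i x))"
    using insert by (intro primitive_of_linear) auto
  then show ?case using insert(1,2) by simp
qed (simp add: primitive_of_zero)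

context cev begin

abbreviation "T \<equiv> cev_op \<mu> \<sigma> \<gamma>"

lemma cev_op_intro:
  assumes J: "primitive_of k J" and u: "primitive_of (\<lambda>x. of_real (scale x) * J x) u"
    and f: "f \<in> L2 M" "AE x in M. f x = u x / of_real (w x)"
    and h: "h \<in> L2 M" "AE x in M. h x = k x"
  shows "(f, h) \<in> T"
proof -
  define p where "p x = u x / of_real (w x)" for x
  have p: "p x = u x / of_real (w x)" if "x > 0" for x by (simp add: p_def)
  note facts = Dmax_of_primitives[OF J u p]
  have "primitive_of (\<lambda>x. of_real (inverse (w x)) * (of_real (scale x) * J x) + of_real (- (inverse (w x) * (scale x * drift x) * inverse (w x))) * u x) (\<lambda>x. of_real (inverse (w x)) * u x)"
    by (rule primitive_of_mult[OF winv_primitive u])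
  from primitive_of_continuous[OF this] have "continuous_on {0<..} p"
    by (simp add: p_def[abs_def] divide_inverse mult.commute)
  then have pm: "p \<in> borel_measurable M"
    unfolding measurable_M by (intro continuous_imp_measurable_on_sets_lebesgue) auto
  have fp: "AE x in M. f x = p x" using f(2) by (simp add: p_def)
  have pL: "p \<in> L2 M" by (rule L2_cong_AE[OF f(1) pm fp])
  have ke: "AE x in M. expr p x = k x" unfolding AE_M using facts(3) by simp
  have he: "AE x in M. h x = expr p x" using h(2) ke by eventually_elim simp
  then obtain N where N: "negligible N" "\<And>x. x > 0 \<Longrightarrow> x \<notin> N \<Longrightarrow> h x = expr p x" unfolding AE_M by blast
  have em: "expr p \<in> borel_measurable M"
    unfolding measurable_M
    by (rule borel_measurable_lebesgue_on_spike[OF L2D(1)[OF h(1), unfolded measurable_M] _ N(1)]) (use N(2) in auto)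
  have eL: "expr p \<in> L2 M" by (rule L2_cong_AE[OF h(1) em he])
  have "p \<in> Dmax" by (rule facts(4)) (use pL eL in auto)
  then show ?thesis unfolding cev_op_def using f(1) h(1) fp he by blast
qed

lemma cev_op_cases:
  assumes "(f, h) \<in> T"
  obtains p where "p \<in> Dmax" "f \<in> L2 M" "h \<in> L2 M" "AE x in M. f x = p x" "AE x in M. h x = expr p x"
  using assms that unfolding cev_op_def by blast

lemma cev_op_sum:
  assumes T: "\<And>i. i \<in> I \<Longrightarrow> (F i, H i) \<in> T" and I: "finite I"
  shows "((\<lambda>x. \<Sum>i\<in>I. c i * F i x), (\<lambda>x. \<Sum>i\<in>I. c i * H i x)) \<in> T"
proof -
  have "\<exists>p. p \<in> Dmax \<and> F i \<in> L2 M \<and> H i \<in> L2 M \<and> (AE x in M. F i x = p x) \<and> (AE x in M. H i x = expr p x)"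
    if "i \<in> I" for i
    by (rule cev_op_cases[OF T[OF that]]) blast
  then have "\<forall>i\<in>I. \<exists>p. p \<in> Dmax \<and> F i \<in> L2 M \<and> H i \<in> L2 M \<and> (AE x in M. F i x = p x) \<and> (AE x in M. H i x = expr p x)"
    by blast
  from bchoice[OF this] obtain p where p: "\<And>i. i \<in> I \<Longrightarrow> p i \<in> Dmax" "\<And>i. i \<in> I \<Longrightarrow> F i \<in> L2 M" "\<And>i. i \<in> I \<Longrightarrow> H i \<in> L2 M"
    "\<And>i. i \<in> I \<Longrightarrow> AE x in M. F i x = p i x" "\<And>i. i \<in> I \<Longrightarrow> AE x in M. H i x = expr (p i) x"
    by blast
  have J: "primitive_of (\<lambda>x. \<Sum>i\<in>I. c i * expr (p i) x) (\<lambda>x. \<Sum>i\<in>I. c i * flux (p i) x)"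
    by (intro primitive_of_sum I Dmax_primitives p)
  have "primitive_of (\<lambda>x. \<Sum>i\<in>I. c i * (of_real (scale x) * flux (p i) x)) (\<lambda>x. \<Sum>i\<in>I. c i * (of_real (w x) * p i x))"
    by (intro primitive_of_sum I Dmax_primitives p)
  then have u: "primitive_of (\<lambda>x. of_real (scale x) * (\<Sum>i\<in>I. c i * flux (p i) x)) (\<lambda>x. \<Sum>i\<in>I. c i * (of_real (w x) * p i x))"
    by (simp add: sum_distrib_left mult_ac)
  have aeF: "AE x in M. \<forall>i\<in>I. F i x = p i x" and aeH: "AE x in M. \<forall>i\<in>I. H i x = expr (p i) x"
    using p I by (auto intro: AE_finite_allI)
  have pos: "AE x in M. x > 0" unfolding AE_M by (intro exI[of _ "{}"]) auto
  show ?thesis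
  proof (rule cev_op_intro[OF J u])
    show "AE x in M. (\<Sum>i\<in>I. c i * F i x) = (\<Sum>i\<in>I. c i * (of_real (w x) * p i x)) / of_real (w x)"
      using aeF pos
    proof eventually_elim
      case (elim x)
      have "complex_of_real (w x) \<noteq> 0" using w_pos[of x] elim by simp
      then show ?case using elim by (simp add: sum_divide_distrib)
    qed
    show "AE x in M. (\<Sum>i\<in>I. c i * H i x) = (\<Sum>i\<in>I. c i * expr (p i) x)"
      using aeH by eventually_elim simp
  qed (intro L2_sum L2_scale p; assumption)+
qed

lemma cev_op_symmetric:
  assumes "(f, h) \<in> T" "(f', h') \<in> T"
  shows "L2_inner M h f' = L2_inner M f h'"
proof -
  obtain p where p: "p \<in> Dmax" "f \<in> L2 M" "h \<in> L2 M" "AE x in M. f x = p x" "AE x in M. h x = expr p x"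
    using assms(1) by (rule cev_op_cases)
  obtain p' where p': "p' \<in> Dmax" "f' \<in> L2 M" "h' \<in> L2 M" "AE x in M. f' x = p' x" "AE x in M. h' x = expr p' x"
    using assms(2) by (rule cev_op_cases)
  note m = L2D(1)[OF p(2)] L2D(1)[OF p(3)] L2D(1)[OF p'(2)] L2D(1)[OF p'(3)]
    L2D(1)[OF Dmax_L2(1)[OF p(1)]] L2D(1)[OF Dmax_L2(2)[OF p(1)]] L2D(1)[OF Dmax_L2(1)[OF p'(1)]] L2D(1)[OF Dmax_L2(2)[OF p'(1)]]
  have "L2_inner M h f' = L2_inner M (expr p) p'"
    unfolding L2_inner_def using p(5) p'(4) m by (intro integral_cong_AE) (auto elim!: eventually_elim2)
  also have "\<dots> = L2_inner M p (expr p')" by (rule Dmax_symmetric[OF p(1) p'(1)])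
  also have "\<dots> = L2_inner M f h'"
    unfolding L2_inner_def using p(4) p'(5) m by (intro integral_cong_AE) (auto elim!: eventually_elim2)
  finally show ?thesis .
qed

text \<open>
  On compact subintervals, convergence in norm implies convergence of integrals.
\<close>

lemma L2_locally_integrable:
  assumes g: "g \<in> L2 M" and xy: "0 < x" "x \<le> y"
  shows "g absolutely_integrable_on {x..y}"
    "cmod (integral {x..y} g) \<le> sqrt (integral {x..y} m) * L2_norm M g"
proof -
  have gm: "g \<in> borel_measurable (lebesgue_on {0<..})" and gi: "(\<lambda>x. w x * (cmod (g x))\<^sup>2) integrable_on {0<..}"
    using g by (auto simp: L2_M_iff)
  define a where "a t = complex_of_real (sqrt (m t))" for t
  define b where "b t = complex_of_real (sqrt (w t)) * g t" for t
  have sub: "{x..y} \<subseteq> {0<..}" using xy by auto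
  have pos: "w t > 0" "m t > 0" if "t \<in> {x..y}" for t using that sub w_pos m_pos by auto
  have ab: "a t * b t = g t" if "t \<in> {x..y}" for t
    using pos[OF that] by (simp add: a_def b_def m_def real_sqrt_inverse)
  have asq: "(cmod (a t))\<^sup>2 = m t" and bsq: "(cmod (b t))\<^sup>2 = w t * (cmod (g t))\<^sup>2" if "t \<in> {x..y}" for t
    using pos[OF that] by (simp_all add: a_def b_def norm_mult power_mult_distrib)
  have am: "a \<in> borel_measurable (lebesgue_on {x..y})"
    unfolding a_def[abs_def]
    by (intro continuous_imp_measurable_on_sets_lebesgue continuous_intros continuous_on_subset[OF m_cont] sub) auto
  have "(\<lambda>t. complex_of_real (sqrt (w t))) \<in> borel_measurable (lebesgue_on {x..y})"
    by (intro continuous_imp_measurable_on_sets_lebesgue continuous_intros continuous_on_subset[OF w_cont] sub) auto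
  moreover have "g \<in> borel_measurable (lebesgue_on {x..y})" by (rule measurable_restrict_mono[OF gm sub])
  ultimately have bm: "b \<in> borel_measurable (lebesgue_on {x..y})"
    unfolding b_def[abs_def] by (rule borel_measurable_times)
  have mi: "m integrable_on {x..y}"
    by (intro integrable_continuous_real continuous_on_subset[OF m_cont] sub)
  have ai: "(\<lambda>t. (cmod (a t))\<^sup>2) integrable_on {x..y}" using mi by (rule integrable_eq) (simp add: asq)
  have g2: "(\<lambda>x. w x * (cmod (g x))\<^sup>2) integrable_on {x..y}"
    by (rule integrable_on_subset_nonneg[OF gi]) (use sub w_pos in \<open>auto simp: less_imp_le\<close>)
  then have bi: "(\<lambda>t. (cmod (b t))\<^sup>2) integrable_on {x..y}" by (rule integrable_eq) (simp add: bsq)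
  note CS = Cauchy_Schwarz_integral[OF _ am ai bm bi]
  have "(\<lambda>t. a t * b t) absolutely_integrable_on {x..y}" by (rule CS(1)) simp
  then show "g absolutely_integrable_on {x..y}"
    by (rule absolutely_integrable_spike[OF _ negligible_empty]) (simp add: ab)
  have "integral {x..y} g = integral {x..y} (\<lambda>t. a t * b t)" by (intro integral_cong) (simp add: ab)
  also have "cmod \<dots> \<le> sqrt (integral {x..y} (\<lambda>t. (cmod (a t))\<^sup>2)) * sqrt (integral {x..y} (\<lambda>t. (cmod (b t))\<^sup>2))"
    by (rule CS(2)) simp
  also have "integral {x..y} (\<lambda>t. (cmod (a t))\<^sup>2) = integral {x..y} m" by (intro integral_cong) (simp add: asq)
  also have "integral {x..y} (\<lambda>t. (cmod (b t))\<^sup>2) = integral {x..y} (\<lambda>x. w x * (cmod (g x))\<^sup>2)" by (intro integral_cong) (simp add: bsq)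
  also have "sqrt (integral {x..y} (\<lambda>x. w x * (cmod (g x))\<^sup>2)) \<le> L2_norm M g"
  proof -
    have m2: "(\<lambda>x. (cmod (g x))\<^sup>2) \<in> borel_measurable (lebesgue_on {0<..})" using gm by simp
    have "(\<lambda>x. w x * (cmod (g x))\<^sup>2) absolutely_integrable_on {0<..}"
      using gi w_pos by (intro nonnegative_absolutely_integrable_1) (auto simp: less_imp_le)
    then have ii: "integrable (lebesgue_on {0<..}) (\<lambda>x. w x * (cmod (g x))\<^sup>2)"
      by (rule absolutely_integrable_imp_integrable) simp
    have "(LINT x|M. (cmod (g x))\<^sup>2) = integral {0<..} (\<lambda>x. w x * (cmod (g x))\<^sup>2)"
      unfolding integrable_M(2)[OF m2] real_scaleR_def by (rule lebesgue_integral_eq_integral[OF ii]) simp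
    moreover have "integral {x..y} (\<lambda>x. w x * (cmod (g x))\<^sup>2) \<le> integral {0<..} (\<lambda>x. w x * (cmod (g x))\<^sup>2)"
      by (rule integral_subset_le[OF sub g2 gi]) (simp add: w_pos less_imp_le)
    ultimately show ?thesis unfolding L2_norm_def by (simp only: real_sqrt_le_iff)
  qed
  finally show "cmod (integral {x..y} g) \<le> sqrt (integral {x..y} m) * L2_norm M g"
    using Henstock_Kurzweil_Integration.integral_nonneg[OF mi] pos(2) by (simp add: mult_left_mono less_imp_le)
qed


lemma antideriv_L2_bound:
  assumes g: "g \<in> L2 M" and a: "0 < a" "a \<le> 1" "1 \<le> b" and t: "t \<in> {a..b}"
  shows "cmod (antideriv g t) \<le> sqrt (integral {a..b} m) * L2_norm M g"
proof -
  have mono: "integral {x..y} m \<le> integral {a..b} m" if "a \<le> x" "y \<le> b" for x y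
    using that a by (intro integral_subset_le integrable_continuous_real continuous_on_subset[OF m_cont])
      (auto simp: less_imp_le m_pos)
  have bound: "cmod (integral {x..y} g) \<le> sqrt (integral {a..b} m) * L2_norm M g" if "a \<le> x" "x \<le> y" "y \<le> b" for x y
  proof -
    have "cmod (integral {x..y} g) \<le> sqrt (integral {x..y} m) * L2_norm M g"
      using that a by (intro L2_locally_integrable(2) g) auto
    also have "\<dots> \<le> sqrt (integral {a..b} m) * L2_norm M g"
      using that by (intro mult_right_mono real_sqrt_le_mono mono L2_norm_nonneg)
    finally show ?thesis .
  qed
  show ?thesis
  proof (cases "1 \<le> t")
    case True
    have "integral {t..1} g = 0" using True by (cases "t = 1") auto
    then show ?thesis using bound[of 1 t] True t a by (simp add: antideriv_def)
  next
    case False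
    then have "integral {1..t} g = 0" by simp
    then show ?thesis using bound[of t 1] False t a by (simp add: antideriv_def)
  qed
qed

lemma L2_antideriv_primitive: "g \<in> L2 M \<Longrightarrow> primitive_of g (antideriv g)"
  by (rule antideriv_primitive) (rule L2_locally_integrable(1))

lemma L2_scale_antideriv_primitive:
  assumes g: "g \<in> L2 M"
  shows "primitive_of (\<lambda>x. of_real (scale x) * antideriv g x) (antideriv (\<lambda>x. of_real (scale x) * antideriv g x))"
proof (rule antideriv_primitive)
  fix x y :: real assume xy: "0 < x" "x \<le> y"
  show "(\<lambda>x. of_real (scale x) * antideriv g x) absolutely_integrable_on {x..y}"
  proof -
    have c1: "continuous_on {x..y} scale" by (rule continuous_on_subset[OF scale_cont]) (use xy in auto)
    have c2: "continuous_on {x..y} (antideriv g)"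
      by (rule continuous_on_subset[OF primitive_of_continuous[OF L2_antideriv_primitive[OF g]]]) (use xy in auto)
    show ?thesis by (intro absolutely_integrable_continuous_real continuous_intros c1 c2)
  qed
qed

lemma double_antideriv_tendsto:
  assumes k: "\<And>N. k N \<in> L2 M" and h: "h \<in> L2 M"
    and lim: "(\<lambda>N. L2_norm M (\<lambda>x. k N x - h x)) \<longlonglongrightarrow> 0" and x: "x > 0"
  shows "(\<lambda>N. antideriv (\<lambda>x. of_real (scale x) * antideriv (k N) x) x) \<longlonglongrightarrow> antideriv (\<lambda>x. of_real (scale x) * antideriv h x) x"
proof -
  define a where "a = min x 1"
  define b where "b = max x 1"
  have ab: "0 < a" "a \<le> 1" "1 \<le> b" using x by (auto simp: a_def b_def)
  define C where "C = 2 / \<sigma>\<^sup>2 * sqrt (integral {a..b} m) * \<bar>x - 1\<bar>"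
  have bound: "cmod (antideriv (\<lambda>x. of_real (scale x) * antideriv (k N) x) x - antideriv (\<lambda>x. of_real (scale x) * antideriv h x) x)
      \<le> C * L2_norm M (\<lambda>x. k N x - h x)" for N
  proof -
    let ?d = "\<lambda>x. k N x - h x"
    have d: "?d \<in> L2 M" by (intro L2_diff k h)
    have ad: "antideriv ?d t = antideriv (k N) t - antideriv h t" if "t > 0" for t
      by (rule antideriv_diff[OF _ _ that])
         (auto intro!: primitive_ofD(3)[OF L2_antideriv_primitive] k h)
    have "antideriv (\<lambda>x. of_real (scale x) * antideriv (k N) x) x - antideriv (\<lambda>x. of_real (scale x) * antideriv h x) x
      = antideriv (\<lambda>t. of_real (scale t) * antideriv (k N) t - of_real (scale t) * antideriv h t) x"
      by (rule antideriv_diff[symmetric, OF _ _ x])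
         (auto intro!: primitive_ofD(3)[OF L2_scale_antideriv_primitive] k h)
    also have "cmod \<dots> \<le> (2 / \<sigma>\<^sup>2 * (sqrt (integral {a..b} m) * L2_norm M ?d)) * \<bar>x - 1\<bar>"
    proof (rule antideriv_bound[OF _ _ x])
      show "(\<lambda>t. of_real (scale t) * antideriv (k N) t - of_real (scale t) * antideriv h t) integrable_on {x..y}" if "0 < x" "x \<le> y" for x y
        by (intro integrable_diff primitive_ofD(3)[OF L2_scale_antideriv_primitive] k h that)
      fix t assume t: "t \<in> {min x 1..max x 1}"
      then have t': "t \<in> {a..b}" "t > 0" using x by (auto simp: a_def b_def)
      have "cmod (of_real (scale t) * antideriv (k N) t - of_real (scale t) * antideriv h t) = scale t * cmod (antideriv ?d t)"
        using scale_pos[of t] unfolding ad[OF t'(2)] right_diff_distrib[symmetric] norm_mult by simp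
      also have "\<dots> \<le> 2 / \<sigma>\<^sup>2 * (sqrt (integral {a..b} m) * L2_norm M ?d)"
        using t' scale_le[of t] by (intro mult_mono antideriv_L2_bound d ab) auto
      finally show "cmod (of_real (scale t) * antideriv (k N) t - of_real (scale t) * antideriv h t) \<le> 2 / \<sigma>\<^sup>2 * (sqrt (integral {a..b} m) * L2_norm M ?d)" .
    qed
    finally show ?thesis by (simp add: C_def mult_ac)
  qed
  have Clim: "(\<lambda>N. C * L2_norm M (\<lambda>x. k N x - h x)) \<longlonglongrightarrow> 0"
    by (rule tendsto_mult_right_zero[OF lim])
  have "(\<lambda>N. antideriv (\<lambda>x. of_real (scale x) * antideriv (k N) x) x - antideriv (\<lambda>x. of_real (scale x) * antideriv h x) x) \<longlonglongrightarrow> 0"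
    by (rule Lim_null_comparison[OF always_eventually Clim]) (rule allI, rule bound)
  then show ?thesis by (simp add: LIM_zero_iff)
qed

lemma AE_M_obtain:
  assumes ae: "AE x in M. P x" and ab: "0 \<le> a" "a < b"
  obtains x where "a < x" "x < b" "P x"
proof -
  obtain N where N: "negligible N" "\<And>x. x > 0 \<Longrightarrow> x \<notin> N \<Longrightarrow> P x" using ae unfolding AE_M by blast
  have "\<not> {a<..<b} \<subseteq> N"
  proof
    assume "{a<..<b} \<subseteq> N"
    then have "negligible {a<..<b}" using N(1) negligible_subset by blast
    then show False using open_not_negligible[of "{a<..<b}"] ab by auto
  qed
  then obtain x where "x \<in> {a<..<b}" "x \<notin> N" by blast
  then show ?thesis using that N(2) ab by auto
qed

text \<open>
  Integration of the system from \<open>1\<close> gives \<open>u\<^sub>N = A\<^sub>N + B\<^sub>N D + V\<^sub>N\<close>, where \<open>V\<^sub>N\<close> depends continuously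
  on the right-hand side \<open>k\<^sub>N\<close>.  A subsequence of \<open>u\<^sub>N\<close> converges almost everywhere, and convergence at two
  points determines the limits of \<open>A\<^sub>N\<close> and \<open>B\<^sub>N\<close>.  The limit function again solves the system.
\<close>

theorem cev_op_closed:
  assumes T: "\<And>N. (F N, H N) \<in> T" and f: "f \<in> L2 M" and h: "h \<in> L2 M"
    and F: "(\<lambda>N. L2_norm M (\<lambda>x. F N x - f x)) \<longlonglongrightarrow> 0" and H: "(\<lambda>N. L2_norm M (\<lambda>x. H N x - h x)) \<longlonglongrightarrow> 0"
  shows "(f, h) \<in> T"
proof -
  have "\<exists>p. p \<in> Dmax \<and> F N \<in> L2 M \<and> H N \<in> L2 M \<and> (AE x in M. F N x = p x) \<and> (AE x in M. H N x = expr p x)" for N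
    by (rule cev_op_cases[OF T[of N]]) blast
  then obtain p where p: "\<And>N. p N \<in> Dmax" "\<And>N. F N \<in> L2 M" "\<And>N. H N \<in> L2 M"
    "\<And>N. AE x in M. F N x = p N x" "\<And>N. AE x in M. H N x = expr (p N) x"
    by metis
  define k where "k N = expr (p N)" for N
  have pL: "p N \<in> L2 M" and kL: "k N \<in> L2 M" for N using Dmax_L2[OF p(1)[of N]] by (auto simp: k_def)
  have normk: "L2_norm M (\<lambda>x. k N x - h x) = L2_norm M (\<lambda>x. H N x - h x)" for N
    using p(5)[of N] by (intro L2_norm_cong_AE L2D(1)[OF L2_diff] kL h p(3)) (auto simp: k_def elim!: eventually_mono)
  have klim: "(\<lambda>N. L2_norm M (\<lambda>x. k N x - h x)) \<longlonglongrightarrow> 0" using H by (simp add: normk)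
  have "(\<lambda>N. (L2_norm M (\<lambda>x. F N x - f x))\<^sup>2) \<longlonglongrightarrow> 0\<^sup>2" by (intro tendsto_intros F)
  then have "(\<lambda>N. LINT x|M. norm ((cmod (F N x - f x))\<^sup>2)) \<longlonglongrightarrow> 0" by (simp add: L2_norm_sq)
  from tendsto_L1_AE_subseq[OF L2D(2)[OF L2_diff[OF p(2) f]] this] obtain r where r: "strict_mono r"
    "AE x in M. (\<lambda>N. (cmod (F (r N) x - f x))\<^sup>2) \<longlonglongrightarrow> 0"
    by blast
  have aeall: "AE x in M. \<forall>N. F N x = p N x" using p(4) by (simp add: AE_all_countable)
  define u where "u N x = of_real (w x) * p N x" for N x
  define V where "V N x = antideriv (\<lambda>x. of_real (scale x) * antideriv (k N) x) x" for N x
  define V0 where "V0 x = antideriv (\<lambda>x. of_real (scale x) * antideriv h x) x" for x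
  have uconv: "AE x in M. x > 0 \<and> (\<lambda>N. u (r N) x) \<longlonglongrightarrow> of_real (w x) * f x"
  proof -
    have pos: "AE x in M. x > 0" unfolding AE_M by (intro exI[of _ "{}"]) auto
    show ?thesis using r(2) aeall pos
    proof eventually_elim
      case (elim x)
      have "(\<lambda>N. sqrt ((cmod (F (r N) x - f x))\<^sup>2)) \<longlonglongrightarrow> sqrt 0" by (intro tendsto_intros elim)
      then have "(\<lambda>N. F (r N) x) \<longlonglongrightarrow> f x" by (simp add: tendsto_norm_zero_iff LIM_zero_iff)
      then have "(\<lambda>N. of_real (w x) * F (r N) x) \<longlonglongrightarrow> of_real (w x) * f x" by (intro tendsto_intros)
      then show ?case using elim by (simp add: u_def)
    qed
  qed
  have Vconv: "(\<lambda>N. V (r N) x) \<longlonglongrightarrow> V0 x" if "x > 0" for x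
    unfolding V_def V0_def
    using LIMSEQ_subseq_LIMSEQ[OF double_antideriv_tendsto[OF kL h klim that] r(1)] by (simp add: o_def)
  define A where "A N = u N 1" for N
  define B where "B N = flux (p N) 1" for N
  define D where "D x = complex_of_real (S_lo x - S_lo 1)" for x
  have Dprim: "primitive_of (\<lambda>x. of_real (scale x)) D"
    unfolding D_def[abs_def] by (intro primitive_real) (auto intro!: derivative_eq_intros S_deriv scale_cont)
  have rep: "u N x = A N + B N * D x + V N x" if x: "x > 0" for N x
  proof -
    have J: "primitive_of (k N) (flux (p N))" and uu: "primitive_of (\<lambda>x. of_real (scale x) * flux (p N) x) (u N)"
      using Dmax_primitives[OF p(1)[of N]] by (simp_all add: k_def u_def[abs_def])
    have Jrep: "flux (p N) t = B N + antideriv (k N) t" if "t > 0" for t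
      unfolding B_def by (rule primitive_antideriv[OF J that])
    have 1: "primitive_of (\<lambda>x. B N * of_real (scale x) + 1 * (of_real (scale x) * antideriv (k N) x)) (\<lambda>x. B N * D x + 1 * V N x)"
      unfolding V_def by (intro primitive_of_linear Dprim L2_scale_antideriv_primitive kL)
    have 2: "primitive_of (\<lambda>x. B N * of_real (scale x) + 1 * (of_real (scale x) * antideriv (k N) x)) (u N)"
      by (rule primitive_of_spike[OF uu negligible_empty]) (simp add: Jrep algebra_simps)
    have "B N * D x + 1 * V N x - (B N * D 1 + 1 * V N 1) = u N x - u N 1"
      using primitive_antideriv[OF 1 x] primitive_antideriv[OF 2 x] by simp
    moreover have "D 1 = 0" "V N 1 = 0" by (simp_all add: D_def V_def antideriv_1)
    ultimately have "B N * D x + V N x = u N x - A N" by (simp add: A_def)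
    then show ?thesis by (metis add.assoc add.commute diff_add_cancel)
  qed
  \<comment> \<open>Two distinct points of convergence suffice, since \<open>D\<close> is strictly increasing.\<close>
  obtain x1 where x1: "1 < x1" "x1 < 2" "x1 > 0 \<and> (\<lambda>N. u (r N) x1) \<longlonglongrightarrow> of_real (w x1) * f x1"
    by (rule AE_M_obtain[OF uconv, of 1 2]) auto
  obtain x2 where x2: "2 < x2" "x2 < 3" "x2 > 0 \<and> (\<lambda>N. u (r N) x2) \<longlonglongrightarrow> of_real (w x2) * f x2"
    by (rule AE_M_obtain[OF uconv, of 2 3]) auto
  have D12: "D x2 - D x1 \<noteq> 0"
    using S_lo_diff[of x1 x2] scale_integral_pos[of x1 x2] x1 x2 by (simp add: D_def flip: of_real_diff)
  define L where "L x = of_real (w x) * f x - V0 x" for x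
  have lin: "(\<lambda>N. A (r N) + B (r N) * D x) \<longlonglongrightarrow> L x" if "x > 0" "(\<lambda>N. u (r N) x) \<longlonglongrightarrow> of_real (w x) * f x" for x
  proof -
    have "(\<lambda>N. u (r N) x - V (r N) x) \<longlonglongrightarrow> L x" unfolding L_def by (intro tendsto_diff that Vconv)
    then show ?thesis by (simp add: rep[OF that(1)])
  qed
  define b where "b = (L x2 - L x1) / (D x2 - D x1)"
  have "(\<lambda>N. ((A (r N) + B (r N) * D x2) - (A (r N) + B (r N) * D x1)) / (D x2 - D x1)) \<longlonglongrightarrow> b"
    unfolding b_def using x1 x2 D12 by (intro tendsto_divide tendsto_diff lin tendsto_const) auto
  moreover have "((A (r N) + B (r N) * D x2) - (A (r N) + B (r N) * D x1)) / (D x2 - D x1) = B (r N)" for N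
    using D12 by (simp add: field_simps)
  ultimately have Blim: "(\<lambda>N. B (r N)) \<longlonglongrightarrow> b" by simp
  define a where "a = L x1 - b * D x1"
  have "(\<lambda>N. (A (r N) + B (r N) * D x1) - B (r N) * D x1) \<longlonglongrightarrow> a"
    unfolding a_def using x1 by (intro tendsto_diff lin tendsto_mult Blim tendsto_const) auto
  then have Alim: "(\<lambda>N. A (r N)) \<longlonglongrightarrow> a" by simp
  define U where "U x = a + b * D x + V0 x" for x
  have Ulim: "(\<lambda>N. u (r N) x) \<longlonglongrightarrow> U x" if "x > 0" for x
    unfolding rep[OF that] U_def by (intro tendsto_add tendsto_mult Alim Blim Vconv that tendsto_const)
  show ?thesis
  proof (rule cev_op_intro[of h "\<lambda>x. b + antideriv h x" U])
    have c: "primitive_of (\<lambda>x. 0) (\<lambda>x. b)" by (rule primitive_ofI) auto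
    show "primitive_of h (\<lambda>x. b + antideriv h x)"
      using primitive_of_linear[OF c L2_antideriv_primitive[OF h], of 1 1] by simp
    have "primitive_of (\<lambda>x. b * of_real (scale x) + 1 * (of_real (scale x) * antideriv h x)) (\<lambda>x. b * D x + 1 * V0 x)"
      unfolding V0_def by (intro primitive_of_linear Dprim L2_scale_antideriv_primitive h)
    moreover have "primitive_of (\<lambda>x. 0) (\<lambda>x. a)" by (rule primitive_ofI) auto
    ultimately show "primitive_of (\<lambda>x. of_real (scale x) * (b + antideriv h x)) U"
      using primitive_of_linear[of "\<lambda>x. 0" "\<lambda>x. a" _ _ 1 1] by (force simp: U_def[abs_def] algebra_simps)
    show "AE x in M. f x = U x / of_real (w x)"
      using uconv
    proof eventually_elim
      case (elim x)
      then have "of_real (w x) * f x = U x" using Ulim[of x] LIMSEQ_unique by blast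
      moreover have "complex_of_real (w x) \<noteq> 0" using w_pos[of x] elim by simp
      ultimately show ?case by (simp add: field_simps)
    qed
  qed (use f h in auto)
qed

end

section \<open>Laguerre eigenfunctions\<close>

text \<open>
  The polynomial factor of \<open>d\<^sup>k/dt\<^sup>k (e\<^sup>-\<^sup>t t\<^sup>c) = e\<^sup>-\<^sup>t t\<^sup>c\<^sup>-\<^sup>k P\<^sub>k(t)\<close>.
\<close>

fun rodrigues_poly :: "real \<Rightarrow> nat \<Rightarrow> real poly" where
  "rodrigues_poly c 0 = 1"
| "rodrigues_poly c (Suc k) = [:0, 1:] * pderiv (rodrigues_poly c k) + [:c - real k, -1:] * rodrigues_poly c k"

lemma rodrigues_poly_degree: "degree (rodrigues_poly c k) \<le> k" and
  rodrigues_poly_lead: "coeff (rodrigues_poly c k) k = (-1) ^ k"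
proof -
  have "degree (rodrigues_poly c k) \<le> k \<and> coeff (rodrigues_poly c k) k = (-1) ^ k"
  proof (induction k)
    case (Suc k)
    let ?P = "rodrigues_poly c k"
    have z: "coeff ?P j = 0" if "j > k" for j
      using Suc that by (intro coeff_eq_0) auto
    have cf: "coeff (rodrigues_poly c (Suc k)) (Suc j) = real (Suc j) * coeff ?P (Suc j) + (c - real k) * coeff ?P (Suc j) - coeff ?P j" for j
      by (simp add: coeff_pderiv)
    have "degree (rodrigues_poly c (Suc k)) \<le> Suc k"
    proof (rule degree_le, intro allI impI)
      fix i assume i: "Suc k < i"
      then obtain j where j: "i = Suc j" "j > k" by (cases i) auto
      show "coeff (rodrigues_poly c (Suc k)) i = 0" unfolding j(1) cf using z[of j] z[of "Suc j"] j(2) by simp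
    qed
    moreover have "coeff (rodrigues_poly c (Suc k)) (Suc k) = (-1) ^ Suc k"
      unfolding cf using z[of "Suc k"] Suc by simp
    ultimately show ?case by blast
  qed simp
  then show "degree (rodrigues_poly c k) \<le> k" "coeff (rodrigues_poly c k) k = (-1) ^ k" by auto
qed

definition rodrigues :: "real \<Rightarrow> nat \<Rightarrow> real \<Rightarrow> real" where
  "rodrigues c k t = exp (- t) * t powr (c - real k) * poly (rodrigues_poly c k) t"

lemma rodrigues_deriv:
  assumes t: "t > 0"
  shows "(rodrigues c k has_real_derivative rodrigues c (Suc k) t) (at t)"
proof -
  let ?P = "rodrigues_poly c k"
  have "((\<lambda>t. exp (- t) * t powr (c - real k) * poly ?P t) has_real_derivative
      (exp (- t) * (- 1) * t powr (c - real k) + exp (- t) * ((c - real k) * t powr (c - real k - 1))) * poly ?P t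
      + exp (- t) * t powr (c - real k) * poly (pderiv ?P) t) (at t)"
    using t by (auto intro!: derivative_eq_intros poly_DERIV)
  also have "(exp (- t) * (- 1) * t powr (c - real k) + exp (- t) * ((c - real k) * t powr (c - real k - 1))) * poly ?P t
      + exp (- t) * t powr (c - real k) * poly (pderiv ?P) t = rodrigues c (Suc k) t"
  proof -
    have 1: "t powr (c - real k) = t powr (c - real (Suc k)) * t"
      using t powr_add[of t "c - real (Suc k)" 1] by simp
    have 2: "c - real k - 1 = c - real (Suc k)" by simp
    show ?thesis unfolding rodrigues_def 1 2 by (simp add: algebra_simps)
  qed
  finally show ?thesis unfolding rodrigues_def[abs_def] .
qed

lemma rodrigues_higher_deriv:
  "t > 0 \<Longrightarrow> (deriv ^^ k) (\<lambda>t. exp (- t) * t powr c) t = rodrigues c k t"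
proof (induction k arbitrary: t)
  case (Suc k)
  have "((deriv ^^ k) (\<lambda>t. exp (- t) * t powr c) has_real_derivative rodrigues c (Suc k) t) (at t)"
    by (rule has_field_derivative_transform_within_open[OF rodrigues_deriv[OF Suc.prems], where S = "{0<..}"])
       (use Suc in auto)
  then show ?case by (simp add: DERIV_imp_deriv)
qed (simp add: rodrigues_def)

text \<open>
  The function \<open>v = e\<^sup>-\<^sup>t t\<^sup>c\<close> satisfies \<open>t v' = (c - t) v\<close>; the recurrence is this equation
  differentiated \<open>k + 1\<close> times.  It carries the Laguerre differential equation.
\<close>

lemma rodrigues_recurrence:
  assumes t: "t > 0"
  shows "t * rodrigues c (Suc (Suc k)) t = (c - real (Suc k) - t) * rodrigues c (Suc k) t - real (Suc k) * rodrigues c k t"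
  using t
proof (induction k arbitrary: t)
  case 0
  have base: "s * rodrigues c 1 s = (c - s) * rodrigues c 0 s" if "s > 0" for s
  proof -
    have e: "s powr c = s * s powr (c - 1)" using that powr_add[of s 1 "c - 1"] by simp
    show ?thesis by (simp add: rodrigues_def e algebra_simps)
  qed
  have "((\<lambda>s. s * rodrigues c 1 s) has_real_derivative 1 * rodrigues c 1 t + t * rodrigues c (Suc 1) t) (at t)"
    using 0 by (auto intro!: derivative_eq_intros rodrigues_deriv)
  moreover have "((\<lambda>s. s * rodrigues c 1 s) has_real_derivative - rodrigues c 0 t + (c - t) * rodrigues c (Suc 0) t) (at t)"
  proof (rule has_field_derivative_transform_within_open[where S = "{0<..}"])
    show "((\<lambda>s. (c - s) * rodrigues c 0 s) has_real_derivative - rodrigues c 0 t + (c - t) * rodrigues c (Suc 0) t) (at t)"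
      using 0 by (auto intro!: derivative_eq_intros rodrigues_deriv)
  qed (use 0 base in auto)
  ultimately have "1 * rodrigues c 1 t + t * rodrigues c (Suc 1) t = - rodrigues c 0 t + (c - t) * rodrigues c (Suc 0) t"
    by (rule DERIV_unique)
  then show ?case by (simp add: algebra_simps)
next
  case (Suc k)
  let ?D = "(-1) * rodrigues c (Suc k) t + (c - real (Suc k) - t) * rodrigues c (Suc (Suc k)) t - real (Suc k) * rodrigues c (Suc k) t"
  have "((\<lambda>s. s * rodrigues c (Suc (Suc k)) s) has_real_derivative 1 * rodrigues c (Suc (Suc k)) t + t * rodrigues c (Suc (Suc (Suc k))) t) (at t)"
    using Suc.prems by (auto intro!: derivative_eq_intros rodrigues_deriv)
  moreover have "((\<lambda>s. s * rodrigues c (Suc (Suc k)) s) has_real_derivative ?D) (at t)"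
  proof (rule has_field_derivative_transform_within_open[where S = "{0<..}"])
    show "((\<lambda>s. (c - real (Suc k) - s) * rodrigues c (Suc k) s - real (Suc k) * rodrigues c k s) has_real_derivative ?D) (at t)"
      using Suc.prems by (auto intro!: derivative_eq_intros rodrigues_deriv simp del: of_nat_Suc)
  qed (use Suc in auto)
  ultimately have "1 * rodrigues c (Suc (Suc k)) t + t * rodrigues c (Suc (Suc (Suc k))) t = ?D"
    by (rule DERIV_unique)
  then show ?case by (simp add: algebra_simps)
qed

lemma gen_Laguerre_eq:
  assumes y: "y > 0"
  shows "gen_Laguerre n a y = poly (rodrigues_poly (real n + a) n) y / fact n"
    "gen_Laguerre n a y = y powr (- a) * exp y / fact n * rodrigues (real n + a) n y"
proof -
  show 1: "gen_Laguerre n a y = y powr (- a) * exp y / fact n * rodrigues (real n + a) n y"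
    unfolding gen_Laguerre_def using rodrigues_higher_deriv[OF y, of n "real n + a"] by simp
  have "y powr (- a) * y powr a = 1" using y by (simp flip: powr_add)
  moreover have "exp y * exp (- y) = 1" by (simp flip: exp_add)
  moreover have "y powr (- a) * exp y / fact n * (exp (- y) * y powr a * P) = (y powr (- a) * y powr a) * (exp y * exp (- y)) * P / fact n" for P
    by simp
  ultimately show "gen_Laguerre n a y = poly (rodrigues_poly (real n + a) n) y / fact n"
    unfolding 1 rodrigues_def by simp
qed

context cev begin

definition yvar :: "real \<Rightarrow> real" where "yvar x = \<alpha> * x powr \<delta>"

abbreviation "c_n n \<equiv> real n + 1 / \<delta>"

definition eigval :: "nat \<Rightarrow> real" where "eigval n = - \<mu> * \<delta> * (real n + 1)"

definition eig_const :: "nat \<Rightarrow> real" where "eig_const n = \<alpha> powr (- 1 / \<delta>) / fact n"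

text \<open>
  The components \<open>u\<close> and \<open>J\<close> of the system for the \<open>n\<close>-th eigenfunction.  The prefactor
  \<open>x\<^sup>1\<^sup>-\<^sup>\<gamma> y\<^sup>-\<^sup>a e\<^sup>y\<close> in the eigenfunction is a constant multiple of \<open>m\<close>, because \<open>y\<^sup>-\<^sup>a\<close> is proportional to \<open>1 / x\<close>.
\<close>

definition eig_u :: "nat \<Rightarrow> real \<Rightarrow> real" where
  "eig_u n x = eig_const n * rodrigues (c_n n) n (yvar x)"

definition eig_J :: "nat \<Rightarrow> real \<Rightarrow> real" where
  "eig_J n x = \<mu> * eig_const n * (rodrigues (c_n n) (Suc n) (yvar x) * (x powr (\<delta> - 1) * exp (yvar x)))"

lemma yvar_pos: "x > 0 \<Longrightarrow> yvar x > 0" using alpha_pos by (simp add: yvar_def)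

lemma powr_delta_minus: "x > 0 \<Longrightarrow> x powr (\<delta> - 1) = x powr \<delta> / x"
  unfolding powr_diff[of x \<delta> 1] by simp

lemma yvar_deriv:
  assumes x: "x > 0"
  shows "(yvar has_real_derivative \<delta> * yvar x / x) (at x)"
proof -
  have "\<alpha> * (\<delta> * x powr (\<delta> - 1)) = \<delta> * yvar x / x"
    unfolding powr_delta_minus[OF x] yvar_def by simp
  then show ?thesis
    using DERIV_cmult[OF powr_deriv[OF x, of \<delta>], of \<alpha>] unfolding yvar_def[abs_def] by (simp only:)
qed

lemma eigenfun_eq:
  assumes x: "x > 0"
  shows "cev_eigenfun \<mu> \<sigma> \<gamma> n x = of_real (eig_u n x) / of_real (w x)"
    "cev_eigenfun \<mu> \<sigma> \<gamma> n x = of_real (x powr (1 - \<gamma>) * (poly (rodrigues_poly (c_n n) n) (yvar x) / fact n))"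
proof -
  have y: "- cev_nu \<mu> \<sigma> \<gamma> * x powr (2 - \<gamma>) = yvar x" by (simp add: yvar_def \<alpha>_def)
  show "cev_eigenfun \<mu> \<sigma> \<gamma> n x = of_real (x powr (1 - \<gamma>) * (poly (rodrigues_poly (c_n n) n) (yvar x) / fact n))"
    unfolding cev_eigenfun_def y gen_Laguerre_eq(1)[OF yvar_pos[OF x]] ..
  define D where "D = x powr (-1)"
  have A: "yvar x powr (- (1 / \<delta>)) = \<alpha> powr (- 1 / \<delta>) * D"
    unfolding yvar_def D_def using x alpha_pos delta_pos by (simp add: powr_mult powr_powr)
  have B: "x powr (1 - \<gamma>) * D = x powr (- \<gamma>)" unfolding D_def powr_add[symmetric] by simp
  have C: "x powr (- \<gamma>) * exp (yvar x) = inverse (w x)" using m_eq[of x] by (simp add: m_def yvar_def)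
  have "x powr (1 - \<gamma>) * (yvar x powr (- (1 / \<delta>)) * exp (yvar x) / fact n * rodrigues (c_n n) n (yvar x))
      = eig_u n x * ((x powr (1 - \<gamma>) * D) * exp (yvar x))"
    unfolding A eig_u_def eig_const_def by simp
  then have "x powr (1 - \<gamma>) * (yvar x powr (- (1 / \<delta>)) * exp (yvar x) / fact n * rodrigues (c_n n) n (yvar x)) = eig_u n x / w x"
    unfolding B C by (simp add: divide_inverse)
  then show "cev_eigenfun \<mu> \<sigma> \<gamma> n x = of_real (eig_u n x) / of_real (w x)"
    unfolding cev_eigenfun_def y gen_Laguerre_eq(2)[OF yvar_pos[OF x]] by simp
qed

lemma eig_u_deriv:
  assumes x: "x > 0"
  shows "(eig_u n has_real_derivative scale x * eig_J n x) (at x)"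
proof -
  have "((\<lambda>x. rodrigues (c_n n) n (yvar x)) has_real_derivative rodrigues (c_n n) (Suc n) (yvar x) * (\<delta> * yvar x / x)) (at x)"
    by (rule DERIV_chain2[OF rodrigues_deriv[OF yvar_pos[OF x]] yvar_deriv[OF x]])
  from DERIV_cmult[OF this, of "eig_const n"]
  have "(eig_u n has_real_derivative eig_const n * (rodrigues (c_n n) (Suc n) (yvar x) * (\<delta> * yvar x / x))) (at x)"
    by (simp add: eig_u_def[abs_def])
  also have "eig_const n * (rodrigues (c_n n) (Suc n) (yvar x) * (\<delta> * yvar x / x)) = scale x * eig_J n x"
  proof -
    have e: "scale x = 2 / \<sigma>\<^sup>2 * exp (- yvar x)" by (simp add: scale_def yvar_def)
    have "exp (- yvar x) * exp (yvar x) = 1" by (simp flip: exp_add)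
    then have "scale x * eig_J n x = (2 * \<mu> / \<sigma>\<^sup>2) * (eig_const n * (rodrigues (c_n n) (Suc n) (yvar x) * x powr (\<delta> - 1)))"
      unfolding e eig_J_def by (simp add: mult_ac)
    also have "\<dots> = eig_const n * (rodrigues (c_n n) (Suc n) (yvar x) * (\<delta> * (\<alpha> * x powr \<delta>) / x))"
      unfolding alpha_delta[symmetric] powr_delta_minus[OF x] by (simp add: mult_ac)
    finally show ?thesis by (simp add: yvar_def)
  qed
  finally show ?thesis .
qed

text \<open>
  In the derivative of the flux the terms with the \<open>(n + 1)\<close>-st Rodrigues function cancel, because
  \<open>a (2 - \<gamma>) = 1\<close>.
\<close>

lemma eig_J_deriv:
  assumes x: "x > 0"
  shows "(eig_J n has_real_derivative eigval n * (eig_u n x / w x)) (at x)"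
proof -
  define y where "y = yvar x"
  define R where "R k = rodrigues (c_n n) k y" for k
  define E where "E = x powr (\<delta> - 2) * exp y"
  have y: "y > 0" using yvar_pos[OF x] by (simp add: y_def)
  have 1: "((\<lambda>x. rodrigues (c_n n) (Suc n) (yvar x)) has_real_derivative R (Suc (Suc n)) * (\<delta> * y / x)) (at x)"
    unfolding R_def y_def by (rule DERIV_chain2[OF rodrigues_deriv[OF yvar_pos[OF x]] yvar_deriv[OF x]])
  have 2: "((\<lambda>x. x powr (\<delta> - 1) * exp (yvar x)) has_real_derivative
      (\<delta> - 1) * x powr (\<delta> - 1 - 1) * exp y + x powr (\<delta> - 1) * (exp y * (\<delta> * y / x))) (at x)"
    unfolding y_def by (rule DERIV_cong[OF DERIV_mult[OF powr_deriv[OF x] DERIV_chain2[OF DERIV_exp yvar_deriv[OF x]]]]) (simp add: mult_ac)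
  have x1: "x powr (\<delta> - 1) = x * x powr (\<delta> - 2)" using x powr_add[of x 1 "\<delta> - 2"] by simp
  have x2: "\<delta> - 1 - 1 = \<delta> - 2" by simp
  have d2: "(\<delta> - 1) * x powr (\<delta> - 1 - 1) * exp y + x powr (\<delta> - 1) * (exp y * (\<delta> * y / x)) = E * ((\<delta> - 1) + \<delta> * y)"
    unfolding x1 x2 E_def using x by (simp add: field_simps)
  have d1: "R (Suc (Suc n)) * (\<delta> * y / x) * (x powr (\<delta> - 1) * exp y) = E * (\<delta> * (y * R (Suc (Suc n))))"
    unfolding x1 E_def using x by (simp add: field_simps)
  have "(eig_J n has_real_derivative \<mu> * eig_const n * (R (Suc (Suc n)) * (\<delta> * y / x) * (x powr (\<delta> - 1) * exp y) + R (Suc n) * (E * ((\<delta> - 1) + \<delta> * y)))) (at x)"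
    unfolding eig_J_def[abs_def] using DERIV_cmult[OF DERIV_mult[OF 1 2[unfolded d2]], of "\<mu> * eig_const n"]
    by (simp add: R_def y_def mult_ac)
  also have "R (Suc (Suc n)) * (\<delta> * y / x) * (x powr (\<delta> - 1) * exp y) + R (Suc n) * (E * ((\<delta> - 1) + \<delta> * y)) = - (\<delta> * (real n + 1)) * (E * R n)"
  proof -
    have rec: "y * R (Suc (Suc n)) = (1 / \<delta> - 1 - y) * R (Suc n) - (real n + 1) * R n"
      using rodrigues_recurrence[OF y, of "c_n n" n] by (simp add: R_def algebra_simps)
    have "\<delta> * (1 / \<delta> - 1 - y) = 1 - \<delta> - \<delta> * y" using delta_pos by (simp add: right_diff_distrib)
    then have rec2: "\<delta> * (y * R (Suc (Suc n))) = (1 - \<delta> - \<delta> * y) * R (Suc n) - \<delta> * (real n + 1) * R n"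
      unfolding rec by (simp add: right_diff_distrib flip: mult.assoc)
    show ?thesis unfolding d1 rec2 by (simp add: algebra_simps)
  qed
  also have "\<mu> * eig_const n * (- (\<delta> * (real n + 1)) * (E * R n)) = eigval n * (eig_u n x / w x)"
  proof -
    have "E = inverse (w x)" using m_eq[of x] by (simp add: E_def m_def y_def yvar_def)
    then show ?thesis by (simp add: eigval_def eig_u_def R_def y_def divide_inverse)
  qed
  finally show ?thesis .
qed

lemma eig_primitives:
  "primitive_of (\<lambda>x. of_real (eigval n * (eig_u n x / w x))) (\<lambda>x. of_real (eig_J n x))"
  "primitive_of (\<lambda>x. of_real (scale x) * of_real (eig_J n x)) (\<lambda>x. of_real (eig_u n x))"
proof -
  have uc: "continuous_on {0<..} (eig_u n)" and Jc: "continuous_on {0<..} (eig_J n)"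
    by (intro continuous_at_imp_continuous_on ballI DERIV_isCont[OF eig_u_deriv] DERIV_isCont[OF eig_J_deriv]; simp)+
  show "primitive_of (\<lambda>x. of_real (eigval n * (eig_u n x / w x))) (\<lambda>x. of_real (eig_J n x))"
    by (intro primitive_real eig_J_deriv continuous_intros uc w_cont) (use w_pos in force)+
  have "primitive_of (\<lambda>x. of_real (scale x * eig_J n x)) (\<lambda>x. of_real (eig_u n x))"
    by (intro primitive_real eig_u_deriv continuous_intros scale_cont Jc)
  then show "primitive_of (\<lambda>x. of_real (scale x) * of_real (eig_J n x)) (\<lambda>x. of_real (eig_u n x))" by simp
qed

text \<open>
  The family in which the moment problem is solved; its span for \<open>h = 0\<close> contains the eigenfunctions.
\<close>

definition exp_moment :: "nat \<Rightarrow> real \<Rightarrow> real \<Rightarrow> complex" where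
  "exp_moment n h x = of_real (x powr (1 - \<gamma>) * (yvar x ^ n * exp (h * yvar x)))"

lemma exp_moment_cont: "continuous_on {0<..} (exp_moment n h)"
  unfolding exp_moment_def[abs_def] yvar_def by (intro continuous_intros powr_cont)

lemma exp_moment_L2:
  assumes h: "h < 1 / 2" shows "exp_moment n h \<in> L2 M"
  unfolding L2_M_iff
proof
  show "exp_moment n h \<in> borel_measurable (lebesgue_on {0<..})"
    by (rule continuous_imp_measurable_on_sets_lebesgue[OF exp_moment_cont]) simp
  have "(\<lambda>x. (\<alpha> ^ n)\<^sup>2 * (x powr (\<delta> * real (2 * n + 1)) * exp (- (\<alpha> * (1 - 2 * h)) * x powr \<delta>))) integrable_on {0<..}"
    using h alpha_pos delta_pos by (intro integrable_on_mult_right stretched_exponential_integrable) auto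
  then show "(\<lambda>x. w x * (cmod (exp_moment n h x))\<^sup>2) integrable_on {0<..}"
  proof (rule integrable_eq)
    fix x :: real assume "x \<in> {0<..}"
    then have x: "x > 0" by simp
    have p: "x powr (\<delta> * real (2 * n + 1)) = x powr \<gamma> * (x powr (1 - \<gamma>))\<^sup>2 * ((x powr \<delta>) ^ n)\<^sup>2"
    proof -
      have "((x powr \<delta>) ^ n)\<^sup>2 = x powr (\<delta> * real (2 * n))"
        using x by (simp add: powr_powr[symmetric] powr_realpow power_mult[symmetric] mult.commute)
      moreover have "x powr \<gamma> * (x powr (1 - \<gamma>))\<^sup>2 = x powr \<delta>"
        using x by (simp add: power2_eq_square flip: powr_add)
      ultimately show ?thesis by (simp add: distrib_left powr_add mult.commute)
    qed
    have e: "exp (- (\<alpha> * (1 - 2 * h)) * x powr \<delta>) = exp (- \<alpha> * x powr \<delta>) * (exp (h * yvar x))\<^sup>2"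
      by (simp add: yvar_def power2_eq_square algebra_simps flip: exp_add)
    have c: "(cmod (exp_moment n h x))\<^sup>2 = (x powr (1 - \<gamma>) * (yvar x ^ n * exp (h * yvar x)))\<^sup>2"
      unfolding exp_moment_def norm_of_real by simp
    show "(\<alpha> ^ n)\<^sup>2 * (x powr (\<delta> * real (2 * n + 1)) * exp (- (\<alpha> * (1 - 2 * h)) * x powr \<delta>)) = w x * (cmod (exp_moment n h x))\<^sup>2"
      unfolding p e c w_eq power_mult_distrib by (simp add: yvar_def power_mult_distrib mult_ac)
  qed
qed

lemma eigenfun_exp_moment:
  assumes "x > 0"
  shows "cev_eigenfun \<mu> \<sigma> \<gamma> n x = (\<Sum>i\<le>n. of_real (coeff (rodrigues_poly (c_n n) n) i / fact n) * exp_moment i 0 x)"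
proof -
  have "poly (rodrigues_poly (c_n n) n) (yvar x) = (\<Sum>i\<le>n. coeff (rodrigues_poly (c_n n) n) i * yvar x ^ i)"
    unfolding poly_altdef using rodrigues_poly_degree[of "c_n n" n]
    by (intro sum.mono_neutral_left) (auto simp: coeff_eq_0)
  then show ?thesis
    unfolding eigenfun_eq(2)[OF assms] exp_moment_def
    by (simp add: sum_distrib_left sum_divide_distrib mult_ac)
qed

lemma eigenfun_L2: "cev_eigenfun \<mu> \<sigma> \<gamma> n \<in> L2 M"
proof (rule L2_cong_AE)
  show s: "(\<lambda>x. \<Sum>i\<le>n. of_real (coeff (rodrigues_poly (c_n n) n) i / fact n) * exp_moment i 0 x) \<in> L2 M"
    by (intro L2_sum L2_scale exp_moment_L2) simp
  show "AE x in M. (\<Sum>i\<le>n. of_real (coeff (rodrigues_poly (c_n n) n) i / fact n) * exp_moment i 0 x) = cev_eigenfun \<mu> \<sigma> \<gamma> n x"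
    unfolding AE_M using eigenfun_exp_moment by (intro exI[of _ "{}"]) auto
  show "cev_eigenfun \<mu> \<sigma> \<gamma> n \<in> borel_measurable M"
    unfolding measurable_M
    by (rule borel_measurable_lebesgue_on_spike[OF L2D(1)[OF s, unfolded measurable_M] _ negligible_empty]) (use eigenfun_exp_moment in auto)
qed

end

section \<open>Totality of the eigenfunctions\<close>

lemma exp_partial_sum_bound: "\<bar>\<Sum>k<N. (z::real) ^ k / fact k\<bar> \<le> exp \<bar>z\<bar>"
proof -
  have "\<bar>\<Sum>k<N. z ^ k / fact k\<bar> \<le> (\<Sum>k<N. \<bar>z ^ k / fact k\<bar>)" by (rule sum_abs)
  also have "\<dots> = (\<Sum>k<N. \<bar>z\<bar> ^ k /\<^sub>R fact k)" by (simp add: abs_mult power_abs divide_inverse mult.commute)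
  also have "\<dots> \<le> (\<Sum>k. \<bar>z\<bar> ^ k /\<^sub>R fact k)" by (rule sum_le_suminf[OF summable_exp_generic]) auto
  finally show ?thesis by (simp add: exp_def)
qed

lemma exp_partial_sum_tendsto: "(\<lambda>N. \<Sum>k<N. (z::real) ^ k / fact k) \<longlonglongrightarrow> exp z"
  using exp_converges[of z] by (simp add: sums_def divide_inverse mult.commute)

context cev begin

abbreviation "efun \<equiv> cev_eigenfun \<mu> \<sigma> \<gamma>"

text \<open>
  The \<open>n\<close>-th Laguerre polynomial has degree exactly \<open>n\<close>, so its orthogonality relation yields the
  \<open>n\<close>-th moment from the lower ones.
\<close>

lemma moments_vanish:
  assumes f: "f \<in> L2 M" and orth: "\<And>n. L2_inner M f (efun n) = 0"
  shows "L2_inner M f (exp_moment n 0) = 0"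
proof (induction n rule: less_induct)
  case (less n)
  define a where "a i = complex_of_real (coeff (rodrigues_poly (c_n n) n) i / fact n)" for i
  have G: "exp_moment i 0 \<in> L2 M" for i by (rule exp_moment_L2) simp
  have swap: "L2_inner M (exp_moment i 0) f = 0" if "i < n" for i
    using less.IH[OF that] L2_inner_cnj[of M f "exp_moment i 0"] by simp
  have "L2_inner M (efun n) f = L2_inner M (\<lambda>x. \<Sum>i\<le>n. a i * exp_moment i 0 x) f"
  proof (rule L2_inner_cong_AE)
    show "AE x in M. efun n x = (\<Sum>i\<le>n. a i * exp_moment i 0 x)"
      unfolding AE_M a_def using eigenfun_exp_moment by (intro exI[of _ "{}"]) auto
  qed (intro L2D(1) eigenfun_L2 L2_sum L2_scale G f; assumption)+
  also have "\<dots> = (\<Sum>i\<le>n. a i * L2_inner M (exp_moment i 0) f)" by (rule L2_inner_sum[OF G f])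
  also have "\<dots> = (\<Sum>i\<in>{n}. a i * L2_inner M (exp_moment i 0) f)"
    by (rule sum.mono_neutral_right) (auto simp: swap)
  finally have "a n * L2_inner M (exp_moment n 0) f = 0"
    using orth[of n] L2_inner_cnj[of M f "efun n"] by simp
  moreover have "a n \<noteq> 0" by (simp add: a_def rodrigues_poly_lead)
  ultimately show ?case using L2_inner_cnj[of M "exp_moment n 0" f] by simp
qed

text \<open>
  Expand \<open>e\<^sup>-\<^sup>y\<^sup>/\<^sup>8\<close> in its power series and integrate term by term.  The partial sums are dominated
  by \<open>e\<^sup>y\<^sup>/\<^sup>8\<close>, which is admissible because \<open>s + 1/8 < 1/2\<close>.  All moments are carried along, so the step
  can be repeated, reaching exponents beyond the radius in which a single expansion converges.
\<close>

lemma moments_step: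
  assumes f: "f \<in> L2 M" and s: "s \<le> 0" and orth: "\<And>n. L2_inner M f (exp_moment n s) = 0"
  shows "L2_inner M f (exp_moment n (s - 1 / 8)) = 0"
proof -
  define P where "P N x = (\<Sum>k<N. of_real ((-1/8) ^ k / fact k) * exp_moment (n + k) s x)" for N x
  have G: "exp_moment i s \<in> L2 M" for i using s by (intro exp_moment_L2) simp
  have PL: "P N \<in> L2 M" for N unfolding P_def[abs_def] by (intro L2_sum L2_scale G)
  have Peq: "P N x = of_real (x powr (1 - \<gamma>) * (yvar x ^ n * exp (s * yvar x)) * (\<Sum>k<N. (- yvar x / 8) ^ k / fact k))" for N x
  proof -
    have "(-1/8) ^ k / fact k * (x powr (1 - \<gamma>) * (yvar x ^ (n + k) * exp (s * yvar x)))
       = x powr (1 - \<gamma>) * (yvar x ^ n * exp (s * yvar x)) * ((- yvar x / 8) ^ k / fact k)" for k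
    proof -
      have "(- yvar x / 8) ^ k = (-1/8) ^ k * yvar x ^ k" by (simp flip: power_mult_distrib)
      then show ?thesis by (simp add: power_add)
    qed
    note eq = this
    have "P N x = of_real (\<Sum>k<N. (-1/8) ^ k / fact k * (x powr (1 - \<gamma>) * (yvar x ^ (n + k) * exp (s * yvar x))))"
      unfolding P_def exp_moment_def by (simp only: of_real_sum of_real_mult)
    then show ?thesis unfolding eq sum_distrib_left .
  qed
  have zero: "(LINT x|M. P N x * cnj (f x)) = 0" for N
  proof -
    have "L2_inner M (P N) f = (\<Sum>k<N. of_real ((-1/8) ^ k / fact k) * L2_inner M (exp_moment (n + k) s) f)"
      unfolding P_def by (rule L2_inner_sum[OF G f])
    also have "\<dots> = 0"
    proof (rule sum.neutral, rule ballI)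
      fix k
      have "L2_inner M (exp_moment (n + k) s) f = 0" using orth[of "n + k"] L2_inner_cnj[of M f "exp_moment (n + k) s"] by simp
      then show "of_real ((-1/8) ^ k / fact k) * L2_inner M (exp_moment (n + k) s) f = 0" by simp
    qed
    finally show ?thesis by (simp add: L2_inner_def)
  qed
  have G1: "exp_moment n (s + 1/8) \<in> L2 M" and G2: "exp_moment n (s - 1/8) \<in> L2 M" using s by (auto intro!: exp_moment_L2)
  have pos: "AE x in M. x > 0" unfolding AE_M by (intro exI[of _ "{}"]) auto
  have "(\<lambda>N. LINT x|M. P N x * cnj (f x)) \<longlonglongrightarrow> (LINT x|M. exp_moment n (s - 1/8) x * cnj (f x))"
  proof (rule integral_dominated_convergence)
    show "(\<lambda>x. exp_moment n (s - 1/8) x * cnj (f x)) \<in> borel_measurable M"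
      by (rule borel_measurable_integrable[OF L2_inner_integrable[OF G2 f]])
    show "(\<lambda>x. P N x * cnj (f x)) \<in> borel_measurable M" for N
      by (rule borel_measurable_integrable[OF L2_inner_integrable[OF PL f]])
    show "integrable M (\<lambda>x. norm (exp_moment n (s + 1/8) x * cnj (f x)))"
      by (rule integrable_norm[OF L2_inner_integrable[OF G1 f]])
    show "AE x in M. (\<lambda>N. P N x * cnj (f x)) \<longlonglongrightarrow> exp_moment n (s - 1/8) x * cnj (f x)"
    proof (rule AE_I2)
      fix x
      have eq: "exp_moment n (s - 1/8) x = of_real (x powr (1 - \<gamma>) * (yvar x ^ n * exp (s * yvar x)) * exp (- yvar x / 8))"
        unfolding exp_moment_def by (simp add: mult.assoc left_diff_distrib flip: exp_add)
      show "(\<lambda>N. P N x * cnj (f x)) \<longlonglongrightarrow> exp_moment n (s - 1/8) x * cnj (f x)"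
        unfolding Peq eq by (intro tendsto_mult tendsto_of_real tendsto_const exp_partial_sum_tendsto)
    qed
    show "AE x in M. norm (P N x * cnj (f x)) \<le> norm (exp_moment n (s + 1/8) x * cnj (f x))" for N
      using pos
    proof eventually_elim
      case (elim x)
      have y: "yvar x > 0" using elim by (rule yvar_pos)
      have "\<bar>\<Sum>k<N. (- yvar x / 8) ^ k / fact k\<bar> \<le> exp (yvar x / 8)"
        using exp_partial_sum_bound[of "- yvar x / 8" N] y by simp
      then have "norm (P N x) \<le> x powr (1 - \<gamma>) * (yvar x ^ n * exp (s * yvar x)) * exp (yvar x / 8)"
        unfolding Peq norm_of_real abs_mult using y by (intro mult_mono) auto
      also have "\<dots> = norm (exp_moment n (s + 1/8) x)"
        unfolding exp_moment_def norm_of_real abs_mult using y by (simp add: mult.assoc distrib_right flip: exp_add)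
      finally show ?case by (simp add: norm_mult mult_right_mono)
    qed
  qed
  then have "(LINT x|M. exp_moment n (s - 1/8) x * cnj (f x)) = 0" unfolding zero by (simp add: LIMSEQ_const_iff)
  then have "L2_inner M (exp_moment n (s - 1/8)) f = 0" by (simp add: L2_inner_def)
  then show ?thesis using L2_inner_cnj[of M "exp_moment n (s - 1/8)" f] by simp
qed

lemma exponential_moments_vanish:
  assumes f: "f \<in> L2 M" and orth: "\<And>n. L2_inner M f (efun n) = 0"
  shows "L2_inner M f (exp_moment n (- real j / 8)) = 0"
proof (induction j arbitrary: n)
  case 0
  then show ?case using moments_vanish[OF f orth] by simp
next
  case (Suc j)
  have eq: "- real (Suc j) / 8 = - real j / 8 - 1 / 8" by simp
  show ?case unfolding eq by (rule moments_step[OF f _ Suc]) simp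
qed

text \<open>
  Polynomials in \<open>t\<close> approximate continuous functions of \<open>t\<close>, and these approximate the
  indicator functions of the intervals \<open>(0, X]\<close> because \<open>t\<close> is decreasing.
\<close>

lemma polynomial_moments_imp_zero:
  fixes \<psi> :: "real \<Rightarrow> complex" and t :: "real \<Rightarrow> real"
  assumes psi: "\<psi> absolutely_integrable_on {0<..}"
    and t: "continuous_on {0<..} t" "\<And>x. x > 0 \<Longrightarrow> t x \<in> {0..1}" "\<And>x y. 0 < x \<Longrightarrow> x < y \<Longrightarrow> t y < t x"
    and mom: "\<And>j. integral\<^sup>L (lebesgue_on {0<..}) (\<lambda>x. \<psi> x * of_real (t x ^ j)) = 0"
  shows "\<exists>N. negligible N \<and> (\<forall>x>0. x \<notin> N \<longrightarrow> \<psi> x = 0)"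
proof -
  let ?E = "lebesgue_on {0<..} :: real measure"
  have psiE: "integrable ?E \<psi>" by (rule absolutely_integrable_imp_integrable[OF psi]) simp
  have psim: "\<psi> \<in> borel_measurable ?E" by (rule borel_measurable_integrable[OF psiE])
  define K where "K = (LINT x|?E. norm (\<psi> x))"
  have K0: "K \<ge> 0" unfolding K_def by (intro Bochner_Integration.integral_nonneg) auto
  have int: "integrable ?E (\<lambda>x. \<psi> x * of_real (g (t x)))" and bound: "(\<And>s. s \<in> {0..1} \<Longrightarrow> \<bar>g s\<bar> \<le> B) \<Longrightarrow>
      norm (LINT x|?E. \<psi> x * of_real (g (t x))) \<le> B * K"
    if g: "continuous_on {0..1} g" for g :: "real \<Rightarrow> real" and B
  proof -
    have gt: "continuous_on {0<..} (\<lambda>x. g (t x))" by (rule continuous_on_compose2[OF g t(1)]) (use t(2) in auto)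
    have gm: "(\<lambda>x. \<psi> x * of_real (g (t x))) \<in> borel_measurable ?E"
      by (intro borel_measurable_times psim continuous_imp_measurable_on_sets_lebesgue continuous_intros gt) simp
    have "bounded (g ` {0..1})" by (rule compact_imp_bounded[OF compact_continuous_image[OF g compact_Icc]])
    then obtain C where "\<forall>y\<in>g ` {0..1}. norm y \<le> C" unfolding bounded_iff by blast
    then have C: "\<And>s. s \<in> {0..1} \<Longrightarrow> \<bar>g s\<bar> \<le> C" by simp
    have le: "norm (\<psi> x * of_real (g (t x))) \<le> D * norm (\<psi> x)" if "\<And>s. s \<in> {0..1} \<Longrightarrow> \<bar>g s\<bar> \<le> D" "x \<in> space ?E" for x D
    proof -
      have "\<bar>g (t x)\<bar> * norm (\<psi> x) \<le> D * norm (\<psi> x)" using that t(2)[of x] by (intro mult_right_mono) auto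
      then show ?thesis by (simp add: norm_mult mult.commute)
    qed
    show i: "integrable ?E (\<lambda>x. \<psi> x * of_real (g (t x)))"
    proof (rule Bochner_Integration.integrable_bound[OF integrable_mult_right[OF integrable_norm[OF psiE], of C] gm], rule AE_I2)
      fix x assume "x \<in> space ?E"
      from le[OF C this] show "norm (\<psi> x * of_real (g (t x))) \<le> norm (C * norm (\<psi> x))" by simp
    qed
    assume B: "\<And>s. s \<in> {0..1} \<Longrightarrow> \<bar>g s\<bar> \<le> B"
    have "norm (LINT x|?E. \<psi> x * of_real (g (t x))) \<le> (LINT x|?E. norm (\<psi> x * of_real (g (t x))))"
      by (rule integral_norm_bound)
    also have "\<dots> \<le> (LINT x|?E. B * norm (\<psi> x))"
      by (intro integral_mono integrable_norm i integrable_mult_right psiE le B)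
    finally show "norm (LINT x|?E. \<psi> x * of_real (g (t x))) \<le> B * K" by (simp add: K_def)
  qed
  have poly0: "(LINT x|?E. \<psi> x * of_real (q (t x))) = 0" if "real_polynomial_function q" for q
  proof -
    obtain a n where q: "q = (\<lambda>s. \<Sum>i\<le>n. a i * s ^ i)" using \<open>real_polynomial_function q\<close> real_polynomial_function_iff_sum by auto
    have "(LINT x|?E. \<psi> x * of_real (q (t x))) = (LINT x|?E. (\<Sum>i\<le>n. of_real (a i) * (\<psi> x * of_real (t x ^ i))))"
      unfolding q by (simp add: sum_distrib_left mult_ac)
    also have "\<dots> = (\<Sum>i\<le>n. (LINT x|?E. of_real (a i) * (\<psi> x * of_real (t x ^ i))))"
    proof (rule Bochner_Integration.integral_sum)
      fix i
      show "integrable ?E (\<lambda>x. of_real (a i) * (\<psi> x * of_real (t x ^ i)))"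
        by (rule integrable_mult_right[OF int]) (intro continuous_intros)
    qed
    also have "\<dots> = 0" by (intro sum.neutral ballI) (simp add: mom[simplified])
    finally show ?thesis .
  qed
  have cont0: "(LINT x|?E. \<psi> x * of_real (g (t x))) = 0" if g: "continuous_on {0..1} g" for g
  proof -
    have "norm (LINT x|?E. \<psi> x * of_real (g (t x))) \<le> e" if e: "e > 0" for e
    proof -
      have e': "e / (K + 1) > 0" using e K0 by simp
      obtain q where q: "real_polynomial_function q" "\<And>s. s \<in> {0..1} \<Longrightarrow> \<bar>g s - q s\<bar> < e / (K + 1)"
        using Stone_Weierstrass_real_polynomial_function[OF _ g e'] by (metis compact_Icc)
      have qc: "continuous_on {0..1} q"
        using q(1) continuous_on_polymonial_function real_polynomial_function_eq by blast
      have "(LINT x|?E. \<psi> x * of_real (g (t x))) = (LINT x|?E. \<psi> x * of_real (g (t x))) - (LINT x|?E. \<psi> x * of_real (q (t x)))"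
        using poly0[OF q(1)] by simp
      also have "\<dots> = (LINT x|?E. \<psi> x * of_real ((\<lambda>s. g s - q s) (t x)))"
        unfolding Bochner_Integration.integral_diff[OF int[OF g] int[OF qc], symmetric] by (simp add: right_diff_distrib)
      also have "norm \<dots> \<le> e / (K + 1) * K"
        by (rule bound) (use q(2) in \<open>auto intro!: continuous_intros g qc less_imp_le\<close>)
      also have "\<dots> \<le> e" using e K0 by (simp add: field_simps)
      finally show ?thesis .
    qed
    then have "norm (LINT x|?E. \<psi> x * of_real (g (t x))) \<le> 0" by (rule field_le_epsilon[where y = 0, simplified])
    then show ?thesis by simp
  qed
  have ind0: "(LINT x|?E. \<psi> x * of_real (if x \<le> X then 1 else 0)) = 0" if X: "X > 0" for X
  proof -
    \<comment> \<open>Continuous ramps that decrease to the indicator function of \<open>[t X, 1]\<close>.\<close>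
    define g where "g k s = max 0 (min 1 (1 + real k * (s - t X)))" for k s
    have gc: "continuous_on {0..1} (g k)" for k unfolding g_def[abs_def] by (intro continuous_intros)
    have "(\<lambda>k. LINT x|?E. \<psi> x * of_real (g k (t x))) \<longlonglongrightarrow> (LINT x|?E. \<psi> x * of_real (if x \<le> X then 1 else 0))"
    proof (rule integral_dominated_convergence[where w = "\<lambda>x. norm (\<psi> x)"])
      show "integrable ?E (\<lambda>x. norm (\<psi> x))" by (rule integrable_norm[OF psiE])
      show "(\<lambda>x. \<psi> x * of_real (g k (t x))) \<in> borel_measurable ?E" for k
        by (rule borel_measurable_integrable[OF int[OF gc]])
      have "(\<lambda>x::real. complex_of_real (if x \<le> X then 1 else 0)) \<in> borel_measurable borel" by measurable
      then have "(\<lambda>x::real. complex_of_real (if x \<le> X then 1 else 0)) \<in> borel_measurable lebesgue"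
        by (intro measurable_completion) simp
      then show "(\<lambda>x. \<psi> x * of_real (if x \<le> X then 1 else 0)) \<in> borel_measurable ?E"
        by (intro borel_measurable_times psim measurable_restrict_space1)
      show "AE x in ?E. norm (\<psi> x * of_real (g k (t x))) \<le> norm (\<psi> x)" for k
        by (rule AE_I2) (auto simp: norm_mult g_def intro!: mult_left_le)
      show "AE x in ?E. (\<lambda>k. \<psi> x * of_real (g k (t x))) \<longlonglongrightarrow> \<psi> x * of_real (if x \<le> X then 1 else 0)"
      proof (rule AE_I2)
        fix x assume "x \<in> space ?E"
        then have x: "x > 0" by simp
        have "(\<lambda>k. g k (t x)) \<longlonglongrightarrow> (if x \<le> X then 1 else 0)"
        proof (cases "x \<le> X")
          case True
          then have "t X \<le> t x" using t(3)[OF x, of X] by (cases "x = X") auto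
          then have "g k (t x) = 1" for k by (simp add: g_def)
          then show ?thesis using True by simp
        next
          case False
          then have lt: "t x - t X < 0" using t(3)[OF X, of x] by simp
          obtain n :: nat where n: "1 / (t X - t x) < real n" using reals_Archimedean2 by blast
          have "g k (t x) = 0" if "k \<ge> n" for k
          proof -
            have "1 / (t X - t x) < real k" using n that by linarith
            then have "1 + real k * (t x - t X) < 0" using lt by (simp add: field_simps)
            then show ?thesis by (simp add: g_def)
          qed
          then show ?thesis using False by (intro tendsto_eventually eventually_sequentiallyI[of n]) simp
        qed
        then show "(\<lambda>k. \<psi> x * of_real (g k (t x))) \<longlonglongrightarrow> \<psi> x * of_real (if x \<le> X then 1 else 0)"
          by (intro tendsto_mult tendsto_const tendsto_of_real)
      qed
    qed
    then show ?thesis unfolding cont0[OF gc] by (simp add: LIMSEQ_const_iff)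
  qed
  have sub_abs: "\<psi> absolutely_integrable_on S" if "S \<subseteq> {0<..}" "S \<in> sets lebesgue" for S
    by (rule set_integrable_subset[OF psi that(2,1)])
  have HK0: "(\<psi> has_integral 0) {0<..X}" if X: "X > 0" for X
  proof -
    have i: "\<psi> integrable_on {0<..X}" by (rule set_lebesgue_integral_eq_integral(1)[OF sub_abs]) auto
    have "integral {0<..X} \<psi> = integral\<^sup>L (lebesgue_on {0<..X}) \<psi>"
      by (rule lebesgue_integral_eq_integral[symmetric, OF absolutely_integrable_imp_integrable[OF sub_abs]]) auto
    also have "\<dots> = (LINT x|lebesgue. indicator {0<..X} x *\<^sub>R \<psi> x)" by (rule integral_restrict_space) simp
    also have "\<dots> = (LINT x|lebesgue. indicator {0<..} x *\<^sub>R (\<psi> x * of_real (if x \<le> X then 1 else 0)))"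
      by (intro Bochner_Integration.integral_cong) (auto simp: indicator_def)
    also have "\<dots> = (LINT x|?E. \<psi> x * of_real (if x \<le> X then 1 else 0))" by (rule integral_restrict_space[symmetric]) simp
    finally show ?thesis using ind0[OF X] integrable_integral[OF i] by simp
  qed
  have prim: "primitive_of \<psi> (\<lambda>x. 0)"
  proof (rule primitive_ofI)
    fix x y :: real assume xy: "0 < x" "x \<le> y"
    show abs: "\<psi> absolutely_integrable_on {x..y}" by (rule sub_abs) (use xy in auto)
    have i: "(\<psi> has_integral integral {x..y} \<psi>) {x..y}"
      by (rule integrable_integral[OF set_lebesgue_integral_eq_integral(1)[OF abs]])
    have "(\<psi> has_integral 0 + integral {x..y} \<psi>) ({0<..x} \<union> {x..y})"
      by (rule has_integral_Un[OF HK0[OF xy(1)] i]) (rule negligible_subset[of "{x}"]; auto)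
    moreover have "{0<..x} \<union> {x..y} = {0<..y}" using xy by auto
    ultimately have "integral {x..y} \<psi> = 0"
      using HK0[of y] xy by (simp add: has_integral_unique)
    then show "(\<psi> has_integral 0 - 0) {x..y}" using i by simp
  qed
  obtain N where N: "negligible N" "\<And>x. x > 0 \<Longrightarrow> x \<notin> N \<Longrightarrow> ((\<lambda>x. 0::complex) has_vector_derivative \<psi> x) (at x)"
    by (rule primitive_of_deriv[OF prim]) (erule that, blast)
  have "\<psi> x = 0" if "x > 0" "x \<notin> N" for x
    using vector_derivative_unique_at[OF N(2)[OF that] has_vector_derivative_const] .
  with N(1) show ?thesis by blast
qed

theorem eigenfun_total:
  assumes f: "f \<in> L2 M" and orth: "\<And>n. L2_inner M f (efun n) = 0"
  shows "AE x in M. f x = 0"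
proof -
  define \<psi> where "\<psi> x = of_real (w x) * (f x * cnj (exp_moment 0 0 x))" for x
  define t where "t x = exp (- yvar x / 8)" for x
  have GL: "exp_moment 0 (- real j / 8) \<in> L2 M" for j by (rule exp_moment_L2) (simp add: add_pos_nonneg)
  have G0: "exp_moment 0 0 \<in> L2 M" using GL[of 0] by simp
  have Gj: "cnj (exp_moment 0 (- real j / 8) x) = cnj (exp_moment 0 0 x) * of_real (t x ^ j)" for j x
    unfolding exp_moment_def t_def by (simp add: exp_of_nat_mult[symmetric])
  have "\<exists>N. negligible N \<and> (\<forall>x>0. x \<notin> N \<longrightarrow> \<psi> x = 0)"
  proof (rule polynomial_moments_imp_zero)
    show "\<psi> absolutely_integrable_on {0<..}" unfolding \<psi>_def[abs_def] by (rule L2_inner_M(1)[OF f G0])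
    show "continuous_on {0<..} t" unfolding t_def[abs_def] yvar_def by (intro continuous_intros powr_cont) simp
    show "t x \<in> {0..1}" if "x > 0" for x using yvar_pos[OF that] by (simp add: t_def)
    show "t y < t x" if "0 < x" "x < y" for x y
      unfolding t_def yvar_def using that alpha_pos delta_pos by (auto intro!: mult_strict_left_mono powr_less_mono2)
    fix j
    have m: "(\<lambda>x. of_real (w x) * (f x * cnj (exp_moment 0 (- real j / 8) x))) absolutely_integrable_on {0<..}"
      by (rule L2_inner_M(1)[OF f GL])
    have "integral\<^sup>L (lebesgue_on {0<..}) (\<lambda>x. \<psi> x * of_real (t x ^ j)) = integral\<^sup>L (lebesgue_on {0<..}) (\<lambda>x. of_real (w x) * (f x * cnj (exp_moment 0 (- real j / 8) x)))"
      unfolding Gj \<psi>_def by (simp add: mult.assoc)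
    also have "\<dots> = L2_inner M f (exp_moment 0 (- real j / 8))"
      unfolding L2_inner_M(2)[OF f GL]
      by (rule lebesgue_integral_eq_integral[OF absolutely_integrable_imp_integrable[OF m]]) auto
    also have "\<dots> = 0" by (rule exponential_moments_vanish[OF f orth])
    finally show "integral\<^sup>L (lebesgue_on {0<..}) (\<lambda>x. \<psi> x * of_real (t x ^ j)) = 0" .
  qed
  then obtain N where N: "negligible N" "\<And>x. x > 0 \<Longrightarrow> x \<notin> N \<Longrightarrow> \<psi> x = 0" by blast
  have "f x = 0" if "x > 0" "x \<notin> N" for x
    using N(2)[OF that] w_pos[OF that(1)] that(1) by (simp add: \<psi>_def exp_moment_def)
  then show ?thesis unfolding AE_M using N(1) by blast
qed

end

section \<open>Self-adjointness and spectrum\<close>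

context cev begin

lemma eigval_inj: "inj eigval"
proof (rule injI)
  fix i j assume "eigval i = eigval j"
  then show "i = j" using mu delta_pos by (simp add: eigval_def)
qed

lemma eigval_dist: "eigval i - eigval j = \<mu> * \<delta> * (real j - real i)"
  by (simp add: eigval_def algebra_simps)

lemma eigval_isolated:
  "\<exists>U. open U \<and> U \<inter> range (\<lambda>n. complex_of_real (eigval n)) = {complex_of_real (eigval n)}"
proof (intro exI conjI)
  define \<kappa> where "\<kappa> = \<mu> * \<delta>"
  have k: "\<kappa> > 0" using mu delta_pos by (simp add: \<kappa>_def)
  show "open (ball (complex_of_real (eigval n)) \<kappa>)" by simp
  have near: "i = n" if "dist (complex_of_real (eigval n)) (of_real (eigval i)) < \<kappa>" for i
  proof -
    have "\<kappa> * \<bar>real i - real n\<bar> < \<kappa> * 1"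
      using that k unfolding dist_norm of_real_diff[symmetric] norm_of_real eigval_dist \<kappa>_def[symmetric] by (simp add: abs_mult)
    then have "\<bar>real i - real n\<bar> < 1" using k by simp
    then show ?thesis by linarith
  qed
  show "ball (complex_of_real (eigval n)) \<kappa> \<inter> range (\<lambda>n. complex_of_real (eigval n)) = {complex_of_real (eigval n)}"
  proof (intro equalityI subsetI)
    fix z assume "z \<in> ball (complex_of_real (eigval n)) \<kappa> \<inter> range (\<lambda>n. complex_of_real (eigval n))"
    then obtain i where i: "z = of_real (eigval i)" "dist (complex_of_real (eigval n)) (of_real (eigval i)) < \<kappa>"
      unfolding mem_ball[symmetric] by blast
    show "z \<in> {complex_of_real (eigval n)}" using near[OF i(2)] i(1) by simp
  qed (use k in auto)
qed

lemma eigval_gap: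
  assumes z: "z \<notin> range (\<lambda>n. complex_of_real (eigval n))"
  shows "\<exists>d>0. \<forall>n. d \<le> cmod (of_real (eigval n) - z)"
proof -
  define \<kappa> where "\<kappa> = \<mu> * \<delta>"
  have k: "\<kappa> > 0" using mu delta_pos by (simp add: \<kappa>_def)
  obtain N :: nat where "(cmod z + 1) / \<kappa> < real N" using reals_Archimedean2 by blast
  then have N: "cmod z + 1 < \<kappa> * real N" using k by (simp add: field_simps)
  define d where "d = Min (insert 1 ((\<lambda>n. cmod (of_real (eigval n) - z)) ` {..<N}))"
  have "d > 0" unfolding d_def using z by (subst Min_gr_iff) (auto simp: image_iff)
  moreover have "d \<le> cmod (of_real (eigval n) - z)" for n
  proof (cases "n < N")
    case True
    then show ?thesis unfolding d_def by (intro Min_le) auto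
  next
    case False
    have "eigval n = - (\<kappa> * (real n + 1))" by (simp add: eigval_def \<kappa>_def)
    then have "cmod (of_real (eigval n)) = \<kappa> * (real n + 1)" using k by (simp only: norm_of_real abs_minus_cancel) simp
    moreover have "\<kappa> * real N \<le> \<kappa> * (real n + 1)" using False k by (intro mult_left_mono) auto
    ultimately have "1 \<le> cmod (of_real (eigval n) - z)"
      using N norm_triangle_ineq2[of "of_real (eigval n)" z] by linarith
    moreover have "d \<le> 1" unfolding d_def by (intro Min_le) auto
    ultimately show ?thesis by linarith
  qed
  ultimately show ?thesis by blast
qed

lemma eigenfun_T: "(efun n, \<lambda>x. of_real (eigval n) * efun n x) \<in> T"
proof (rule cev_op_intro[OF eig_primitives(1)[of n] eig_primitives(2)[of n] eigenfun_L2 _ L2_scale[OF eigenfun_L2]])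
  show "AE x in M. efun n x = of_real (eig_u n x) / of_real (w x)"
    unfolding AE_M using eigenfun_eq(1) by (intro exI[of _ "{}"]) auto
  show "AE x in M. of_real (eigval n) * efun n x = of_real (eigval n * (eig_u n x / w x))"
    unfolding AE_M using eigenfun_eq(1) by (intro exI[of _ "{}"]) auto
qed

text \<open>
  A nonzero polynomial in \<open>y\<close> has only finitely many zeros.
\<close>

lemma eigenfun_nonzero: "\<not> (AE x in M. efun n x = 0)"
proof
  assume "AE x in M. efun n x = 0"
  then obtain N where N: "negligible N" "\<And>x. x > 0 \<Longrightarrow> x \<notin> N \<Longrightarrow> efun n x = 0" unfolding AE_M by blast
  let ?P = "rodrigues_poly (c_n n) n"
  have "?P \<noteq> 0" using rodrigues_poly_lead[of "c_n n" n] by auto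
  then have fin: "finite {y. poly ?P y = 0}" by (rule poly_roots_finite)
  have inj: "inj_on yvar {0<..}"
  proof (rule inj_onI)
    fix x y assume "x \<in> {0<..}" "y \<in> {0<..}" "yvar x = yvar y"
    then show "x = y"
      using alpha_pos delta_pos powr_less_mono2[of \<delta> x y] powr_less_mono2[of \<delta> y x]
      by (cases x y rule: linorder_cases) (auto simp: yvar_def)
  qed
  have fin': "finite {x\<in>{0<..}. yvar x \<in> {y. poly ?P y = 0}}"
    using finite_vimage_IntI[OF fin inj] by (rule finite_subset[rotated]) auto
  have "negligible (N \<union> {x\<in>{0<..}. yvar x \<in> {y. poly ?P y = 0}})"
    by (rule negligible_Un[OF N(1) negligible_finite[OF fin']])
  moreover have "{0<..} \<subseteq> N \<union> {x\<in>{0<..}. yvar x \<in> {y. poly ?P y = 0}}"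
  proof
    fix x :: real assume x: "x \<in> {0<..}"
    show "x \<in> N \<union> {x\<in>{0<..}. yvar x \<in> {y. poly ?P y = 0}}"
    proof (cases "x \<in> N")
      case False
      then have "efun n x = 0" using N(2) x by simp
      then have "poly ?P (yvar x) = 0" using x by (simp add: eigenfun_eq(2) del: of_real_mult of_real_divide)
      then show ?thesis using x by simp
    qed simp
  qed
  ultimately have "negligible {0::real<..}" by (rule negligible_subset)
  then show False using open_not_negligible[of "{0::real<..}"] by auto
qed

definition normalized_efun :: "nat \<Rightarrow> real \<Rightarrow> complex" where
  "normalized_efun n x = of_real (inverse (L2_norm M (efun n))) * efun n x"

lemma eigenfun_norm_pos: "L2_norm M (efun n) > 0"
  using eigenfun_nonzero[of n] L2_norm_eq_0[OF eigenfun_L2, of n] L2_norm_nonneg[of M "efun n"] by simp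

lemma eigenfun_orthogonal:
  assumes "i \<noteq> j" shows "L2_inner M (efun i) (efun j) = 0"
proof -
  have "of_real (eigval i) * L2_inner M (efun i) (efun j) = of_real (eigval j) * L2_inner M (efun i) (efun j)"
    using cev_op_symmetric[OF eigenfun_T[of i] eigenfun_T[of j]] by (simp add: L2_inner_scale L2_inner_scale_right)
  moreover have "eigval i \<noteq> eigval j" using eigval_inj assms by (auto dest: injD)
  ultimately show ?thesis by simp
qed

sublocale spectral: diagonal_operator M normalized_efun T eigval
proof
  show "normalized_efun n \<in> L2 M" for n unfolding normalized_efun_def[abs_def] by (intro L2_scale eigenfun_L2)
  show "L2_inner M (normalized_efun i) (normalized_efun j) = (if i = j then 1 else 0)" for i j
    unfolding normalized_efun_def[abs_def] L2_inner_scale L2_inner_scale_right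
    using eigenfun_norm_pos[of j] by (simp add: eigenfun_orthogonal L2_inner_self power2_eq_square field_simps)
  show "AE x in M. f x = 0" if "f \<in> L2 M" "\<And>n. L2_inner M f (normalized_efun n) = 0" for f
  proof (rule eigenfun_total[OF that(1)])
    show "L2_inner M f (efun n) = 0" for n
      using that(2)[of n] eigenfun_norm_pos[of n] unfolding normalized_efun_def[abs_def] L2_inner_scale_right by simp
  qed
  show "(normalized_efun n, \<lambda>x. of_real (eigval n) * normalized_efun n x) \<in> T" for n
    using cev_op_sum[of "{0::nat}" "\<lambda>_. efun n" "\<lambda>_. \<lambda>x. of_real (eigval n) * efun n x" "\<lambda>_. of_real (inverse (L2_norm M (efun n)))"] eigenfun_T[of n]
    by (simp add: normalized_efun_def[abs_def] mult_ac)
  show "f \<in> L2 M \<and> h \<in> L2 M" if "(f, h) \<in> T" for f h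
    using that by (auto simp: cev_op_def)
qed (fact cev_op_sum cev_op_symmetric cev_op_closed eigval_gap eigval_isolated eigval_inj)+

end

theorem mainTheorem2:
  fixes \<mu> \<sigma> \<gamma> :: real
  assumes "\<mu> > 0" and "\<sigma> > 0" and "1 \<le> \<gamma>" and "\<gamma> < 2"
  shows "cev_limit_point \<mu> \<sigma> \<gamma> (at_right 0) \<and>
         cev_limit_point \<mu> \<sigma> \<gamma> at_top \<and>
         self_adjoint_op (cev_measure \<mu> \<sigma> \<gamma>) (cev_op \<mu> \<sigma> \<gamma>) \<and>
         purely_discrete_spectrum (cev_measure \<mu> \<sigma> \<gamma>) (cev_op \<mu> \<sigma> \<gamma>) \<and>
         spectrum_op (cev_measure \<mu> \<sigma> \<gamma>) (cev_op \<mu> \<sigma> \<gamma>) =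
           range (\<lambda>n :: nat. complex_of_real (- \<mu> * (2 - \<gamma>) * (real n + 1))) \<and>
         (\<forall>n. eigenfunction_op (cev_measure \<mu> \<sigma> \<gamma>) (cev_op \<mu> \<sigma> \<gamma>)
                (complex_of_real (- \<mu> * (2 - \<gamma>) * (real n + 1)))
                (cev_eigenfun \<mu> \<sigma> \<gamma> n))"
proof -
  interpret cev \<mu> \<sigma> \<gamma> using assms by unfold_locales
  have "eigenfunction_op M T (complex_of_real (eigval n)) (efun n)" for n
    unfolding eigenfunction_op_def using eigenfun_T eigenfun_nonzero by blast
  then show ?thesis
    using limit_point spectral.T_self_adjoint spectral.T_purely_discrete spectral.T_spectrum
    unfolding eigval_def by blast
qed

end
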